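(* Let $X_n=\frac{1}{\sqrt n}(a_n(p,q))_{p,q=1,\dots,n}$ be the classical Wigner ensemble with complex matrix entries: $X_n$ is hermitian, the entries $a_n(p,q)$, $1\le p\le q\le n$, are independent and centered with $\sup_n\max_{p,q}\mathbb{E}(|a_n(p,q)|^k)<\infty$ for all $k\in\mathbb{N}$, and each $a_n(p,q)$ with $p<q$ has the distribution of a fixed complex random variable $a$ with $\mathbb{E}(|a|^2)=s^2>0$. Then, as $n\to\infty$, the random variables $\{\operatorname{Tr}(T_m(X_n,s))-\mathbb{E}\operatorname{Tr}(T_m(X_n,s))\}_{m\ge2}$ converge jointly in distribution to independent centered Gaussians $\{Y_m\}_{m\ge2}$ with $$\mathbb{E}(Y_2^2)=2\left(\mathbb{E}(|a|^4)-\mathbb{E}(|a|^2)^2\right)$$ and, for $m\ge3$, $$\mathbb{E}(Y_m^2)=m\,\mathbb{E}(|a|^2)^m+m\sum_{k=1}^{\lfloor m/2\rfloor}\frac{A_{m-1,k}}{(m-1)!}\left([\mathbb{E}(a^{2})]^{k}\,[\mathbb{E}(\overline{a}^{2})]^{m-k}+\delta_{k\ne\frac m2}\,[\mathbb{E}(a^{2})]^{m-k}\,[\mathbb{E}(\overline{a}^{2})]^{k}\right),$$ where $\delta_{k\neq \frac m2}$ equals $1$ if $k\ne m/2$ and $0$ if $k=m/2$.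
   Context: Rescaled Chebyshev polynomials: for $m\ge1$, $T_m$ is the monic polynomial determined by $T_m(2\cos\theta)=2\cos(m\theta)$, and $T_m(x,s)=s^mT_m(x/s)$. Eulerian numbers: $A_{m,k}=\sum_{j=0}^k(-1)^j(k-j)^m\frac{(m+1)!}{j!\,(m+1-j)!}$. Joint convergence in distribution of a sequence of random variables means convergence in distribution of all finite subfamilies. *)

theory Defs
  imports
    "HOL-Probability.Probability"
    "HOL-Computational_Algebra.Polynomial"
    "Jordan_Normal_Form.Matrix"
begin

text \<open>The rescaled Chebyshev polynomial of the first kind; meaningful for \<open>m \<ge> 1\<close>, where it exists
  and is unique (lemma \<open>cheb_ex1\<close> below).\<close>

definition cheb :: "nat \<Rightarrow> real poly" where
  "cheb m = (THE p. lead_coeff p = 1 \<and> (\<forall>\<theta>::real. poly p (2 * cos \<theta>) = 2 * cos (real m * \<theta>)))"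

lemma cheb_exists:
  assumes "m \<ge> 1"
  shows "\<exists>p :: real poly. degree p = m \<and> lead_coeff p = 1 \<and>
           (\<forall>\<theta>::real. poly p (2 * cos \<theta>) = 2 * cos (real m * \<theta>))"
  using assms
proof (induction m rule: less_induct)
  case (less m)
  consider "m = 1" | "m = 2" | k where "m = Suc (Suc k)" "k \<ge> 1"
    using less.prems by (metis One_nat_def Suc_1 Suc_le_D le_SucE le_less_Suc_eq le_zero_eq
        not_less_eq_eq)
  then show ?case
  proof cases
    case 1
    show ?thesis by (rule exI[of _ "[:0, 1:]"]) (simp add: 1)
  next
    case 2
    have "cos (2 * \<theta>) = 2 * (cos \<theta> * cos \<theta>) - 1" for \<theta> :: real
      by (simp add: cos_double_cos power2_eq_square)
    then show ?thesis
      by (intro exI[of _ "[:-2, 0, 1:]"]) (simp add: 2)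
  next
    case 3
    from less.IH[of k] less.IH[of "Suc k"] 3 obtain p q :: "real poly" where
      p: "degree p = k" "\<And>\<theta>::real. poly p (2 * cos \<theta>) = 2 * cos (real k * \<theta>)" and
      q: "degree q = Suc k" "lead_coeff q = 1"
         "\<And>\<theta>::real. poly q (2 * cos \<theta>) = 2 * cos (real (Suc k) * \<theta>)"
      by auto
    let ?r = "pCons 0 q - p"
    have q0: "q \<noteq> 0" using q(2) by auto
    have dq: "degree (pCons 0 q) = m" using q(1) q0 3 by simp
    have d: "degree ?r = m"
      using degree_add_eq_left[of "- p" "pCons 0 q"] dq p(1) 3 by simp
    have lc: "lead_coeff ?r = 1"
      using d p(1) q 3 by (simp add: coeff_eq_0)
    have "poly ?r (2 * cos \<theta>) = 2 * cos (real m * \<theta>)" for \<theta> :: real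
    proof -
      have a: "real m * \<theta> = real (Suc k) * \<theta> + \<theta>" "real k * \<theta> = real (Suc k) * \<theta> - \<theta>"
        using 3 by (auto simp: algebra_simps)
      show ?thesis
        by (simp only: poly_diff poly_pCons p(2) q(3) a cos_add cos_diff) (simp add: algebra_simps)
    qed
    with d lc show ?thesis by blast
  qed
qed

lemma cheb_ex1:
  assumes "m \<ge> 1"
  shows "\<exists>!p :: real poly. lead_coeff p = 1 \<and>
           (\<forall>\<theta>::real. poly p (2 * cos \<theta>) = 2 * cos (real m * \<theta>))"
proof (rule ex_ex1I)
  show "\<exists>p :: real poly. lead_coeff p = 1 \<and>
           (\<forall>\<theta>::real. poly p (2 * cos \<theta>) = 2 * cos (real m * \<theta>))"
    using cheb_exists[OF assms] by blast
next
  fix p q :: "real poly"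
  assume "lead_coeff p = 1 \<and> (\<forall>\<theta>::real. poly p (2 * cos \<theta>) = 2 * cos (real m * \<theta>))"
    and "lead_coeff q = 1 \<and> (\<forall>\<theta>::real. poly q (2 * cos \<theta>) = 2 * cos (real m * \<theta>))"
  then have eq: "poly (p - q) (2 * cos \<theta>) = 0" for \<theta> :: real by simp
  have "{-2..2} \<subseteq> {x. poly (p - q) x = 0}"
  proof
    fix x :: real assume "x \<in> {-2..2}"
    then have "x = 2 * cos (arccos (x / 2))" by simp
    then show "x \<in> {x. poly (p - q) x = 0}" using eq[of "arccos (x / 2)"] by simp
  qed
  moreover have "infinite {-2..2::real}" by simp
  ultimately have "infinite {x. poly (p - q) x = 0}" using finite_subset by blast
  then have "p - q = 0" using poly_roots_finite by blast
  then show "p = q" by simp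
qed

definition cheb_scaled :: "nat \<Rightarrow> real \<Rightarrow> real poly" where
  "cheb_scaled m s = Polynomial.smult (s ^ m) (pcompose (cheb m) [:0, 1 / s:])"

text \<open>The binomial coefficient is the quotient of factorials \<open>(m+1)! / (j! (m+1-j)!)\<close>, read as \<open>0\<close>
  for \<open>j > m + 1\<close>.\<close>

definition eulerian :: "nat \<Rightarrow> nat \<Rightarrow> int" where
  "eulerian m k = (\<Sum>j=0..k. (- 1) ^ j * (int k - int j) ^ m * int ((m + 1) choose j))"

definition poly_mat :: "real poly \<Rightarrow> complex mat \<Rightarrow> complex mat" where
  "poly_mat p A = mat (dim_row A) (dim_row A)
     (\<lambda>ij. \<Sum>k\<le>degree p. complex_of_real (coeff p k) * (A ^\<^sub>m k) $$ ij)"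

definition trace_mat :: "complex mat \<Rightarrow> complex" where
  "trace_mat A = (\<Sum>i<dim_row A. A $$ (i, i))"

definition wigner_mat :: "nat \<Rightarrow> (nat \<Rightarrow> nat \<Rightarrow> complex) \<Rightarrow> complex mat" where
  "wigner_mat n a = mat n n (\<lambda>(p, q). a p q / complex_of_real (sqrt (real n)))"

text \<open>Gaussians of variance \<open>0\<close> are allowed: they are the almost surely vanishing variables.\<close>

definition centered_gaussian :: "'a measure \<Rightarrow> ('a \<Rightarrow> real) \<Rightarrow> bool" where
  "centered_gaussian M Y \<longleftrightarrow> Y \<in> borel_measurable M \<and>
     ((AE \<omega> in M. Y \<omega> = 0) \<or>
      (\<exists>\<sigma>>0. distributed M lborel Y (\<lambda>x. ennreal (normal_density 0 \<sigma> x))))"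

text \<open>For each finite \<open>J \<subseteq> I\<close> the random vectors \<open>(Z n j)\<close> with \<open>j \<in> J\<close> converge in distribution:
  the test functions are the bounded continuous real functions on the power of \<open>'c\<close> indexed by \<open>J\<close>,
  whose points are the functions that are \<open>undefined\<close> outside \<open>J\<close>.\<close>

definition joint_conv_distr ::
  "(nat \<Rightarrow> 'a measure) \<Rightarrow> (nat \<Rightarrow> 'i \<Rightarrow> 'a \<Rightarrow> 'c::topological_space) \<Rightarrow>
   'b measure \<Rightarrow> ('i \<Rightarrow> 'b \<Rightarrow> 'c) \<Rightarrow> 'i set \<Rightarrow> bool" where
  "joint_conv_distr M Z N Y I \<longleftrightarrow>
     (\<forall>J f. finite J \<and> J \<subseteq> I \<and>
        continuous_map (product_topology (\<lambda>_. euclidean) J) euclideanreal f \<and>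
        bounded (f ` (\<Pi>\<^sub>E j\<in>J. UNIV)) \<longrightarrow>
        (\<lambda>n. \<integral>\<omega>. f (\<lambda>j\<in>J. Z n j \<omega>) \<partial>M n) \<longlonglongrightarrow> (\<integral>\<omega>. f (\<lambda>j\<in>J. Y j \<omega>) \<partial>N))"

end

(*
Idea. Since T_m counts the partial matchings of an m-cycle by adjacent pairs, Tr T_m(X_n, s) is n^(-m/2)
times a sum over closed walks p of length m of weights W(p) in which a matched pair of steps (necessarily a
backtracking step) contributes -s^2 in place of |a|^2. If some vertex is visited exactly once, W(p) has
a centred factor that is independent of everything else (a * a' with different edges, or |a|^2 - s^2), so
the mixed moment of the centred weights of a family of walks vanishes. Hence only families in which every
vertex is visited at least twice count; there are O(n^(L/2)) of them, L being the total length, and up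
to O(n^((L-1)/2)) of them every vertex is visited exactly twice. For these, a walk sharing an edge with
another walk must have the same vertices, since otherwise at the place where it leaves the other walk
some edge is used only once. So the walks are simple cycles matched in pairs, which gives the moment
recursion of a Gaussian. For m >= 3 two matched cycles have the same edges, hence they agree up to one of the m
rotations, with equal or opposite orientation. Opposite orientations contribute s^(2m); equal ones
contribute a product of E(a^2) and E(cnj a^2) according to the cyclic ascents and descents of the cycle,
which the Eulerian numbers count.
*)
theory Submission
  imports Defs "HOL-Combinatorics.Multiset_Permutations" "HOL-Real_Asymp.Real_Asymp"
begin

section \<open>Chebyshev traces as sums over closed walks\<close>

text \<open>Joint convergence is reduced to one real variable at a time: the linear combinations
  \<open>lin_stat J t\<close>, whose powers expand into families of walks of mixed lengths. The
  moment recursion is exact for every family with at least half as many vertices as steps; the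
  remaining sparse families have total size O(n^(-1/2)), and uniform moment bounds suffice for them.

  Counting vertices instead of edges keeps the diagonal out, whose entries share no prescribed
  variance: a vertex visited once differs from its neighbours, so the two entries at it are
  off-diagonal, and if they are opposite their product has mean s^2, which the matched pair cancels.

  Characteristic functions follow from moments by Taylor's formula, since Gaussian moments grow
  slowly compared with factorials. The way back to bounded continuous functions of a vector is by
  trigonometric polynomials, dense on boxes, with tightness from second moments.

  The limit may be degenerate (Y_2 vanishes if |a| is constant), so the limits are multiples of
  standard normal variables, and nonnegativity of a variance is inherited from the second moments
  converging to it.\<close>

text \<open>With \<open>cycle_weight\<close> below: the sums over the sets of disjoint pairs of consecutive steps of a path
  (of a closed walk), where each chosen pair must backtrack and contributes \<open>- c\<close>.  A closed walk is
  represented without the repetition of its first vertex.\<close>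

fun path_weight :: "(nat \<Rightarrow> nat \<Rightarrow> complex) \<Rightarrow> complex \<Rightarrow> nat list \<Rightarrow> complex" where
  "path_weight a c [] = 1"
| "path_weight a c [x] = 1"
| "path_weight a c [x, y] = a x y"
| "path_weight a c (x # y # z # r) =
     a x y * path_weight a c (y # z # r) - (if x = z then c * path_weight a c (z # r) else 0)"

definition cycle_weight :: "(nat \<Rightarrow> nat \<Rightarrow> complex) \<Rightarrow> complex \<Rightarrow> nat list \<Rightarrow> complex" where
  "cycle_weight a c p = path_weight a c (p @ [hd p]) -
     (if p ! 1 = last p then c * path_weight a c (tl p) else 0)"

text \<open>The admissible choices of pairs are the same whether the path is read from its first or
  from its last step. This recursion at the far end is what gives invariance under rotation and
  reversal.\<close>

lemma path_weight_snoc: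
  "path_weight a c (xs @ [x, y, z]) = path_weight a c (xs @ [x, y]) * a y z
     - (if x = z then c * path_weight a c (xs @ [x]) else 0)"
proof (induction xs rule: induct_list012)
  case (2 u)
  then show ?case by (simp add: algebra_simps)
next
  case (3 u v ws)
  show ?case
  proof (cases ws)
    case Nil
    then show ?thesis by (auto simp: algebra_simps)
  next
    case (Cons w us)
    have ab: "path_weight a c (w # us @ [x, y, z]) = path_weight a c (w # us @ [x, y]) * a y z
        - (if x = z then c * path_weight a c (w # us @ [x]) else 0)"
      and ab2: "path_weight a c (v # w # us @ [x, y, z]) = path_weight a c (v # w # us @ [x, y]) * a y z
        - (if x = z then c * path_weight a c (v # w # us @ [x]) else 0)"
      using 3 by (simp_all add: Cons)
    show ?thesis
      unfolding Cons append_Cons path_weight.simps ab ab2 by (simp add: algebra_simps)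
  qed
qed (simp add: algebra_simps)

lemma cycle_weight_rotate1:
  assumes "length p \<ge> 3"
  shows "cycle_weight a c (rotate1 p) = cycle_weight a c p"
proof -
  obtain x y z r where p: "p = x # y # z # r"
    using assms by (metis Suc_le_length_iff numeral_3_eq_3)
  obtain us w where w: "z # r = us @ [w]"
    by (metis append_butlast_last_id list.discI)
  have l: "last r = w" if "r \<noteq> []" using w that by (metis last.simps last_snoc)
  have "path_weight a c ((y # us) @ [w, x, y]) = path_weight a c ((y # us) @ [w, x]) * a x y
     - (if w = y then c * path_weight a c ((y # us) @ [w]) else 0)"
    by (rule path_weight_snoc)
  then have "path_weight a c (y # z # r @ [x, y]) = path_weight a c (y # z # r @ [x]) * a x y
     - (if w = y then c * path_weight a c (y # z # r) else 0)"
    using w by (metis append.assoc append_Cons append_Nil)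
  moreover have "last (z # r) = w" using w by simp
  ultimately show ?thesis
    by (auto simp: cycle_weight_def p)
qed

lemma cycle_weight_rotate:
  assumes "length p \<ge> 2"
  shows "cycle_weight a c (rotate k p) = cycle_weight a c p"
proof (induction k)
  case (Suc k)
  show ?case
  proof (cases "length p = 2")
    case True
    then obtain x y where q: "rotate k p = [x, y]"
      by (metis One_nat_def length_0_conv length_Suc_conv length_rotate numeral_2_eq_2)
    \<comment> \<open>With two steps the pair can be centred at either vertex, so the weight is
      \<open>a x y * a y x - 2 * c\<close>, symmetric in the two vertices.\<close>
    have "cycle_weight a c (rotate1 [x, y]) = cycle_weight a c [x, y]"
      by (simp add: cycle_weight_def)
    then show ?thesis using Suc q by simp
  next
    case False
    then have "length (rotate k p) \<ge> 3" using assms by simp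
    then show ?thesis using Suc by (metis cycle_weight_rotate1 rotate_Suc)
  qed
qed simp

lemma path_weight_rev:
  assumes "\<And>x y. x \<in> set p \<Longrightarrow> y \<in> set p \<Longrightarrow> a y x = cnj (a x y)" and "cnj c = c"
  shows "path_weight a c (rev p) = cnj (path_weight a c p)"
  using assms(1)
proof (induction p rule: induct_list012)
  case (3 x y zs)
  show ?case
  proof (cases zs)
    case Nil
    then show ?thesis by (simp add: 3(3)[of x y])
  next
    case (Cons z r)
    have "path_weight a c (rev r @ [z, y, x]) = path_weight a c (rev (y # z # r)) * a y x
       - (if z = x then c * path_weight a c (rev (z # r)) else 0)"
      by (simp add: path_weight_snoc)
    moreover have "path_weight a c (rev (y # zs)) = cnj (path_weight a c (y # zs))"
      by (rule 3(2)) (rule 3(3); simp)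
    moreover have "path_weight a c (rev zs) = cnj (path_weight a c zs)"
      by (rule 3(1)) (rule 3(3); simp)
    moreover have "a y x = cnj (a x y)"
      by (rule 3(3)) simp_all
    ultimately show ?thesis using assms(2) unfolding Cons by auto
  qed
qed auto

lemma cycle_weight_rev:
  assumes "\<And>x y. x \<in> set p \<Longrightarrow> y \<in> set p \<Longrightarrow> a y x = cnj (a x y)" and "cnj c = c"
    and "length p \<ge> 2"
  shows "cycle_weight a c (hd p # rev (tl p)) = cnj (cycle_weight a c p)"
proof -
  obtain x y r where p: "p = x # y # r"
    using assms(3) by (metis Suc_le_length_iff numeral_2_eq_2)
  have "path_weight a c (rev (x # y # r @ [x])) = cnj (path_weight a c (x # y # r @ [x]))"
    by (rule path_weight_rev[OF assms(1,2)]) (auto simp: p)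
  moreover have "path_weight a c (rev (y # r)) = cnj (path_weight a c (y # r))"
    by (rule path_weight_rev[OF assms(1,2)]) (auto simp: p)
  ultimately have "path_weight a c (x # (rev r @ [y]) @ [x]) = cnj (path_weight a c (x # y # r @ [x]))"
    "path_weight a c (rev r @ [y]) = cnj (path_weight a c (y # r))" by simp_all
  moreover have "(rev r @ [y]) ! 0 = last (x # y # r)"
    by (cases r rule: rev_cases) simp_all
  ultimately show ?thesis
    using assms(2) unfolding cycle_weight_def p by auto
qed

lemma path_weight_distinct:
  "distinct (x # xs) \<Longrightarrow> path_weight a c (x # y # xs) = a x y * path_weight a c (y # xs)"
  by (cases xs) auto

text \<open>A chosen pair containing a step at \<open>v\<close> must be centred at \<open>v\<close>,
  because one centred at a neighbour would have to return to \<open>v\<close>. If \<open>q\<close>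
  had only one vertex, a pair centred there would do so, whence the length bound.\<close>

lemma cycle_weight_simple_head:
  assumes "v \<notin> set q" "length q \<ge> 2"
  shows "cycle_weight a c (v # q) =
    (a v (hd q) * a (last q) v - (if hd q = last q then c else 0)) * path_weight a c q"
proof -
  obtain y z r where q: "q = y # z # r"
    using assms(2) by (metis Suc_le_length_iff numeral_2_eq_2)
  obtain us w where w: "z # r = us @ [w]"
    by (metis append_butlast_last_id list.discI)
  obtain us' u where u: "y # us = us' @ [u]"
    by (metis append_butlast_last_id list.discI)
  have "u \<in> set q" using u w q by (metis in_set_conv_decomp append.assoc append_Cons)
  then have "u \<noteq> v" using assms by auto
  have q': "q = us' @ [u, w]" using q w u by (metis append.assoc append_Cons append_Nil)
  have "path_weight a c (q @ [v]) = path_weight a c q * a w v"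
    using path_weight_snoc[of a c us' u w v] \<open>u \<noteq> v\<close> by (simp add: q')
  moreover have "path_weight a c (v # q @ [v]) = a v (hd q) * path_weight a c (q @ [v])"
    using assms by (auto simp: q)
  moreover have "last q = w" using q' by simp
  ultimately show ?thesis using q
    by (auto simp: cycle_weight_def algebra_simps)
qed

section \<open>Sums over lists of fixed length and over walks\<close>

definition tuples :: "'x set \<Rightarrow> nat \<Rightarrow> 'x list set" where
  "tuples S k = {p. length p = k \<and> set p \<subseteq> S}"

abbreviation walks :: "nat \<Rightarrow> nat \<Rightarrow> nat list set" where
  "walks n k \<equiv> tuples {..<n} k"

lemma finite_tuples [simp]: "finite S \<Longrightarrow> finite (tuples S k)"
  unfolding tuples_def using finite_lists_length_eq[of S k] by (simp add: conj_commute)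

lemma tuples_0 [simp]: "tuples S 0 = {[]}"
  by (auto simp: tuples_def)

lemma card_tuples: "finite S \<Longrightarrow> card (tuples S k) = card S ^ k"
  unfolding tuples_def using card_lists_length_eq[of S k] by (simp add: conj_commute)

lemma sum_tuples_Suc: "(\<Sum>p\<in>tuples S (Suc k). f p) = (\<Sum>x\<in>S. \<Sum>q\<in>tuples S k. f (x # q))"
proof -
  have "tuples S (Suc k) = (\<lambda>(x, q). x # q) ` (S \<times> tuples S k)"
    by (auto simp: tuples_def length_Suc_conv image_iff)
  moreover have "inj_on (\<lambda>(x, q). x # q) (S \<times> tuples S k)"
    by (auto simp: inj_on_def)
  ultimately have "(\<Sum>p\<in>tuples S (Suc k). f p) = (\<Sum>(x, q)\<in>S \<times> tuples S k. f (x # q))"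
    using sum.reindex[of "\<lambda>(x, q). x # q" _ f] by (simp add: comp_def case_prod_beta')
  then show ?thesis by (simp add: sum.cartesian_product)
qed

text \<open>Insertion at an arbitrary place serves both the last vertex of a walk and, in the moment
  recursion, the partner walk at place \<open>j\<close>.\<close>

lemma sum_tuples_insert:
  assumes "j \<le> k"
  shows "(\<Sum>p\<in>tuples S (Suc k). f p) = (\<Sum>q\<in>tuples S k. \<Sum>x\<in>S. f (take j q @ x # drop j q))"
proof -
  have "(\<Sum>p\<in>tuples S (Suc k). f p) = (\<Sum>(q, x)\<in>tuples S k \<times> S. f (take j q @ x # drop j q))"
  proof (rule sum.reindex_bij_witness[where i = "\<lambda>(q, x). take j q @ x # drop j q"
        and j = "\<lambda>p. (take j p @ drop (Suc j) p, p ! j)"])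
    fix p assume "p \<in> tuples S (Suc k)"
    then have p: "length p = Suc k" "set p \<subseteq> S" "j < length p" using assms by (auto simp: tuples_def)
    then show "(take j p @ drop (Suc j) p, p ! j) \<in> tuples S k \<times> S"
      using set_take_subset[of j p] set_drop_subset[of "Suc j" p] by (auto simp: tuples_def)
    show "(case (take j p @ drop (Suc j) p, p ! j) of (q, x) \<Rightarrow> take j q @ x # drop j q) = p"
      using id_take_nth_drop[OF p(3)] p(3) by simp
    then show "(case (take j p @ drop (Suc j) p, p ! j) of (q, x) \<Rightarrow> f (take j q @ x # drop j q)) = f p"
      by simp
  next
    fix z assume "z \<in> tuples S k \<times> S"
    then obtain q x where z: "z = (q, x)" "length q = k" "set q \<subseteq> S" "x \<in> S" by (auto simp: tuples_def)
    then show "(case z of (q, x) \<Rightarrow> take j q @ x # drop j q) \<in> tuples S (Suc k)"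
      using assms set_take_subset[of j q] set_drop_subset[of j q] by (auto simp: tuples_def)
    show "(take j (case z of (q, x) \<Rightarrow> take j q @ x # drop j q) @
            drop (Suc j) (case z of (q, x) \<Rightarrow> take j q @ x # drop j q),
           (case z of (q, x) \<Rightarrow> take j q @ x # drop j q) ! j) = z"
      using z assms by (simp add: nth_append min_def)
  qed
  then show ?thesis by (simp add: sum.cartesian_product)
qed

lemma sum_tuples_snoc: "(\<Sum>p\<in>tuples S (Suc k). f p) = (\<Sum>q\<in>tuples S k. \<Sum>x\<in>S. f (q @ [x]))"
  unfolding sum_tuples_insert[OF le_refl]
  by (intro sum.cong refl) (auto simp: tuples_def)

text \<open>These turn out to be the entries of n^(k/2) times the polynomial
  \<open>chebU c k\<close> of the Wigner matrix. The number \<open>k\<close> counts steps, not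
  vertices.\<close>

definition path_sum :: "nat \<Rightarrow> (nat \<Rightarrow> nat \<Rightarrow> complex) \<Rightarrow> complex \<Rightarrow> nat \<Rightarrow> nat \<Rightarrow> nat \<Rightarrow> complex" where
  "path_sum n a c k x y = (\<Sum>q\<in>walks n k. if last (x # q) = y then path_weight a c (x # q) else 0)"

lemma path_sum_0: "path_sum n a c 0 x y = (if x = y then 1 else 0)"
  by (simp add: path_sum_def)

lemma path_sum_1:
  assumes "y < n"
  shows "path_sum n a c (Suc 0) x y = a x y"
proof -
  have "path_sum n a c (Suc 0) x y = (\<Sum>z<n. if z = y then a x z else 0)"
    unfolding path_sum_def sum_tuples_Suc by (intro sum.cong refl) simp
  then show ?thesis using assms by simp
qed

text \<open>The middle vertex of a chosen pair is summed freely, which produces the factor n.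
  Dividing by sqrt n for each step turns this into the coefficient c of the three-term recurrence of
  \<open>chebU\<close>.\<close>

lemma path_sum_Suc_Suc:
  assumes "x < n"
  shows "path_sum n a c (Suc (Suc k)) x y =
    (\<Sum>z<n. a x z * path_sum n a c (Suc k) z y) - of_nat n * c * path_sum n a c k x y"
proof -
  have "path_sum n a c (Suc (Suc k)) x y = (\<Sum>z<n. \<Sum>w<n. \<Sum>q\<in>walks n k.
      a x z * (if last (w # q) = y then path_weight a c (z # w # q) else 0) -
      (if x = w then c * (if last (w # q) = y then path_weight a c (w # q) else 0) else 0))"
    unfolding path_sum_def sum_tuples_Suc
    by (intro sum.cong refl) auto
  also have "\<dots> = (\<Sum>z<n. a x z * (\<Sum>w<n. \<Sum>q\<in>walks n k.
        if last (w # q) = y then path_weight a c (z # w # q) else 0)) -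
      (\<Sum>z<n. \<Sum>w<n. if x = w then c * path_sum n a c k w y else 0)"
  proof -
    have "(\<Sum>q\<in>walks n k. if x = w then c * (if last (w # q) = y then path_weight a c (w # q) else 0) else 0)
        = (if x = w then c * path_sum n a c k w y else 0)" for w
      unfolding path_sum_def sum_distrib_left by auto
    then show ?thesis unfolding sum_subtractf sum_distrib_left by simp
  qed
  also have "(\<Sum>w<n. if x = w then c * path_sum n a c k w y else 0) = c * path_sum n a c k x y"
    using assms by simp
  also have "(\<Sum>z<n. a x z * (\<Sum>w<n. \<Sum>q\<in>walks n k.
        if last (w # q) = y then path_weight a c (z # w # q) else 0))
      = (\<Sum>z<n. a x z * path_sum n a c (Suc k) z y)"
    unfolding path_sum_def sum_tuples_Suc by simp
  finally show ?thesis by simp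
qed

text \<open>A pair that wraps around the first vertex leaves that vertex free, hence the factor n
  again. This is the trace form of T_m = U_m - c U_(m-2).\<close>

lemma sum_cycle_weight:
  "(\<Sum>p\<in>walks n (Suc (Suc k)). cycle_weight a c p) =
     (\<Sum>x<n. path_sum n a c (Suc (Suc k)) x x) - of_nat n * c * (\<Sum>x<n. path_sum n a c k x x)"
proof -
  have 1: "(\<Sum>q\<in>walks n (Suc k). path_weight a c (x # q @ [x])) = path_sum n a c (Suc (Suc k)) x x"
    if "x < n" for x
    unfolding path_sum_def sum_tuples_snoc[of _ "{..<n}" "Suc k"] using that
    by (intro sum.cong refl) simp
  have 2: "(\<Sum>q\<in>walks n (Suc k). if hd q = last q then c * path_weight a c q else 0)
      = c * (\<Sum>y<n. path_sum n a c k y y)"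
    unfolding path_sum_def sum_tuples_Suc sum_distrib_left by (intro sum.cong refl) auto
  have "(\<Sum>p\<in>walks n (Suc (Suc k)). cycle_weight a c p) =
    (\<Sum>x<n. \<Sum>q\<in>walks n (Suc k). path_weight a c (x # q @ [x]) -
        (if hd q = last q then c * path_weight a c q else 0))"
    unfolding sum_tuples_Suc[of _ "{..<n}" "Suc k"] cycle_weight_def
  proof (intro sum.cong refl)
    fix x q assume "q \<in> walks n (Suc k)"
    then obtain y r where "q = y # r" by (auto simp: tuples_def length_Suc_conv)
    then show "path_weight a c ((x # q) @ [hd (x # q)]) -
         (if (x # q) ! 1 = last (x # q) then c * path_weight a c (tl (x # q)) else 0) =
         path_weight a c (x # q @ [x]) - (if hd q = last q then c * path_weight a c q else 0)"
      by simp
  qed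
  also have "\<dots> = (\<Sum>x<n. path_sum n a c (Suc (Suc k)) x x - c * (\<Sum>y<n. path_sum n a c k y y))"
    by (intro sum.cong refl) (simp add: sum_subtractf 1 2)
  finally show ?thesis by (simp add: sum_subtractf)
qed

section \<open>Chebyshev polynomials of both kinds and of matrices\<close>

fun chebU :: "real \<Rightarrow> nat \<Rightarrow> real poly" where
  "chebU c 0 = 1"
| "chebU c (Suc 0) = [:0, 1:]"
| "chebU c (Suc (Suc k)) = pCons 0 (chebU c (Suc k)) - Polynomial.smult c (chebU c k)"

text \<open>Identifies \<open>chebU\<close> as the rescaled Chebyshev polynomial of the second kind;
  the factor sin avoids a division.\<close>

lemma chebU_sin: "poly (chebU (s\<^sup>2) k) (2 * s * cos \<theta>) * sin \<theta> = s ^ k * sin (real (Suc k) * \<theta>)"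
proof (induction k rule: induct_nat_012)
  case 1
  then show ?case using sin_double[of \<theta>] by simp
next
  case (ge2 k)
  have e: "real (Suc (Suc (Suc k))) * \<theta> = real (Suc (Suc k)) * \<theta> + \<theta>"
    "real (Suc k) * \<theta> = real (Suc (Suc k)) * \<theta> - \<theta>" by (auto simp: algebra_simps)
  have "poly (chebU (s\<^sup>2) (Suc (Suc k))) (2 * s * cos \<theta>) * sin \<theta> =
     2 * s * cos \<theta> * (poly (chebU (s\<^sup>2) (Suc k)) (2 * s * cos \<theta>) * sin \<theta>)
     - s\<^sup>2 * (poly (chebU (s\<^sup>2) k) (2 * s * cos \<theta>) * sin \<theta>)"
    by (simp add: algebra_simps)
  also have "\<dots> = s ^ Suc (Suc k) * (2 * cos \<theta> * sin (real (Suc (Suc k)) * \<theta>) - sin (real (Suc k) * \<theta>))"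
    unfolding ge2 power_Suc by (simp only: power2_eq_square right_diff_distrib mult_ac)
  also have "2 * cos \<theta> * sin (real (Suc (Suc k)) * \<theta>) - sin (real (Suc k) * \<theta>)
      = sin (real (Suc (Suc (Suc k))) * \<theta>)"
    unfolding e sin_add sin_diff by simp
  finally show ?case .
qed simp

lemma cheb_spec:
  assumes "m \<ge> 1"
  shows "poly (cheb m) (2 * cos \<theta>) = 2 * cos (real m * \<theta>)"
  using theI'[OF cheb_ex1[OF assms]] unfolding cheb_def by blast

text \<open>With m = k + 2 this is 2 sin \<theta> cos (m \<theta>) = sin ((m + 1) \<theta>) - sin
  ((m - 1) \<theta>), divided by sin \<theta> at the infinitely many points 2 s cos \<theta> where
  that is possible.\<close>

lemma cheb_scaled_eq:
  assumes "s \<noteq> 0"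
  shows "cheb_scaled (Suc (Suc k)) s = chebU (s\<^sup>2) (Suc (Suc k)) - Polynomial.smult (s\<^sup>2) (chebU (s\<^sup>2) k)"
    (is "?l = ?r")
proof -
  have eq: "poly ?l (2 * s * cos \<theta>) = poly ?r (2 * s * cos \<theta>)" if "sin \<theta> \<noteq> 0" for \<theta>
  proof -
    have e: "real (Suc (Suc (Suc k))) * \<theta> = real (Suc (Suc k)) * \<theta> + \<theta>"
      "real (Suc k) * \<theta> = real (Suc (Suc k)) * \<theta> - \<theta>" by (auto simp: algebra_simps)
    have "poly ?r (2 * s * cos \<theta>) * sin \<theta> =
       s ^ Suc (Suc k) * (sin (real (Suc (Suc (Suc k))) * \<theta>) - sin (real (Suc k) * \<theta>))"
    proof -
      have "poly ?r (2 * s * cos \<theta>) * sin \<theta> = poly (chebU (s\<^sup>2) (Suc (Suc k))) (2 * s * cos \<theta>) * sin \<theta>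
          - s\<^sup>2 * (poly (chebU (s\<^sup>2) k) (2 * s * cos \<theta>) * sin \<theta>)"
        by (simp only: poly_diff poly_smult left_diff_distrib mult.assoc)
      then show ?thesis
        unfolding chebU_sin power_Suc by (simp only: power2_eq_square right_diff_distrib mult_ac)
    qed
    also have "\<dots> = s ^ Suc (Suc k) * (2 * cos (real (Suc (Suc k)) * \<theta>)) * sin \<theta>"
      unfolding e sin_add sin_diff by simp
    also have "\<dots> = poly ?l (2 * s * cos \<theta>) * sin \<theta>"
      using assms cheb_spec[of "Suc (Suc k)" \<theta>]
      by (simp add: cheb_scaled_def poly_pcompose)
    finally show ?thesis using that by simp
  qed
  have "(\<lambda>x. 2 * s * x) ` {-1<..<1} \<subseteq> {x. poly (?l - ?r) x = 0}"
  proof safe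
    fix x :: real assume "x \<in> {-1<..<1}"
    then have "cos (arccos x) = x" "sin (arccos x) \<noteq> 0"
      by (auto simp: sin_arccos_nonzero)
    then show "poly (?l - ?r) (2 * s * x) = 0" using eq[of "arccos x"] by simp
  qed
  moreover have "infinite ((\<lambda>x. 2 * s * x) ` {-1<..<1})"
    using assms by (subst finite_image_iff) (auto simp: inj_on_def)
  ultimately have "infinite {x. poly (?l - ?r) x = 0}" using finite_subset by blast
  then have "?l - ?r = 0" using poly_roots_finite by blast
  then show ?thesis by simp
qed

lemma poly_mat_index:
  assumes "i < dim_row A" "j < dim_row A" "degree p \<le> N"
  shows "poly_mat p A $$ (i, j) = (\<Sum>k\<le>N. complex_of_real (coeff p k) * (A ^\<^sub>m k) $$ (i, j))"
proof -
  have "(\<Sum>k\<le>N. complex_of_real (coeff p k) * (A ^\<^sub>m k) $$ (i, j)) =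
     (\<Sum>k\<le>degree p. complex_of_real (coeff p k) * (A ^\<^sub>m k) $$ (i, j))"
    using assms by (intro sum.mono_neutral_right) (auto simp: coeff_eq_0)
  then show ?thesis using assms by (simp add: poly_mat_def)
qed

lemma poly_mat_diff_smult:
  assumes "i < dim_row A" "j < dim_row A"
  shows "poly_mat (p - Polynomial.smult c q) A $$ (i, j) =
     poly_mat p A $$ (i, j) - complex_of_real c * poly_mat q A $$ (i, j)"
proof -
  define N where "N = max (degree p) (degree q)"
  have N: "degree p \<le> N" "degree q \<le> N" "degree (p - Polynomial.smult c q) \<le> N"
    using degree_smult_le[of c q] by (auto simp: N_def intro!: degree_diff_le order.trans[OF degree_smult_le])
  show ?thesis
    unfolding poly_mat_index[OF assms N(1)] poly_mat_index[OF assms N(2)] poly_mat_index[OF assms N(3)]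
    by (simp add: sum_distrib_left algebra_simps flip: sum_subtractf)
qed

lemma poly_mat_pCons:
  assumes A: "A \<in> carrier_mat n n" and "i < n" "j < n"
  shows "poly_mat (pCons 0 p) A $$ (i, j) = (\<Sum>l<n. A $$ (i, l) * poly_mat p A $$ (l, j))"
proof -
  \<comment> \<open>Powers are defined by multiplication on the right, whereas the walk recursion
    splits off the first step.\<close>
  have pow: "A ^\<^sub>m Suc k = A * A ^\<^sub>m k" for k
  proof (induction k)
    case (Suc k)
    have "A ^\<^sub>m Suc (Suc k) = (A * A ^\<^sub>m k) * A" using Suc by simp
    also have "\<dots> = A * (A ^\<^sub>m k * A)" using A by (intro assoc_mult_mat) auto
    finally show ?case by simp
  qed (use A in simp)
  have d: "dim_row A = n" "dim_col A = n" using A by auto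
  have "poly_mat (pCons 0 p) A $$ (i, j) =
      (\<Sum>k\<le>Suc (degree p). complex_of_real (coeff (pCons 0 p) k) * (A ^\<^sub>m k) $$ (i, j))"
    by (rule poly_mat_index) (use assms d degree_pCons_le in auto)
  also have "\<dots> = (\<Sum>k\<le>degree p. complex_of_real (coeff p k) * (A ^\<^sub>m Suc k) $$ (i, j))"
    by (subst sum.atMost_Suc_shift) (simp del: pow_mat.simps)
  also have "\<dots> = (\<Sum>k\<le>degree p. complex_of_real (coeff p k) * (\<Sum>l<n. A $$ (i, l) * (A ^\<^sub>m k) $$ (l, j)))"
  proof (intro sum.cong refl arg_cong2[of _ _ _ _ "(*)"])
    fix k
    have "A ^\<^sub>m k \<in> carrier_mat n n" using A by auto
    then show "(A ^\<^sub>m Suc k) $$ (i, j) = (\<Sum>l<n. A $$ (i, l) * (A ^\<^sub>m k) $$ (l, j))"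
      unfolding pow using assms
      by (auto simp: scalar_prod_def index_mult_mat intro!: sum.cong)
  qed
  also have "\<dots> = (\<Sum>l<n. A $$ (i, l) * (\<Sum>k\<le>degree p. complex_of_real (coeff p k) * (A ^\<^sub>m k) $$ (l, j)))"
    unfolding sum_distrib_left by (subst sum.swap) (simp add: algebra_simps)
  also have "\<dots> = (\<Sum>l<n. A $$ (i, l) * poly_mat p A $$ (l, j))"
    by (intro sum.cong refl) (use assms d in \<open>simp add: poly_mat_def\<close>)
  finally show ?thesis .
qed

lemma mult_divide_power_Suc_Suc:
  fixes S :: complex
  assumes "S \<noteq> 0"
  shows "c * (P / S ^ k) = S * S * c * P / S ^ Suc (Suc k)"
  using assms by (simp add: field_simps)

lemma poly_mat_chebU:
  assumes "n > 0" "x < n" "y < n"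
  shows "poly_mat (chebU c k) (wigner_mat n a) $$ (x, y) =
    path_sum n a (complex_of_real c) k x y / complex_of_real (sqrt (real n)) ^ k"
  using assms(2)
proof (induction c k arbitrary: x rule: chebU.induct)
  case (1 c)
  then show ?case using assms
    by (simp add: poly_mat_def wigner_mat_def path_sum_0 one_mat_def)
next
  case (2 c)
  have "poly_mat (pCons 0 1) (wigner_mat n a) $$ (x, y) =
      (\<Sum>l<n. wigner_mat n a $$ (x, l) * poly_mat 1 (wigner_mat n a) $$ (l, y))"
    by (rule poly_mat_pCons) (use 2 assms in \<open>auto simp: wigner_mat_def\<close>)
  also have "\<dots> = (\<Sum>l<n. if l = y then wigner_mat n a $$ (x, l) else 0)"
    using assms by (intro sum.cong refl) (simp add: poly_mat_def wigner_mat_def)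
  finally show ?case using 2 assms unfolding chebU.simps one_pCons
    by (simp add: path_sum_1 wigner_mat_def)
next
  case (3 c k)
  let ?s = "complex_of_real (sqrt (real n))"
  have s: "?s \<noteq> 0" "?s * ?s = of_nat n" using assms(1)
    by (simp, simp flip: of_real_mult)
  have d: "dim_row (wigner_mat n a) = n" by (simp add: wigner_mat_def)
  have "poly_mat (chebU c (Suc (Suc k))) (wigner_mat n a) $$ (x, y) =
     (\<Sum>l<n. wigner_mat n a $$ (x, l) * poly_mat (chebU c (Suc k)) (wigner_mat n a) $$ (l, y))
     - complex_of_real c * poly_mat (chebU c k) (wigner_mat n a) $$ (x, y)"
    using 3(3) assms d by (simp add: poly_mat_diff_smult)
      (rule poly_mat_pCons, auto simp: wigner_mat_def)
  also have "\<dots> = (\<Sum>l<n. a x l / ?s * (path_sum n a c (Suc k) l y / ?s ^ Suc k))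
     - complex_of_real c * (path_sum n a c k x y / ?s ^ k)"
    using 3 assms by (simp add: wigner_mat_def)
  also have "(\<Sum>l<n. a x l / ?s * (path_sum n a c (Suc k) l y / ?s ^ Suc k)) =
      (\<Sum>l<n. a x l * path_sum n a c (Suc k) l y) / ?s ^ Suc (Suc k)"
    by (simp add: sum_divide_distrib)
  also have "complex_of_real c * (path_sum n a c k x y / ?s ^ k) =
      of_nat n * complex_of_real c * path_sum n a c k x y / ?s ^ Suc (Suc k)"
    unfolding mult_divide_power_Suc_Suc[OF s(1), of "complex_of_real c"] s(2) ..
  finally show ?case unfolding path_sum_Suc_Suc[OF 3(3)] diff_divide_distrib .
qed

lemma trace_cheb_scaled:
  assumes "m \<ge> 2" "n > 0" "s \<noteq> 0"
  shows "trace_mat (poly_mat (cheb_scaled m s) (wigner_mat n a)) =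
    (\<Sum>p\<in>walks n m. cycle_weight a (complex_of_real (s\<^sup>2)) p) / complex_of_real (sqrt (real n)) ^ m"
proof -
  obtain k where m: "m = Suc (Suc k)" using assms(1) by (metis Suc_le_D numeral_2_eq_2 Suc_le_mono)
  let ?s = "complex_of_real (sqrt (real n))" and ?c = "complex_of_real (s\<^sup>2)"
  have s: "?s \<noteq> 0" "?s * ?s = of_nat n" using assms(2)
    by (simp, simp flip: of_real_mult)
  have d: "dim_row (wigner_mat n a) = n" "dim_row (poly_mat p (wigner_mat n a)) = n" for p
    by (simp_all add: wigner_mat_def poly_mat_def)
  have "trace_mat (poly_mat (cheb_scaled m s) (wigner_mat n a)) =
     (\<Sum>x<n. path_sum n a ?c m x x / ?s ^ m - ?c * (path_sum n a ?c k x x / ?s ^ k))"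
    unfolding trace_mat_def d(2) m cheb_scaled_eq[OF assms(3)]
    by (intro sum.cong refl) (simp only: poly_mat_diff_smult d lessThan_iff poly_mat_chebU[OF assms(2)])
  also have "\<dots> = (\<Sum>x<n. path_sum n a ?c m x x - of_nat n * ?c * path_sum n a ?c k x x) / ?s ^ m"
    unfolding sum_divide_distrib mult_divide_power_Suc_Suc[OF s(1), of ?c] s(2) m diff_divide_distrib ..
  finally show ?thesis unfolding m sum_cycle_weight by (simp add: sum_subtractf sum_distrib_left)
qed

section \<open>Random variables depending on a set of entries\<close>

text \<open>An undirected edge is encoded by the upper triangular index of its entry, since opposite
  entries are conjugate and carry the same randomness.\<close>

definition edge :: "nat \<Rightarrow> nat \<Rightarrow> nat \<times> nat" where
  "edge x y = (min x y, max x y)"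

lemma edge_commute: "edge x y = edge y x"
  by (auto simp: edge_def)

lemma edge_eq_iff: "edge x y = edge u v \<longleftrightarrow> (x = u \<and> y = v) \<or> (x = v \<and> y = u)"
  by (auto simp: edge_def min_def max_def)

fun path_edges :: "nat list \<Rightarrow> (nat \<times> nat) set" where
  "path_edges [] = {}"
| "path_edges [x] = {}"
| "path_edges (x # y # r) = insert (edge x y) (path_edges (y # r))"

definition cycle_edges :: "nat list \<Rightarrow> (nat \<times> nat) set" where
  "cycle_edges p = path_edges (p @ [hd p])"

lemma path_edges_Cons: "path_edges xs \<subseteq> path_edges (x # xs)"
  by (cases xs) auto

lemma path_edges_append: "path_edges (xs @ y # ys) = path_edges (xs @ [y]) \<union> path_edges (y # ys)"
  by (induction xs rule: path_edges.induct) auto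

lemma path_edges_ends: "edge x y \<in> path_edges xs \<Longrightarrow> x \<in> set xs \<and> y \<in> set xs"
  by (induction xs rule: path_edges.induct) (auto simp: edge_eq_iff)

lemma cycle_edges_Cons: "cycle_edges (x # xs) = path_edges (x # xs) \<union> {edge (last (x # xs)) x}"
proof -
  obtain us w where w: "x # xs = us @ [w]" by (metis append_butlast_last_id list.discI)
  have "cycle_edges (x # xs) = path_edges ((x # xs) @ [x])" by (simp add: cycle_edges_def)
  also have "\<dots> = path_edges (x # xs) \<union> {edge (last (x # xs)) x}"
    unfolding w using path_edges_append[of us w "[x]"] by simp
  finally show ?thesis .
qed

lemma cycle_edges_rotate1: "cycle_edges (rotate1 p) = cycle_edges p"
proof (cases p)
  case (Cons x xs)
  show ?thesis
  proof (cases xs)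
    case (Cons y ys)
    then show ?thesis
      using path_edges_append[of "y # ys" x "[y]"] \<open>p = x # xs\<close>
      by (auto simp: cycle_edges_def edge_commute)
  qed (use \<open>p = x # xs\<close> in simp)
qed simp

lemma cycle_edges_rotate: "cycle_edges (rotate k p) = cycle_edges p"
  by (induction k) (simp_all add: cycle_edges_rotate1)

lemma cycle_edges_ends: "edge x y \<in> cycle_edges p \<Longrightarrow> x \<in> set p \<and> y \<in> set p"
  by (cases p) (auto simp: cycle_edges_def dest: path_edges_ends)

text \<open>A crude replacement for the Cauchy-Schwarz inequality: moments of a product are bounded
  by moments of the factors, without square roots.\<close>

lemma power_mult_le_add:
  fixes x y :: real
  assumes "x \<ge> 0" "y \<ge> 0"
  shows "(x * y) ^ k \<le> x ^ (2 * k) + y ^ (2 * k)"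
proof -
  have "x ^ k * y ^ k \<le> (x ^ k)\<^sup>2 + (y ^ k)\<^sup>2"
    using sum_squares_bound[of "x ^ k" "y ^ k"] assms by (auto intro: order_trans[rotated])
  then show ?thesis by (simp add: power_mult_distrib power_mult[symmetric] mult.commute[of 2])
qed

lemma power_add_le:
  fixes x y :: real
  assumes "x \<ge> 0" "y \<ge> 0"
  shows "(x + y) ^ k \<le> 2 ^ k * (x ^ k + y ^ k)"
proof -
  have "(x + y) ^ k \<le> (2 * max x y) ^ k" using assms by (intro power_mono) auto
  also have "\<dots> = 2 ^ k * max x y ^ k" by (simp add: power_mult_distrib)
  also have "max x y ^ k \<le> x ^ k + y ^ k" using assms by (auto simp: max_def)
  finally show ?thesis by simp
qed

lemma borel_measurable_cnj [measurable]: "cnj \<in> borel_measurable borel"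
  by (intro borel_measurable_continuous_onI continuous_intros)

section \<open>The matrix ensemble and functions of some of its entries\<close>

locale wigner =
  fixes M :: "nat \<Rightarrow> 'a measure"
    and a :: "nat \<Rightarrow> nat \<Rightarrow> nat \<Rightarrow> 'a \<Rightarrow> complex"
    and P :: "'b measure"
    and A :: "'b \<Rightarrow> complex"
    and s :: real
  assumes prob: "\<And>n. prob_space (M n)"
    and herm: "\<And>n p q \<omega>. p < n \<Longrightarrow> q < n \<Longrightarrow> \<omega> \<in> space (M n) \<Longrightarrow> a n q p \<omega> = cnj (a n p q \<omega>)"
    and indep: "\<And>n. prob_space.indep_vars (M n) (\<lambda>_. borel) (\<lambda>(p, q). a n p q)
               {(p, q). p \<le> q \<and> q < n}"
    and centered: "\<And>n p q. p \<le> q \<Longrightarrow> q < n \<Longrightarrow> (\<integral>\<omega>. a n p q \<omega> \<partial>M n) = 0"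
    and moments: "\<And>k. (SUP (n, p, q) \<in> {(n, p, q). p < n \<and> q < n}.
               \<integral>\<^sup>+\<omega>. ennreal (cmod (a n p q \<omega>) ^ k) \<partial>M n) < \<infinity>"
    and prob_P: "prob_space P"
    and meas_A: "A \<in> borel_measurable P"
    and distr_A: "\<And>n p q. p < q \<Longrightarrow> q < n \<Longrightarrow> distr (M n) borel (a n p q) = distr P borel A"
    and second_moment: "(\<integral>\<omega>. cmod (A \<omega>) ^ 2 \<partial>P) = s ^ 2"
    and s_pos: "s ^ 2 > 0"
begin

abbreviation entry_index :: "nat \<Rightarrow> (nat \<times> nat) set" where
  "entry_index n \<equiv> {(p, q). p \<le> q \<and> q < n}"

definition entries :: "nat \<Rightarrow> (nat \<times> nat) set \<Rightarrow> 'a \<Rightarrow> nat \<times> nat \<Rightarrow> complex" where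
  "entries n S \<omega> = (\<lambda>i\<in>S \<inter> entry_index n. (case i of (p, q) \<Rightarrow> a n p q) \<omega>)"

text \<open>All absolute moments are required to be finite so that the class is closed under
  products and each of its members is integrable. Indices outside the upper triangle are ignored, so
  that \<open>UNIV\<close> or a complement may serve as \<open>S\<close>.\<close>

definition dep :: "nat \<Rightarrow> (nat \<times> nat) set \<Rightarrow> ('a \<Rightarrow> complex) \<Rightarrow> bool" where
  "dep n S f \<longleftrightarrow> f \<in> borel_measurable (M n) \<and>
     (\<exists>g\<in>borel_measurable (PiM (S \<inter> entry_index n) (\<lambda>_. borel)).
        \<forall>\<omega>\<in>space (M n). f \<omega> = g (entries n S \<omega>)) \<and>
     (\<forall>k. integrable (M n) (\<lambda>\<omega>. cmod (f \<omega>) ^ k))"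

lemma borel_entry [measurable]:
  assumes "p < n" "q < n"
  shows "a n p q \<in> borel_measurable (M n)"
proof -
  interpret prob_space "M n" by (rule prob)
  have *: "a n p q \<in> borel_measurable (M n)" if "p \<le> q" "q < n" for p q
    using indep[of n] that unfolding indep_vars_def by fastforce
  show ?thesis
  proof (cases "p \<le> q")
    case False
    have [measurable]: "a n q p \<in> borel_measurable (M n)" using *[of q p] False assms by simp
    have "(\<lambda>\<omega>. cnj (a n q p \<omega>)) \<in> borel_measurable (M n)" by measurable
    then show ?thesis
      by (subst measurable_cong[OF herm[OF assms(2,1)]])
  qed (use * assms in auto)
qed

lemma moment_bound:
  obtains C where "C \<ge> 0" "\<And>n p q. p < n \<Longrightarrow> q < n \<Longrightarrow> integrable (M n) (\<lambda>\<omega>. cmod (a n p q \<omega>) ^ k)"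
    "\<And>n p q. p < n \<Longrightarrow> q < n \<Longrightarrow> (\<integral>\<omega>. cmod (a n p q \<omega>) ^ k \<partial>M n) \<le> C"
proof -
  let ?S = "SUP (n, p, q) \<in> {(n, p, q). p < n \<and> q < n}. \<integral>\<^sup>+\<omega>. ennreal (cmod (a n p q \<omega>) ^ k) \<partial>M n"
  have le: "(\<integral>\<^sup>+\<omega>. ennreal (cmod (a n p q \<omega>) ^ k) \<partial>M n) \<le> ?S" if "p < n" "q < n" for n p q :: nat
    using that by (intro SUP_upper2[of "(n, p, q)"]) auto
  have int: "integrable (M n) (\<lambda>\<omega>. cmod (a n p q \<omega>) ^ k)" if [measurable]: "p < n" "q < n" for n p q
    using le[OF that] moments[of k] by (intro integrableI_nonneg) (auto intro: le_less_trans)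
  show ?thesis
  proof (rule that[of "enn2real ?S"])
    fix n p q :: nat assume pq: "p < n" "q < n"
    have "ennreal (\<integral>\<omega>. cmod (a n p q \<omega>) ^ k \<partial>M n) \<le> ?S"
      using le[OF pq] int[OF pq] by (simp add: nn_integral_eq_integral)
    also have "?S = ennreal (enn2real ?S)" using moments[of k] by simp
    finally show "(\<integral>\<omega>. cmod (a n p q \<omega>) ^ k \<partial>M n) \<le> enn2real ?S"
      by (simp add: ennreal_le_iff)
  qed (use int in auto)
qed

lemma depI:
  assumes "f \<in> borel_measurable (M n)" "g \<in> borel_measurable (PiM (S \<inter> entry_index n) (\<lambda>_. borel))"
    and "\<And>\<omega>. \<omega> \<in> space (M n) \<Longrightarrow> f \<omega> = g (entries n S \<omega>)"
    and "\<And>k. integrable (M n) (\<lambda>\<omega>. cmod (f \<omega>) ^ k)"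
  shows "dep n S f"
  using assms unfolding dep_def by blast

lemma dep_measurable [measurable_dest]: "dep n S f \<Longrightarrow> f \<in> borel_measurable (M n)"
  by (simp add: dep_def)

lemma dep_moment: "dep n S f \<Longrightarrow> integrable (M n) (\<lambda>\<omega>. cmod (f \<omega>) ^ k)"
  by (simp add: dep_def)

lemma dep_integrable: "dep n S f \<Longrightarrow> integrable (M n) f"
  using dep_moment[of n S f 1] dep_measurable[of n S f] by (simp add: integrable_norm_iff)

lemma dep_mono:
  assumes "dep n S f" "S \<inter> entry_index n \<subseteq> T"
  shows "dep n T f"
proof -
  obtain g where g: "g \<in> borel_measurable (PiM (S \<inter> entry_index n) (\<lambda>_. borel))"
    "\<And>\<omega>. \<omega> \<in> space (M n) \<Longrightarrow> f \<omega> = g (entries n S \<omega>)"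
    using assms(1) unfolding dep_def by blast
  have r: "entries n S \<omega> = restrict (entries n T \<omega>) (S \<inter> entry_index n)" for \<omega>
    using assms(2) by (auto simp: entries_def fun_eq_iff restrict_def)
  show ?thesis
  proof (rule depI)
    show "(\<lambda>x. g (restrict x (S \<inter> entry_index n))) \<in> borel_measurable (PiM (T \<inter> entry_index n) (\<lambda>_. borel))"
      by (rule measurable_compose[OF measurable_restrict_subset g(1)]) (use assms(2) in auto)
  qed (use g r assms(1) dep_measurable dep_moment in auto)
qed

lemma dep_const: "dep n S (\<lambda>_. c)"
proof -
  interpret prob_space "M n" by (rule prob)
  show ?thesis by (rule depI[where g = "\<lambda>_. c"]) auto
qed

text \<open>Measurable factorisation through the entries is the same for every operation; only the
  moment bound is particular to sums, products or conjugates and stays a premise.\<close>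

lemma dep_binop:
  assumes "dep n S f" "dep n S g" and [measurable]: "case_prod h \<in> borel_measurable (borel \<Otimes>\<^sub>M borel)"
    and "\<And>k. integrable (M n) (\<lambda>\<omega>. cmod (h (f \<omega>) (g \<omega>)) ^ k)"
  shows "dep n S (\<lambda>\<omega>. h (f \<omega>) (g \<omega>))"
proof -
  have [measurable]: "f \<in> borel_measurable (M n)" "g \<in> borel_measurable (M n)"
    using assms dep_measurable by auto
  obtain f' where f' [measurable]: "f' \<in> borel_measurable (PiM (S \<inter> entry_index n) (\<lambda>_. borel))"
    and "\<And>\<omega>. \<omega> \<in> space (M n) \<Longrightarrow> f \<omega> = f' (entries n S \<omega>)"
    using assms(1) unfolding dep_def by blast
  moreover obtain g' where g' [measurable]: "g' \<in> borel_measurable (PiM (S \<inter> entry_index n) (\<lambda>_. borel))"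
    and "\<And>\<omega>. \<omega> \<in> space (M n) \<Longrightarrow> g \<omega> = g' (entries n S \<omega>)"
    using assms(2) unfolding dep_def by blast
  ultimately show ?thesis
    by (intro depI[where g = "\<lambda>x. h (f' x) (g' x)"] assms(4)) auto
qed

lemma dep_add:
  assumes "dep n S f" "dep n S g"
  shows "dep n S (\<lambda>\<omega>. f \<omega> + g \<omega>)"
proof (rule dep_binop[OF assms])
  fix k
  show "integrable (M n) (\<lambda>\<omega>. cmod (f \<omega> + g \<omega>) ^ k)"
  proof (rule Bochner_Integration.integrable_bound)
    show "integrable (M n) (\<lambda>\<omega>. 2 ^ k * (cmod (f \<omega>) ^ k + cmod (g \<omega>) ^ k))"
      using assms dep_moment by auto
    show "AE \<omega> in M n. norm (cmod (f \<omega> + g \<omega>) ^ k) \<le> norm (2 ^ k * (cmod (f \<omega>) ^ k + cmod (g \<omega>) ^ k))"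
    proof (rule AE_I2)
      fix \<omega>
      have "cmod (f \<omega> + g \<omega>) ^ k \<le> (cmod (f \<omega>) + cmod (g \<omega>)) ^ k"
        by (intro power_mono norm_triangle_ineq) auto
      also have "\<dots> \<le> 2 ^ k * (cmod (f \<omega>) ^ k + cmod (g \<omega>) ^ k)" by (rule power_add_le) auto
      finally show "norm (cmod (f \<omega> + g \<omega>) ^ k) \<le> norm (2 ^ k * (cmod (f \<omega>) ^ k + cmod (g \<omega>) ^ k))"
        by simp
    qed
    show "(\<lambda>\<omega>. cmod (f \<omega> + g \<omega>) ^ k) \<in> borel_measurable (M n)"
      using assms[THEN dep_measurable] by measurable
  qed
qed measurable

lemma dep_mult:
  assumes "dep n S f" "dep n S g"
  shows "dep n S (\<lambda>\<omega>. f \<omega> * g \<omega>)"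
proof (rule dep_binop[OF assms])
  fix k
  show "integrable (M n) (\<lambda>\<omega>. cmod (f \<omega> * g \<omega>) ^ k)"
  proof (rule Bochner_Integration.integrable_bound)
    show "integrable (M n) (\<lambda>\<omega>. cmod (f \<omega>) ^ (2 * k) + cmod (g \<omega>) ^ (2 * k))"
      using assms dep_moment by auto
    show "AE \<omega> in M n. norm (cmod (f \<omega> * g \<omega>) ^ k) \<le> norm (cmod (f \<omega>) ^ (2 * k) + cmod (g \<omega>) ^ (2 * k))"
      using power_mult_le_add by (intro AE_I2) (simp add: norm_mult)
    show "(\<lambda>\<omega>. cmod (f \<omega> * g \<omega>) ^ k) \<in> borel_measurable (M n)"
      using assms[THEN dep_measurable] by measurable
  qed
qed measurable

lemma dep_diff:
  assumes "dep n S f" "dep n S g"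
  shows "dep n S (\<lambda>\<omega>. f \<omega> - g \<omega>)"
  using dep_add[OF assms(1) dep_mult[OF dep_const[of n S "- 1"] assms(2)]] by simp

lemma dep_power: "dep n S f \<Longrightarrow> dep n S (\<lambda>\<omega>. f \<omega> ^ k)"
  by (induction k) (auto intro: dep_const dep_mult)

lemma dep_cnj:
  assumes "dep n S f"
  shows "dep n S (\<lambda>\<omega>. cnj (f \<omega>))"
proof (rule dep_binop[OF assms assms, where h = "\<lambda>x y. cnj x"])
  show "integrable (M n) (\<lambda>\<omega>. cmod (cnj (f \<omega>)) ^ k)" for k using dep_moment[OF assms] by simp
qed measurable

lemma dep_cong:
  assumes "dep n S f" "\<And>\<omega>. \<omega> \<in> space (M n) \<Longrightarrow> g \<omega> = f \<omega>"
  shows "dep n S g"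
proof -
  obtain g' where g': "g' \<in> borel_measurable (PiM (S \<inter> entry_index n) (\<lambda>_. borel))"
    and f: "\<And>\<omega>. \<omega> \<in> space (M n) \<Longrightarrow> f \<omega> = g' (entries n S \<omega>)"
    using assms(1) unfolding dep_def by blast
  show ?thesis
  proof (rule depI[OF _ g'])
    show "g \<in> borel_measurable (M n)"
      using dep_measurable[OF assms(1)] measurable_cong[of "M n" g f borel] assms(2) by simp
    show "integrable (M n) (\<lambda>\<omega>. cmod (g \<omega>) ^ k)" for k
      using dep_moment[OF assms(1), of k] assms(2)
      by (subst Bochner_Integration.integrable_cong[OF refl, of _ _ "\<lambda>\<omega>. cmod (f \<omega>) ^ k"]) auto
  qed (use f assms(2) in simp)
qed

lemma dep_entry:
  assumes "p < n" "q < n" "edge p q \<in> S"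
  shows "dep n S (a n p q)"
proof -
  have *: "dep n S (a n p q)" if "p \<le> q" "q < n" "(p, q) \<in> S" for p q
  proof (rule depI[where g = "\<lambda>x. x (p, q)"])
    show "(\<lambda>x. x (p, q)) \<in> borel_measurable (PiM (S \<inter> entry_index n) (\<lambda>_. borel))"
      using that by (intro measurable_component_singleton) auto
    show "integrable (M n) (\<lambda>\<omega>. cmod (a n p q \<omega>) ^ k)" for k
      using moment_bound[of k] that by (metis order.strict_trans1)
  qed (use that in \<open>auto simp: entries_def\<close>)
  show ?thesis
  proof (cases "p \<le> q")
    case False
    then show ?thesis
      using dep_cong[OF dep_cnj[OF *[of q p]] herm[of q n p]] assms by (simp add: edge_def)
  qed (use * assms in \<open>auto simp: edge_def\<close>)
qed

lemma dep_prod_list: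
  assumes "\<And>x. x \<in> set xs \<Longrightarrow> dep n S (f x)"
  shows "dep n S (\<lambda>\<omega>. \<Prod>x\<leftarrow>xs. f x \<omega>)"
  using assms by (induction xs) (auto intro: dep_const dep_mult)

text \<open>Functions of disjoint blocks of an independent family are independent, and the moments
  contained in \<open>dep\<close> make the factors integrable.\<close>

lemma dep_indep:
  assumes "dep n S f" "dep n T g" "S \<inter> T = {}"
  shows "(\<integral>\<omega>. f \<omega> * g \<omega> \<partial>M n) = (\<integral>\<omega>. f \<omega> \<partial>M n) * (\<integral>\<omega>. g \<omega> \<partial>M n)"
proof -
  interpret prob_space "M n" by (rule prob)
  obtain f' where f' [measurable]: "f' \<in> borel_measurable (PiM (S \<inter> entry_index n) (\<lambda>_. borel))"
    and f: "\<And>\<omega>. \<omega> \<in> space (M n) \<Longrightarrow> f \<omega> = f' (entries n S \<omega>)"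
    using assms(1) unfolding dep_def by blast
  obtain g' where g' [measurable]: "g' \<in> borel_measurable (PiM (T \<inter> entry_index n) (\<lambda>_. borel))"
    and g: "\<And>\<omega>. \<omega> \<in> space (M n) \<Longrightarrow> g \<omega> = g' (entries n T \<omega>)"
    using assms(2) unfolding dep_def by blast
  have "indep_var (PiM (S \<inter> entry_index n) (\<lambda>_. borel)) (entries n S)
     (PiM (T \<inter> entry_index n) (\<lambda>_. borel)) (entries n T)"
    unfolding entries_def using assms(3)
    by (intro indep_var_restrict[OF indep]) auto
  then have ind: "indep_var borel (f' \<circ> entries n S) borel (g' \<circ> entries n T)"
    by (rule indep_var_compose) measurable
  have eq: "f' (entries n S \<omega>) = f \<omega>" "g' (entries n T \<omega>) = g \<omega>" if "\<omega> \<in> space (M n)" for \<omega>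
    using f g that by auto
  have "(\<integral>\<omega>. f \<omega> * g \<omega> \<partial>M n) = (\<integral>\<omega>. (f' \<circ> entries n S) \<omega> * (g' \<circ> entries n T) \<omega> \<partial>M n)"
    by (intro Bochner_Integration.integral_cong) (auto simp: eq)
  also have "\<dots> = (\<integral>\<omega>. (f' \<circ> entries n S) \<omega> \<partial>M n) * (\<integral>\<omega>. (g' \<circ> entries n T) \<omega> \<partial>M n)"
  proof (rule indep_var_lebesgue_integral[OF ind])
    show "integrable (M n) (f' \<circ> entries n S)"
      using dep_integrable[OF assms(1)] by (subst Bochner_Integration.integrable_cong[OF refl, of _ _ f]) (auto simp: eq)
    show "integrable (M n) (g' \<circ> entries n T)"
      using dep_integrable[OF assms(2)] by (subst Bochner_Integration.integrable_cong[OF refl, of _ _ g]) (auto simp: eq)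
  qed
  also have "\<dots> = (\<integral>\<omega>. f \<omega> \<partial>M n) * (\<integral>\<omega>. g \<omega> \<partial>M n)"
    by (intro arg_cong2[of _ _ _ _ "(*)"] Bochner_Integration.integral_cong) (auto simp: eq)
  finally show ?thesis .
qed

lemma integral_entry_eq:
  fixes f :: "complex \<Rightarrow> complex"
  assumes "p < q" "q < n" and [measurable]: "f \<in> borel_measurable borel"
  shows "(\<integral>\<omega>. f (a n p q \<omega>) \<partial>M n) = (\<integral>\<omega>. f (A \<omega>) \<partial>P)"
proof -
  note [measurable] = meas_A
  have [measurable]: "a n p q \<in> borel_measurable (M n)" using assms by simp
  have "(\<integral>\<omega>. f (a n p q \<omega>) \<partial>M n) = (\<integral>x. f x \<partial>distr (M n) borel (a n p q))"
    by (simp add: integral_distr)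
  also have "\<dots> = (\<integral>x. f x \<partial>distr P borel A)" using distr_A[OF assms(1,2)] by simp
  also have "\<dots> = (\<integral>\<omega>. f (A \<omega>) \<partial>P)" by (simp add: integral_distr)
  finally show ?thesis .
qed

lemma integral_entry_0:
  assumes "p < n" "q < n"
  shows "(\<integral>\<omega>. a n p q \<omega> \<partial>M n) = 0"
proof (cases "p \<le> q")
  case False
  have "(\<integral>\<omega>. a n p q \<omega> \<partial>M n) = (\<integral>\<omega>. cnj (a n q p \<omega>) \<partial>M n)"
    by (intro Bochner_Integration.integral_cong refl herm assms)
  also have "\<dots> = cnj (\<integral>\<omega>. a n q p \<omega> \<partial>M n)" by simp
  finally show ?thesis using centered[of q p n] False assms by simp
qed (use centered assms in simp)

text \<open>Restricted to entries off the diagonal, the only ones that have the law of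
  \<open>A\<close>.\<close>

lemma integral_entry_norm_sq:
  assumes "p < n" "q < n" "p \<noteq> q"
  shows "(\<integral>\<omega>. a n p q \<omega> * a n q p \<omega> \<partial>M n) = complex_of_real (s\<^sup>2)"
proof -
  have *: "(\<integral>\<omega>. a n p q \<omega> * a n q p \<omega> \<partial>M n) = complex_of_real (s\<^sup>2)" if "p < q" "q < n" for p q
  proof -
    have "(\<integral>\<omega>. a n p q \<omega> * a n q p \<omega> \<partial>M n) = (\<integral>\<omega>. a n p q \<omega> * cnj (a n p q \<omega>) \<partial>M n)"
      using herm[of p n q] that by (intro Bochner_Integration.integral_cong) auto
    also have "\<dots> = (\<integral>\<omega>. A \<omega> * cnj (A \<omega>) \<partial>P)"
      using integral_entry_eq[OF that, of "\<lambda>x. x * cnj x"] by simp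
    also have "\<dots> = (\<integral>\<omega>. complex_of_real (cmod (A \<omega>) ^ 2) \<partial>P)"
      unfolding complex_norm_square ..
    also have "\<dots> = complex_of_real (s\<^sup>2)" using second_moment by (subst integral_complex_of_real) simp
    finally show ?thesis .
  qed
  show ?thesis
  proof (cases "p < q")
    case False
    then show ?thesis using *[of q p] assms by (simp add: mult.commute)
  qed (use * assms in auto)
qed

end

section \<open>Mixed moments of centred walk weights\<close>

text \<open>Both steps of a chosen pair traverse the same edge, so an edge used once belongs to no
  pair and its entry factors out.\<close>

lemma cycle_weight_edge_once:
  assumes "edge b (hd l) \<notin> path_edges (l @ [b])" "length l \<ge> 2"
  shows "cycle_weight a c (l @ [b]) = path_weight a c (l @ [b]) * a b (hd l)"
proof -
  obtain x y r where l: "l = x # y # r"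
    using assms(2) by (metis Suc_le_length_iff numeral_2_eq_2)
  obtain l' u where l': "l = l' @ [u]" using l by (metis list.discI rev_exhaust)
  have "edge u b \<in> path_edges (l @ [b])" using path_edges_append[of l' u "[b]"] by (simp add: l')
  then have "u \<noteq> hd l" using assms(1) by (metis edge_commute)
  then have 1: "path_weight a c (l @ [b, hd l]) = path_weight a c (l @ [b]) * a b (hd l)"
    using path_weight_snoc[of a c l' u b "hd l"] by (simp add: l')
  have "edge x y \<in> path_edges (l @ [b])" by (simp add: l)
  then have "y \<noteq> b" using assms(1) by (metis edge_commute l list.sel(1))
  then have "(l @ [b]) ! 1 \<noteq> last (l @ [b])" by (simp add: l)
  moreover have "hd (l @ [b]) = hd l" by (simp add: l)
  ultimately show ?thesis unfolding cycle_weight_def using 1 by simp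
qed

section \<open>Rotations of closed walks and visit counts\<close>

lemma path_edges_split:
  assumes "edge u w \<in> path_edges xs"
  obtains ys zs where "xs = ys @ u # w # zs \<or> xs = ys @ w # u # zs"
proof -
  have "\<exists>ys zs. xs = ys @ u # w # zs \<or> xs = ys @ w # u # zs"
    using assms
  proof (induction xs rule: path_edges.induct)
    case (3 x y r)
    show ?case
    proof (cases "edge u w = edge x y")
      case True
      then show ?thesis by (metis append_Nil edge_eq_iff)
    next
      case False
      then have "\<exists>ys zs. y # r = ys @ u # w # zs \<or> y # r = ys @ w # u # zs"
        using 3 by simp
      then show ?thesis by (metis append_Cons)
    qed
  qed auto
  then show ?thesis using that by blast
qed

lemma fst_path_edges: "e \<in> path_edges xs \<Longrightarrow> fst e \<in> set xs"
  by (induction xs rule: path_edges.induct) (auto simp: edge_def min_def)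

lemma fst_cycle_edges: "e \<in> cycle_edges p \<Longrightarrow> fst e \<in> set p"
  using fst_path_edges[of e "p @ [hd p]"] by (cases p) (auto simp: cycle_edges_def)

lemma cycle_edges_rotate_to:
  assumes "edge u w \<in> cycle_edges p" "length p \<ge> 2"
  obtains k r where "rotate k p = u # w # r \<or> rotate k p = w # u # r"
proof -
  have *: "\<exists>k r. rotate k p = u # w # r" if "p @ [hd p] = ys @ u # w # zs" for u w ys zs
  proof (cases zs rule: rev_cases)
    \<comment> \<open>Here the edge is the closing step from the last vertex back to the
      first.\<close>
    case Nil
    then have "p @ [hd p] = (ys @ [u]) @ [w]"
      using that by (simp only: Nil append.assoc append.simps)
    then have p: "p = ys @ [u]" "w = hd p" by (metis butlast_snoc, metis last_snoc)
    obtain z y' where y': "ys = z # y'" using assms(2) p by (cases ys) auto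
    then have "z = w" using p by simp
    have "rotate (length ys) p = u # w # y'"
      unfolding p(1) rotate_append y' \<open>z = w\<close> by simp
    then show ?thesis by blast
  next
    case (snoc zs' z)
    then have "p @ [hd p] = (ys @ u # w # zs') @ [z]"
      using that by (simp only: append.assoc append.simps)
    then have "p = ys @ u # w # zs'" by (metis butlast_snoc)
    then show ?thesis using rotate_append[of ys "u # w # zs'"] by (intro exI[of _ "length ys"]) auto
  qed
  show ?thesis using path_edges_split[OF assms(1)[unfolded cycle_edges_def]] * that by metis
qed

text \<open>The walk is cut at the end of the initial run inside \<open>S\<close>. This run has at
  least two vertices, so the step into \<open>b\<close> comes from \<open>S\<close> and cannot be
  the reverse of the step from \<open>b\<close> to \<open>c\<close>.\<close>

lemma rotate_exit:
  assumes "rotate k p = u # w # r" "u \<in> S" "w \<in> S" "\<not> set p \<subseteq> S"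
  obtains k' m x b c where "rotate k' p = c # m @ [x, b]" "x \<in> S" "b \<in> S" "c \<notin> S"
proof -
  define ys where "ys = takeWhile (\<lambda>v. v \<in> S) (u # w # r)"
  define zs where "zs = dropWhile (\<lambda>v. v \<in> S) (u # w # r)"
  have "set (u # w # r) = set p" using assms(1) set_rotate by metis
  then have "zs \<noteq> []" using assms(4) unfolding zs_def by (simp only: dropWhile_eq_Nil_conv) auto
  then obtain c zs' where zs: "zs = c # zs'" "c \<notin> S"
    unfolding zs_def by (metis dropWhile_eq_Cons_conv neq_Nil_conv)
  have "length ys \<ge> 2" using assms by (simp add: ys_def)
  then obtain y' x b where ys: "ys = y' @ [x, b]"
    by (metis (no_types) append.assoc append_Cons append_Nil length_append_singleton length_0_conv
        rev_exhaust not_less_eq_eq numeral_2_eq_2 zero_le le_zero_eq nat.simps(3))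
  have "\<forall>v\<in>set ys. v \<in> S" unfolding ys_def by (meson set_takeWhileD)
  then have "x \<in> S" "b \<in> S" unfolding ys by simp_all
  moreover have "rotate (length ys + k) p = zs @ ys"
  proof -
    have "ys @ zs = rotate k p" unfolding ys_def zs_def assms(1) by (rule takeWhile_dropWhile_id)
    then show ?thesis using rotate_append[of ys zs] by (simp flip: rotate_rotate)
  qed
  ultimately show ?thesis using that[of "length ys + k" c "zs' @ y'" x b] zs ys by simp
qed

lemma count_list_rotate [simp]:
  fixes p :: "'x list"
  shows "count_list (rotate k p) v = count_list p v"
proof -
  have "count_list (rotate1 p) v = count_list p v" for p :: "'x list"
    by (cases p) simp_all
  then show ?thesis by (induction k) simp_all
qed

lemma sum_count_list: "(\<Sum>v\<in>set xs. count_list xs v) = length xs"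
  using sum_count_set[of xs "set xs"] by simp

text \<open>Pigeonhole: every value occurs at least twice, and a length of at most twice the number
  of values leaves no room for a third occurrence.\<close>

lemma counts_eq_two:
  assumes "length xs \<le> 2 * card (set xs)" "\<And>v. count_list xs v \<noteq> 1" "v \<in> set xs"
  shows "count_list xs v = 2"
proof (rule ccontr)
  have ge: "count_list xs v \<ge> 2" if "v \<in> set xs" for v
    using assms(2)[of v] that count_list_0_iff[of xs v] by (metis One_nat_def Suc_1 less_2_cases_iff not_less)
  assume "count_list xs v \<noteq> 2"
  then have "(\<Sum>v\<in>set xs. 2) < (\<Sum>v\<in>set xs. count_list xs v)"
  proof (intro sum_strict_mono_ex1)
    show "\<exists>v\<in>set xs. 2 < count_list xs v" using ge[OF assms(3)] \<open>count_list xs v \<noteq> 2\<close> assms(3)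
      by (metis le_neq_implies_less)
  qed (use ge in blast)+
  then show False using assms(1) unfolding sum_count_list by simp
qed

definition is_walk :: "nat \<Rightarrow> nat list \<Rightarrow> bool" where
  "is_walk n p \<longleftrightarrow> length p \<ge> 2 \<and> set p \<subseteq> {..<n}"

definition drop_nth :: "nat \<Rightarrow> 'x list \<Rightarrow> 'x list" where
  "drop_nth j xs = take j xs @ drop (Suc j) xs"

lemma mset_drop_nth: "j < length xs \<Longrightarrow> mset (xs ! j # drop_nth j xs) = mset xs"
  by (subst (3) id_take_nth_drop[of j xs]) (simp_all add: drop_nth_def)

lemma set_drop_nth: "j < length xs \<Longrightarrow> set xs = insert (xs ! j) (set (drop_nth j xs))"
  using mset_drop_nth[of j xs] by (metis list.simps(15) mset_eq_setD)

lemma count_concat_drop_nth: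
  "j < length ps \<Longrightarrow> count_list (concat ps) v = count_list (ps ! j) v + count_list (concat (drop_nth j ps)) v"
  by (subst (1) id_take_nth_drop[of j ps]) (simp_all add: drop_nth_def)

section \<open>Mixed moments that vanish or factorise\<close>

context wigner
begin

definition cw :: "nat \<Rightarrow> nat list \<Rightarrow> 'a \<Rightarrow> complex" where
  "cw n p \<omega> = cycle_weight (\<lambda>x y. a n x y \<omega>) (complex_of_real (s\<^sup>2)) p"

definition xi :: "nat \<Rightarrow> nat list \<Rightarrow> 'a \<Rightarrow> complex" where
  "xi n p \<omega> = cw n p \<omega> - (\<integral>\<omega>. cw n p \<omega> \<partial>M n)"

definition mom :: "nat \<Rightarrow> nat list list \<Rightarrow> complex" where
  "mom n ps = (\<integral>\<omega>. (\<Prod>p\<leftarrow>ps. xi n p \<omega>) \<partial>M n)"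

lemma dep_path_weight:
  "set p \<subseteq> {..<n} \<Longrightarrow> dep n (path_edges p) (\<lambda>\<omega>. path_weight (\<lambda>x y. a n x y \<omega>) c p)"
proof (induction p rule: induct_list012)
  case (3 x y zs)
  have e: "dep n (path_edges (x # y # zs)) (a n x y)" using 3(3) by (intro dep_entry) auto
  show ?case
  proof (cases zs)
    case Nil
    then show ?thesis using e by simp
  next
    case (Cons z r)
    have 1: "dep n (path_edges (x # y # zs)) (\<lambda>\<omega>. path_weight (\<lambda>x y. a n x y \<omega>) c (y # zs))"
      by (rule dep_mono[OF 3(2)]) (use 3(3) in auto)
    have 2: "dep n (path_edges (x # y # zs)) (\<lambda>\<omega>. path_weight (\<lambda>x y. a n x y \<omega>) c zs)"
      by (rule dep_mono[OF 3(1)]) (use 3(3) path_edges_Cons[of zs y] in auto)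
    have 3: "dep n (path_edges (x # y # zs)) (\<lambda>\<omega>. if x = z then c * path_weight (\<lambda>x y. a n x y \<omega>) c zs else 0)"
      using dep_mult[OF dep_const 2] dep_const by (cases "x = z") auto
    show ?thesis
      using dep_diff[OF dep_mult[OF e 1] 3] unfolding Cons by simp
  qed
qed (auto intro: dep_const)

lemma dep_cw:
  assumes "is_walk n p"
  shows "dep n (cycle_edges p) (cw n p)"
proof -
  obtain x q where p: "p = x # q" using assms by (cases p) (auto simp: is_walk_def)
  have sub: "set (p @ [hd p]) \<subseteq> {..<n}" "set q \<subseteq> {..<n}" using assms by (auto simp: is_walk_def p)
  have 1: "dep n (cycle_edges p) (\<lambda>\<omega>. path_weight (\<lambda>x y. a n x y \<omega>) c (p @ [hd p]))" for c
    unfolding cycle_edges_def by (rule dep_path_weight[OF sub(1)])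
  have "path_edges q \<subseteq> cycle_edges p" unfolding p cycle_edges_Cons using path_edges_Cons[of q x] by auto
  then have 2: "dep n (cycle_edges p) (\<lambda>\<omega>. path_weight (\<lambda>x y. a n x y \<omega>) c q)" for c
    by (intro dep_mono[OF dep_path_weight[OF sub(2)]]) auto
  show ?thesis
    using dep_diff[OF 1 dep_mult[OF dep_const[of n _ "complex_of_real (s\<^sup>2)"] 2]] 1
    unfolding cw_def cycle_weight_def p by (cases "(x # q) ! 1 = last (x # q)") auto
qed

lemma dep_xi: "is_walk n p \<Longrightarrow> dep n (cycle_edges p) (xi n p)"
  unfolding xi_def by (intro dep_diff dep_const dep_cw)

lemma dep_prod_xi:
  assumes "\<And>p. p \<in> set ps \<Longrightarrow> is_walk n p"
  shows "dep n (\<Union>p\<in>set ps. cycle_edges p) (\<lambda>\<omega>. \<Prod>p\<leftarrow>ps. xi n p \<omega>)"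
  by (intro dep_prod_list dep_mono[OF dep_xi]) (use assms in auto)

lemma integral_xi: "is_walk n p \<Longrightarrow> (\<integral>\<omega>. xi n p \<omega> \<partial>M n) = 0"
proof -
  interpret prob_space "M n" by (rule prob)
  assume "is_walk n p"
  then show ?thesis using dep_integrable[OF dep_cw] unfolding xi_def
    by (subst Bochner_Integration.integral_diff) (auto simp: prob_space)
qed

lemma cw_rotate: "is_walk n p \<Longrightarrow> cw n (rotate k p) \<omega> = cw n p \<omega>"
  by (simp add: cw_def cycle_weight_rotate is_walk_def)

lemma xi_rotate: "is_walk n p \<Longrightarrow> xi n (rotate k p) \<omega> = xi n p \<omega>"
  by (simp add: xi_def cw_rotate)

lemma mom_mset:
  assumes "mset ps = mset qs"
  shows "mom n ps = mom n qs"
proof -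
  have "(\<Prod>p\<leftarrow>ps. xi n p \<omega>) = (\<Prod>p\<leftarrow>qs. xi n p \<omega>)" for \<omega>
    using assms by (metis mset_map prod_mset_prod_list)
  then show ?thesis by (simp add: mom_def)
qed

lemma mom_append:
  assumes "\<And>p. p \<in> set (ps @ qs) \<Longrightarrow> is_walk n p"
    and "(\<Union>p\<in>set ps. cycle_edges p) \<inter> (\<Union>p\<in>set qs. cycle_edges p) = {}"
  shows "mom n (ps @ qs) = mom n ps * mom n qs"
  unfolding mom_def using dep_indep[OF dep_prod_xi dep_prod_xi assms(2)] assms(1) by simp

lemma mom_isolated:
  assumes "is_walk n p" "\<And>q. q \<in> set ps \<Longrightarrow> is_walk n q \<and> cycle_edges p \<inter> cycle_edges q = {}"
  shows "mom n (p # ps) = 0"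
proof -
  have "mom n ([p] @ ps) = mom n [p] * mom n ps"
    by (rule mom_append) (use assms in auto)
  then show ?thesis using integral_xi[OF assms(1)] by (simp add: mom_def)
qed

lemma mom_factor_0:
  assumes "\<And>\<omega>. \<omega> \<in> space (M n) \<Longrightarrow> xi n p \<omega> = \<phi> \<omega> * \<psi> \<omega>" "dep n S \<phi>" "dep n T \<psi>" "S \<inter> T = {}"
    and "(\<integral>\<omega>. \<phi> \<omega> \<partial>M n) = 0"
    and "\<And>q. q \<in> set ps \<Longrightarrow> is_walk n q \<and> cycle_edges q \<subseteq> T"
  shows "mom n (p # ps) = 0"
proof -
  have "dep n T (\<lambda>\<omega>. \<psi> \<omega> * (\<Prod>p\<leftarrow>ps. xi n p \<omega>))"
    by (intro dep_mult assms(3) dep_mono[OF dep_prod_xi]) (use assms(6) in auto)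
  from dep_indep[OF assms(2) this assms(4)]
  have "(\<integral>\<omega>. \<phi> \<omega> * (\<psi> \<omega> * (\<Prod>p\<leftarrow>ps. xi n p \<omega>)) \<partial>M n) = 0" using assms(5) by simp
  also have "(\<integral>\<omega>. \<phi> \<omega> * (\<psi> \<omega> * (\<Prod>p\<leftarrow>ps. xi n p \<omega>)) \<partial>M n) = mom n (p # ps)"
    unfolding mom_def using assms(1) by (intro Bochner_Integration.integral_cong) auto
  finally show ?thesis .
qed

text \<open>The entry on this edge is centred and independent of all the rest. The weight itself
  then has mean zero, so centring does not destroy the product form.\<close>

lemma mom_edge_once:
  assumes "is_walk n p" "rotate k p = l @ [b]" "l \<noteq> []"
    and "edge b (hd l) \<notin> path_edges (l @ [b])"
    and "\<And>q. q \<in> set ps \<Longrightarrow> is_walk n q \<and> edge b (hd l) \<notin> cycle_edges q"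
  shows "mom n (p # ps) = 0"
proof -
  \<comment> \<open>A closed walk of two steps traverses its edge twice.\<close>
  have "length l \<noteq> 1"
  proof
    assume "length l = 1"
    then obtain c where "l = [c]" by (auto simp: length_Suc_conv)
    then show False using assms(4) by (simp add: edge_commute)
  qed
  then have len: "length l \<ge> 2" using assms(3) by (cases l; cases "tl l") auto
  have lb: "set (l @ [b]) \<subseteq> {..<n}" using assms(1,2) by (metis is_walk_def set_rotate)
  have bl: "b < n" "hd l < n" using lb assms(3) by (auto simp: subset_iff)
  define \<psi> where "\<psi> \<omega> = path_weight (\<lambda>x y. a n x y \<omega>) (complex_of_real (s\<^sup>2)) (l @ [b])" for \<omega>
  let ?T = "- {edge b (hd l)}"
  have d1: "dep n {edge b (hd l)} (a n b (hd l))" using bl by (intro dep_entry) auto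
  have d2: "dep n ?T \<psi>" unfolding \<psi>_def using assms(4) by (intro dep_mono[OF dep_path_weight[OF lb]]) auto
  have cw: "cw n p \<omega> = a n b (hd l) \<omega> * \<psi> \<omega>" for \<omega>
    using cycle_weight_edge_once[OF assms(4) len] cw_rotate[OF assms(1), of k \<omega>] assms(2)
    by (simp add: cw_def \<psi>_def mult.commute)
  have "(\<integral>\<omega>. cw n p \<omega> \<partial>M n) = 0"
    unfolding cw using dep_indep[OF d1 d2] integral_entry_0[OF bl] by simp
  then have "xi n p \<omega> = a n b (hd l) \<omega> * \<psi> \<omega>" for \<omega> by (simp add: xi_def cw)
  then show ?thesis
    by (rule mom_factor_0[OF _ d1 d2]) (use integral_entry_0[OF bl] assms(5) in auto)
qed

lemma mom_vertex_once:
  assumes "\<And>p. p \<in> set ps \<Longrightarrow> is_walk n p" "count_list (concat ps) v = 1"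
  shows "mom n ps = 0"
proof -
  have "v \<in> set (concat ps)" using assms(2) count_list_0_iff[of "concat ps" v] by auto
  then obtain p where "p \<in> set ps" "v \<in> set p" by auto
  then obtain ps1 ps2 where ps: "ps = ps1 @ p # ps2" by (meson split_list)
  have cnt: "count_list p v + count_list (concat (ps1 @ ps2)) v = 1" using assms(2) by (simp add: ps)
  have "count_list p v \<noteq> 0" using \<open>v \<in> set p\<close> by (simp add: count_list_0_iff)
  then have "count_list p v = 1" "count_list (concat (ps1 @ ps2)) v = 0" using cnt by linarith+
  then have v: "\<And>q. q \<in> set (ps1 @ ps2) \<Longrightarrow> v \<notin> set q" by (auto simp: count_list_0_iff)
  have walk: "is_walk n p" using assms(1) ps by simp
  obtain us ws where "p = us @ v # ws" using \<open>v \<in> set p\<close> by (meson split_list)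
  then have rot: "rotate (length us) p = v # (ws @ us)"
    by (simp add: rotate_append)
  define q where "q = ws @ us"
  note rot = rot[folded q_def]
  have "count_list (v # q) v = 1" using \<open>count_list p v = 1\<close> rot by (metis count_list_rotate)
  then have vq: "v \<notin> set q" by (simp add: count_list_0_iff)
  have vqn: "set (v # q) \<subseteq> {..<n}" "length (v # q) \<ge> 2"
    using walk rot by (metis is_walk_def set_rotate, metis is_walk_def length_rotate)
  then have q0: "q \<noteq> []" by auto
  have n: "v < n" "hd q < n" "last q < n" "set q \<subseteq> {..<n}"
    using vqn q0 by (auto simp: subset_iff)
  have ne: "v \<noteq> hd q" "v \<noteq> last q" using vq q0 by auto
  \<comment> \<open>All edges at \<open>v\<close>: the two steps through \<open>v\<close> lie in
    \<open>S\<close>, all other steps of the family in its complement.\<close>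
  define S where "S = {e. \<exists>x. e = edge v x}"
  have edges: "path_edges r \<subseteq> - S" "cycle_edges r \<subseteq> - S" if "v \<notin> set r" for r
    using that path_edges_ends[of v _ r] cycle_edges_ends[of v _ r] by (auto simp: S_def)
  let ?c = "complex_of_real (s\<^sup>2)"
  define c' where "c' = (if hd q = last q then ?c else 0)"
  define \<psi> where "\<psi> \<omega> = (if length q = 1 then 1 else path_weight (\<lambda>x y. a n x y \<omega>) ?c q)" for \<omega>
  define \<phi> where "\<phi> \<omega> = a n v (hd q) \<omega> * a n (last q) v \<omega> - c'" for \<omega>
  have d1: "dep n S \<phi>" unfolding \<phi>_def
    by (intro dep_diff dep_mult dep_const dep_entry) (use n in \<open>auto simp: S_def edge_commute\<close>)
  have d2: "dep n (- S) \<psi>"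
    unfolding \<psi>_def using dep_mono[OF dep_path_weight[OF n(4)]] edges(1)[OF vq] dep_const
    by (cases "length q = 1") auto
  interpret prob_space "M n" by (rule prob)
  \<comment> \<open>If the two neighbours of \<open>v\<close> coincide, the constant is the mean of
    the product of opposite entries; otherwise the product consists of two independent centred
    entries.\<close>
  have \<phi>0: "(\<integral>\<omega>. \<phi> \<omega> \<partial>M n) = 0"
  proof (cases "hd q = last q")
    case True
    have "(\<integral>\<omega>. \<phi> \<omega> \<partial>M n) = (\<integral>\<omega>. a n v (hd q) \<omega> * a n (hd q) v \<omega> \<partial>M n) - c'"
      unfolding \<phi>_def True[symmetric]
      by (subst Bochner_Integration.integral_diff)
         (use dep_integrable[OF dep_mult[OF dep_entry dep_entry, of v n "hd q" UNIV "hd q" v]] n in \<open>auto simp: prob_space\<close>)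
    then show ?thesis using integral_entry_norm_sq[OF n(1,2) ne(1)] True by (simp add: c'_def)
  next
    case False
    have "(\<integral>\<omega>. a n v (hd q) \<omega> * a n (last q) v \<omega> \<partial>M n) = 0"
      using integral_entry_0[of v n "hd q"] n False ne
      by (subst dep_indep[of n "{edge v (hd q)}" _ "{edge v (last q)}"])
         (auto intro!: dep_entry simp: edge_commute edge_eq_iff)
    then show ?thesis using False by (simp add: \<phi>_def c'_def)
  qed
  have xi: "xi n p \<omega> = \<phi> \<omega> * \<psi> \<omega>" for \<omega>
  proof (cases "length q = 1")
    case True
    then obtain y where y: "q = [y]" by (auto simp: length_Suc_conv)
    \<comment> \<open>The weight of two steps carries \<open>2 * ?c\<close> instead of
      \<open>?c\<close>; the surplus constant disappears in the centring.\<close>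
    have "cw n p \<omega> = \<phi> \<omega> - ?c" for \<omega>
      using cw_rotate[OF walk, of "length us" \<omega>] rot
      by (simp add: cw_def cycle_weight_def y \<phi>_def c'_def)
    then show ?thesis using \<phi>0 True dep_integrable[OF d1]
      by (simp add: xi_def \<psi>_def prob_space Bochner_Integration.integral_diff)
  next
    case False
    then have "length q \<ge> 2" using q0 by (cases q; cases "tl q") auto
    note head = cycle_weight_simple_head[OF vq this]
    have cw: "cw n p \<omega> = \<phi> \<omega> * \<psi> \<omega>" for \<omega>
    proof -
      have "cw n p \<omega> = cw n (v # q) \<omega>" using cw_rotate[OF walk, of "length us" \<omega>] rot by simp
      then show ?thesis using False unfolding cw_def head \<phi>_def \<psi>_def c'_def by simp
    qed
    have "(\<integral>\<omega>. cw n p \<omega> \<partial>M n) = 0" unfolding cw using dep_indep[OF d1 d2] \<phi>0 by simp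
    then show ?thesis by (simp add: xi_def cw)
  qed
  have "mom n (p # ps1 @ ps2) = 0"
    by (rule mom_factor_0[OF xi d1 d2 _ \<phi>0]) (use v edges(2) assms(1) ps in auto)
  moreover have "mset ps = mset (p # ps1 @ ps2)" by (simp add: ps)
  ultimately show ?thesis using mom_mset by metis
qed

text \<open>Where \<open>p\<close> leaves the vertex set of \<open>q\<close>, say through an edge from \<open>b\<close> to \<open>c\<close>, the vertex \<open>b\<close> is visited once
  by each of \<open>p\<close>, \<open>q\<close> and by no other walk, so that this edge is used only once.\<close>

lemma mom_partial_overlap_aux:
  assumes "\<And>r. r \<in> set (p # q # ps) \<Longrightarrow> is_walk n r"
    and "\<And>v. count_list (concat (p # q # ps)) v \<le> 2"
    and "cycle_edges p \<inter> cycle_edges q \<noteq> {}" "\<not> set p \<subseteq> set q"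
  shows "mom n (p # q # ps) = 0"
proof -
  have "\<exists>u w. edge u w \<in> cycle_edges p \<inter> cycle_edges q"
  proof -
    obtain i j where ij: "(i, j) \<in> cycle_edges p" "(i, j) \<in> cycle_edges q" using assms(3) by auto
    have "i \<le> j" if "(i, j) \<in> path_edges xs" for xs
      using that by (induction xs rule: path_edges.induct) (auto simp: edge_def)
    then have "edge i j = (i, j)" using ij by (auto simp: cycle_edges_def edge_def)
    then show ?thesis using ij by (intro exI[of _ i] exI[of _ j]) simp
  qed
  then obtain u w where uw: "edge u w \<in> cycle_edges p" "edge u w \<in> cycle_edges q" by auto
  have "length p \<ge> 2" using assms(1)[of p] by (simp add: is_walk_def)
  from cycle_edges_rotate_to[OF uw(1) this]
  obtain k r where rot: "rotate k p = u # w # r \<or> rotate k p = w # u # r" by metis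
  have S: "u \<in> set q" "w \<in> set q" using cycle_edges_ends[OF uw(2)] by auto
  from rot obtain k' m x b c where e: "rotate k' p = c # m @ [x, b]" "x \<in> set q" "b \<in> set q" "c \<notin> set q"
  proof
    assume "rotate k p = u # w # r"
    from rotate_exit[OF this S assms(4)] that show ?thesis by metis
  next
    assume "rotate k p = w # u # r"
    from rotate_exit[OF this S(2,1) assms(4)] that show ?thesis by metis
  qed
  have "count_list (c # m @ [x, b]) b = count_list p b" using e(1) by (metis count_list_rotate)
  moreover have "count_list q b \<ge> 1" using e(3) count_list_0_iff[of q b] by linarith
  ultimately have cnt: "count_list (c # m @ [x, b]) b = 1" "count_list (concat ps) b = 0"
    using assms(2)[of b] by (auto split: if_splits)
  have b1: "b \<notin> set (c # m @ [x])"
    using cnt(1) by (auto simp: count_list_0_iff split: if_splits)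
  have b2: "b \<notin> set r" if "r \<in> set ps" for r using cnt(2) that by (auto simp: count_list_0_iff)
  show ?thesis
  proof (rule mom_edge_once[where l = "c # m @ [x]" and b = b and k = k'])
    show "edge b (hd (c # m @ [x])) \<notin> path_edges ((c # m @ [x]) @ [b])"
    proof
      assume *: "edge b (hd (c # m @ [x])) \<in> path_edges ((c # m @ [x]) @ [b])"
      have "path_edges ((c # m) @ x # [b]) = path_edges ((c # m) @ [x]) \<union> path_edges [x, b]"
        by (rule path_edges_append)
      then have "edge b c \<in> path_edges (c # m @ [x]) \<or> edge b c = edge x b" using * by auto
      then show False using path_edges_ends[of b c "c # m @ [x]"] b1 e by (auto simp: edge_eq_iff)
    qed
  qed (use assms(1) e b1 b2 cycle_edges_ends[of b c] in auto)
qed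

lemma mom_partial_overlap:
  assumes "\<And>r. r \<in> set (p # q # ps) \<Longrightarrow> is_walk n r"
    and "\<And>v. count_list (concat (p # q # ps)) v \<le> 2"
    and "cycle_edges p \<inter> cycle_edges q \<noteq> {}" "set p \<noteq> set q"
  shows "mom n (p # q # ps) = 0"
proof (cases "set p \<subseteq> set q")
  case True
  have "mom n (q # p # ps) = 0"
  proof (rule mom_partial_overlap_aux)
    show "count_list (concat (q # p # ps)) v \<le> 2" for v using assms(2)[of v] by simp
  qed (use assms True in auto)
  then show ?thesis by (subst mom_mset[of _ "q # p # ps"]) auto
qed (use mom_partial_overlap_aux assms in blast)

text \<open>A Wick recursion without error term. If no vertex is visited once, each is visited
  exactly twice. Then either a walk with the vertex set of \<open>p\<close> exhausts all visits
  there, so that this pair splits off, or both sides vanish.\<close>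

lemma mom_recursion:
  assumes walk: "\<And>r. r \<in> set (p # ps) \<Longrightarrow> is_walk n r"
    and card: "length (concat (p # ps)) \<le> 2 * card (set (concat (p # ps)))"
  shows "mom n (p # ps) = (\<Sum>j<length ps. mom n [p, ps ! j] * mom n (drop_nth j ps))"
proof (cases "\<exists>v. count_list (concat (p # ps)) v = 1")
  case True
  then obtain v where v: "count_list (concat (p # ps)) v = 1" by auto
  \<comment> \<open>A vertex visited once by the whole family is visited once by the pair or once by
    the remaining walks.\<close>
  have G0: "mom n [p, ps ! j] * mom n (drop_nth j ps) = 0" if j: "j < length ps" for j
  proof -
    have "count_list p v + count_list (ps ! j) v + count_list (concat (drop_nth j ps)) v = 1"
      using v count_concat_drop_nth[OF j, of v] by simp
    then consider "count_list (concat [p, ps ! j]) v = 1" | "count_list (concat (drop_nth j ps)) v = 1"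
      by fastforce
    then show ?thesis
    proof cases
      case 1
      have "mom n [p, ps ! j] = 0" by (rule mom_vertex_once[OF _ 1]) (use walk j in auto)
      then show ?thesis by simp
    next
      case 2
      have "mom n (drop_nth j ps) = 0"
        by (rule mom_vertex_once[OF _ 2]) (use walk set_drop_nth[OF j] in auto)
      then show ?thesis by simp
    qed
  qed
  have "(\<Sum>j<length ps. mom n [p, ps ! j] * mom n (drop_nth j ps)) = 0"
    by (intro sum.neutral ballI G0) simp
  then show ?thesis using mom_vertex_once[OF walk v] by simp
next
  case False
  let ?C = "concat (p # ps)"
  have two: "count_list ?C v = 2" if "v \<in> set ?C" for v
    by (rule counts_eq_two[OF card _ that]) (use False in blast)
  have le2: "count_list ?C v \<le> 2" for v
    using two[of v] count_list_0_iff[of ?C v] by (cases "v \<in> set ?C") auto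
  have le2': "count_list (concat [p, ps ! j]) v \<le> 2" if "j < length ps" for j v
    using le2[of v] count_concat_drop_nth[OF that, of v] by simp
  show ?thesis
  proof (cases "\<exists>j<length ps. set p = set (ps ! j)")
    case True
    then obtain j where j: "j < length ps" "set p = set (ps ! j)" by auto
    have disj: "v \<notin> set (concat (drop_nth j ps))" if "v \<in> set p" for v
    proof -
      have "count_list p v \<ge> 1" "count_list (ps ! j) v \<ge> 1"
        using that j(2) count_list_0_iff[of _ v] by (metis One_nat_def Suc_leI neq0_conv)+
      moreover have "count_list p v + (count_list (ps ! j) v + count_list (concat (drop_nth j ps)) v) \<le> 2"
        using le2[of v] count_concat_drop_nth[OF j(1), of v] by simp
      ultimately have "count_list (concat (drop_nth j ps)) v = 0" by linarith
      then show ?thesis unfolding count_list_0_iff .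
    qed
    have disj_edges: "cycle_edges r \<inter> cycle_edges q = {}" if "r \<in> {p, ps ! j}" "q \<in> set (drop_nth j ps)" for r q
    proof (rule ccontr)
      assume "cycle_edges r \<inter> cycle_edges q \<noteq> {}"
      then obtain x where "x \<in> set r" "x \<in> set q" using fst_cycle_edges by blast
      then show False using that disj[of x] j(2) by auto
    qed
    have set_drop: "r \<in> set ps" if "r \<in> set (drop_nth j ps)" for r using that set_drop_nth[OF j(1)] by auto
    have "mom n (p # ps) = mom n ([p, ps ! j] @ drop_nth j ps)"
      by (rule mom_mset) (use mset_drop_nth[OF j(1)] in auto)
    also have "\<dots> = mom n [p, ps ! j] * mom n (drop_nth j ps)"
    proof (rule mom_append)
      show "(\<Union>r\<in>set [p, ps ! j]. cycle_edges r) \<inter> (\<Union>q\<in>set (drop_nth j ps). cycle_edges q) = {}"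
      proof (rule equals0I)
        fix e assume "e \<in> (\<Union>r\<in>set [p, ps ! j]. cycle_edges r) \<inter> (\<Union>q\<in>set (drop_nth j ps). cycle_edges q)"
        then obtain r q where "r \<in> {p, ps ! j}" "q \<in> set (drop_nth j ps)" "e \<in> cycle_edges r \<inter> cycle_edges q"
          by auto
        then show False using disj_edges by blast
      qed
    qed (use walk j(1) set_drop in auto)
    also have "\<dots> = (\<Sum>i\<in>{j}. mom n [p, ps ! i] * mom n (drop_nth i ps))" by simp
    \<comment> \<open>The other walks share no edge with \<open>p\<close>, so the added summands
      contain the mean of a centred weight.\<close>
    also have "\<dots> = (\<Sum>i<length ps. mom n [p, ps ! i] * mom n (drop_nth i ps))"
    proof (rule sum.mono_neutral_left)
      show "\<forall>i\<in>{..<length ps} - {j}. mom n [p, ps ! i] * mom n (drop_nth i ps) = 0"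
      proof
        fix i assume i: "i \<in> {..<length ps} - {j}"
        have "ps ! i \<in> set (drop_nth j ps)"
        proof (cases "i < j")
          case True
          then have "take j ps ! i = ps ! i" "i < length (take j ps)" using j(1) by auto
          then show ?thesis unfolding drop_nth_def by (metis UnCI nth_mem set_append)
        next
          case False
          then have "drop (Suc j) ps ! (i - Suc j) = ps ! i" "i - Suc j < length (drop (Suc j) ps)"
            using i by auto
          then show ?thesis unfolding drop_nth_def by (metis UnCI nth_mem set_append)
        qed
        then have "mom n [p, ps ! i] = 0"
          by (intro mom_isolated) (use walk i disj_edges in auto)
        then show "mom n [p, ps ! i] * mom n (drop_nth i ps) = 0" by simp
      qed
    qed (use j in auto)
    finally show ?thesis .
  next
    case False
    \<comment> \<open>No walk has the vertex set of \<open>p\<close>. A shared edge is then a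
      partial overlap, and without shared edges \<open>p\<close> is isolated; this applies to each
      pair and to the whole family alike.\<close>
    have "mom n [p, ps ! j] = 0" if j: "j < length ps" for j
    proof (cases "cycle_edges p \<inter> cycle_edges (ps ! j) = {}")
      case True
      then show ?thesis by (intro mom_isolated) (use walk j in auto)
    next
      case overlap: False
      show ?thesis
        by (rule mom_partial_overlap) (use walk j le2'[OF j] overlap False in auto)
    qed
    moreover have "mom n (p # ps) = 0"
    proof (cases "\<exists>j<length ps. cycle_edges p \<inter> cycle_edges (ps ! j) \<noteq> {}")
      case True
      then obtain j where j: "j < length ps" "cycle_edges p \<inter> cycle_edges (ps ! j) \<noteq> {}" by auto
      have "mom n (p # ps ! j # drop_nth j ps) = 0"
      proof (rule mom_partial_overlap)
        show "count_list (concat (p # ps ! j # drop_nth j ps)) v \<le> 2" for v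
          using le2[of v] count_concat_drop_nth[OF j(1), of v] by simp
      qed (use walk j False set_drop_nth[OF j(1)] in auto)
      moreover have "mset (p # ps) = mset (p # ps ! j # drop_nth j ps)"
        using mset_drop_nth[OF j(1)] by simp
      ultimately show ?thesis using mom_mset by metis
    next
      case False
      then show ?thesis
        by (intro mom_isolated) (use walk in \<open>auto simp: in_set_conv_nth\<close>)
    qed
    ultimately show ?thesis by simp
  qed
qed

end

section \<open>Asymptotic moment recursion\<close>

text \<open>The negation of the size hypothesis of \<open>mom_recursion\<close>.\<close>

definition sparse_family :: "'x list list \<Rightarrow> bool" where
  "sparse_family ps \<longleftrightarrow> 2 * card (set (concat ps)) < length (concat ps)"

text \<open>A list with at most \<open>v\<close> values is determined by an alphabet of
  \<open>v\<close> letters and a word of positions in it.\<close>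

lemma card_tuples_few_values:
  assumes "n > 0" "v > 0"
  shows "card {xs \<in> walks n L. card (set xs) \<le> v} \<le> n ^ v * v ^ L"
proof -
  have "{xs \<in> walks n L. card (set xs) \<le> v} \<subseteq>
     (\<lambda>(ys, is). map (\<lambda>i. ys ! i) is) ` (walks n v \<times> walks v L)"
  proof safe
    fix xs assume xs: "xs \<in> walks n L" "card (set xs) \<le> v"
    define zs where "zs = remdups xs"
    define ys where "ys = zs @ replicate (v - length zs) 0"
    have zs: "set zs = set xs" "length zs \<le> v" using xs(2) by (auto simp: zs_def length_remdups_card_conv)
    have ys: "ys \<in> walks n v" using xs(1) zs assms(1) by (auto simp: ys_def tuples_def)
    have "\<exists>i<v. ys ! i = x" if "x \<in> set xs" for x
    proof -
      have "x \<in> set zs" using that zs(1) by simp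
      then obtain i where "i < length zs" "zs ! i = x" unfolding in_set_conv_nth by blast
      then show ?thesis using zs(2) by (intro exI[of _ i]) (auto simp: ys_def nth_append)
    qed
    then obtain ix where ix: "\<And>x. x \<in> set xs \<Longrightarrow> ix x < v \<and> ys ! ix x = x" by metis
    have "map (\<lambda>i. ys ! i) (map ix xs) = xs" using ix by (intro nth_equalityI) auto
    moreover have "map ix xs \<in> walks v L" using ix xs(1) by (auto simp: tuples_def)
    ultimately show "xs \<in> (\<lambda>(ys, is). map (\<lambda>i. ys ! i) is) ` (walks n v \<times> walks v L)"
      using ys by (intro image_eqI[of _ _ "(ys, map ix xs)"]) auto
  qed
  then have "card {xs \<in> walks n L. card (set xs) \<le> v} \<le>
      card ((\<lambda>(ys, is). map (\<lambda>i. ys ! i) is) ` (walks n v \<times> walks v L))"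
    by (intro card_mono) auto
  also have "\<dots> \<le> card (walks n v \<times> walks v L)" by (rule card_image_le) auto
  finally show ?thesis by (simp add: card_cartesian_product card_tuples)
qed

definition walk_family :: "nat \<Rightarrow> nat set \<Rightarrow> nat list set" where
  "walk_family n J = (\<Union>m\<in>J. walks n m)"

lemma finite_walk_family [simp]: "finite J \<Longrightarrow> finite (walk_family n J)"
  by (simp add: walk_family_def)

text \<open>Among total length L a sparse family has at most (L - 1) / 2 vertices, so the number of
  such families is O(n^((L-1)/2)), while each has weight n^(-L/2).\<close>

lemma sparse_sum_bound:
  assumes "finite J"
  shows "\<exists>C\<ge>0. \<forall>n>0. (\<Sum>ps | ps \<in> tuples (walk_family n J) r \<and> sparse_family ps.
      (1 / sqrt (real n)) ^ length (concat ps)) \<le> C / sqrt (real n)"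
proof -
  \<comment> \<open>For each list of lengths with sum L, \<open>L ^ L\<close> dominates the number
    of words of length L over the alphabet of vertices.\<close>
  define C where "C = (\<Sum>ls\<in>tuples J r. real (sum_list ls ^ sum_list ls))"
  have "(\<Sum>ps | ps \<in> tuples (walk_family n J) r \<and> sparse_family ps.
      (1 / sqrt (real n)) ^ length (concat ps)) \<le> C / sqrt (real n)" if n: "n > 0" for n
  proof -
    let ?S = "{ps. ps \<in> tuples (walk_family n J) r \<and> sparse_family ps}"
    let ?sn = "sqrt (real n)"
    have fin: "finite ?S" using assms by simp
    have shape: "map length ` ?S \<subseteq> tuples J r"
    proof
      fix ls assume "ls \<in> map length ` ?S"
      then obtain ps where ps: "ls = map length ps" "length ps = r" "set ps \<subseteq> walk_family n J"
        by (auto simp: tuples_def)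
      have "length p \<in> J" if "p \<in> set ps" for p
        using that ps(3) by (auto simp: walk_family_def tuples_def)
      then show "ls \<in> tuples J r" using ps by (auto simp: tuples_def)
    qed
    have "(\<Sum>ps\<in>?S. (1 / ?sn) ^ length (concat ps)) =
       (\<Sum>ls\<in>tuples J r. \<Sum>ps | ps \<in> ?S \<and> map length ps = ls. (1 / ?sn) ^ length (concat ps))"
      by (rule sum.group[OF fin finite_tuples[OF assms] shape, symmetric])
    also have "\<dots> \<le> (\<Sum>ls\<in>tuples J r. real (sum_list ls ^ sum_list ls) / ?sn)"
    proof (rule sum_mono)
      fix ls assume "ls \<in> tuples J r"
      let ?L = "sum_list ls"
      let ?T = "{ps \<in> ?S. map length ps = ls}"
      have len: "length (concat ps) = ?L" if "ps \<in> ?T" for ps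
        using that by (auto simp: length_concat)
      define v where "v = (?L - 1) div 2"
      have "real (card ?T) * (1 / ?sn) ^ ?L \<le> real (?L ^ ?L) / ?sn"
      proof (cases "?T = {}")
        case False
        then obtain ps where ps: "ps \<in> ?T" by auto
        then have L: "?L > 0" "2 * card (set (concat ps)) < ?L" using len[OF ps] by (auto simp: sparse_family_def)
        have "concat ps \<noteq> []" using L len[OF ps] by (metis length_greater_0_conv)
        then have "card (set (concat ps)) > 0" by (metis List.finite_set card_gt_0_iff set_empty)
        then have v: "v > 0" "2 * v \<le> ?L - 1" "v \<le> ?L" using L unfolding v_def by linarith+
        \<comment> \<open>Once the lengths are fixed by \<open>ls\<close>, a family can be recovered
          from its concatenation.\<close>
        have inj: "inj_on concat ?T"
        proof
          fix xs ys assume "xs \<in> ?T" "ys \<in> ?T" and eq: "concat xs = concat ys"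
          then have "map length xs = map length ys" by simp
          then have "length xs = length ys" "\<forall>(x, y)\<in>set (zip xs ys). length x = length y"
            by (metis length_map, auto simp: set_zip list_eq_iff_nth_eq)
          then show "xs = ys" using concat_eq_concat_iff eq by blast
        qed
        have "concat ` ?T \<subseteq> {xs \<in> walks n ?L. card (set xs) \<le> v}"
        proof safe
          fix xs assume xs: "xs \<in> tuples (walk_family n J) r" "sparse_family xs" "ls = map length xs"
          then show "concat xs \<in> walks n (sum_list (map length xs))"
            by (fastforce simp: tuples_def walk_family_def length_concat)
          show "card (set (concat xs)) \<le> v" using xs by (auto simp: v_def sparse_family_def length_concat)
        qed
        then have "card ?T \<le> card {xs \<in> walks n ?L. card (set xs) \<le> v}"
          using card_mono[of "{xs \<in> walks n ?L. card (set xs) \<le> v}" "concat ` ?T"] card_image[OF inj] by simp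
        also have "\<dots> \<le> n ^ v * v ^ ?L" using card_tuples_few_values n v(1) by blast
        also have "\<dots> \<le> n ^ v * ?L ^ ?L" using v(3) by (intro mult_mono power_mono) auto
        finally have "real (card ?T) \<le> real (n ^ v * ?L ^ ?L)" by (rule of_nat_mono)
        also have "\<dots> = real n ^ v * real (?L ^ ?L)" by simp
        finally have "real (card ?T) \<le> real n ^ v * real (?L ^ ?L)" .
        then have "real (card ?T) * (1 / ?sn) ^ ?L \<le> (real n ^ v * real (?L ^ ?L)) * (1 / ?sn) ^ ?L"
          by (intro mult_right_mono) auto
        also have "real n ^ v = ?sn ^ (2 * v)" by (simp add: power_mult)
        also have "?sn ^ (2 * v) * real (?L ^ ?L) * (1 / ?sn) ^ ?L \<le>
            ?sn ^ (?L - 1) * real (?L ^ ?L) * (1 / ?sn) ^ ?L"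
          using n v(2) by (intro mult_right_mono power_increasing) auto
        also have "?sn ^ (?L - 1) * real (?L ^ ?L) * (1 / ?sn) ^ ?L = real (?L ^ ?L) / ?sn"
          using n L(1) by (cases ?L) (simp_all add: power_divide field_simps)
        finally show ?thesis .
      next
        case True
        show ?thesis unfolding True using n by simp
      qed
      then show "(\<Sum>ps\<in>?T. (1 / ?sn) ^ length (concat ps)) \<le> real (?L ^ ?L) / ?sn"
        using len by simp
    qed
    finally show ?thesis by (simp add: C_def sum_divide_distrib)
  qed
  moreover have "C \<ge> 0" unfolding C_def by (intro sum_nonneg) auto
  ultimately show ?thesis by blast
qed

section \<open>Uniform moment bounds\<close>

context wigner
begin

text \<open>The index set grows with n, while the bound for each power depends neither on n nor on
  the index.\<close>

definition unif_moments :: "(nat \<Rightarrow> 'i set) \<Rightarrow> (nat \<Rightarrow> 'i \<Rightarrow> 'a \<Rightarrow> complex) \<Rightarrow> bool" where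
  "unif_moments I f \<longleftrightarrow> (\<forall>n. \<forall>i\<in>I n. dep n UNIV (f n i)) \<and>
     (\<forall>k. \<exists>C. \<forall>n. \<forall>i\<in>I n. (\<integral>\<omega>. cmod (f n i \<omega>) ^ k \<partial>M n) \<le> C)"

lemma unif_momentsD: "unif_moments I f \<Longrightarrow> i \<in> I n \<Longrightarrow> dep n UNIV (f n i)"
  by (auto simp: unif_moments_def)

lemma unif_moments_bound:
  assumes "unif_moments I f"
  obtains C where "C \<ge> 0" "\<And>n i. i \<in> I n \<Longrightarrow> (\<integral>\<omega>. cmod (f n i \<omega>) ^ k \<partial>M n) \<le> C"
proof -
  obtain C where "\<And>n i. i \<in> I n \<Longrightarrow> (\<integral>\<omega>. cmod (f n i \<omega>) ^ k \<partial>M n) \<le> C"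
    using assms unfolding unif_moments_def by blast
  then show ?thesis by (intro that[of "max 0 C"]) (auto simp: le_max_iff_disj)
qed

lemma unif_moments_const:
  assumes "\<And>n i. i \<in> I n \<Longrightarrow> cmod (c n i) \<le> B"
  shows "unif_moments I (\<lambda>n i \<omega>. c n i)"
  unfolding unif_moments_def
proof (intro conjI allI ballI exI)
  fix n k i assume "i \<in> I n"
  interpret prob_space "M n" by (rule prob)
  show "(\<integral>\<omega>. cmod (c n i) ^ k \<partial>M n) \<le> B ^ k"
    using power_mono[OF assms[OF \<open>i \<in> I n\<close>] norm_ge_zero, of k] by (simp add: prob_space)
qed (rule dep_const)

lemma unif_moments_reindex:
  assumes "unif_moments I f" "\<And>n i. i \<in> I' n \<Longrightarrow> h n i \<in> I n"
  shows "unif_moments I' (\<lambda>n i. f n (h n i))"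
  using assms unfolding unif_moments_def by blast

lemma unif_moments_cong:
  assumes "unif_moments I f" "\<And>n i. i \<in> I n \<Longrightarrow> f n i = g n i"
  shows "unif_moments I g"
  using assms unfolding unif_moments_def by simp

lemma unif_moments_mult:
  assumes "unif_moments I f" "unif_moments I g"
  shows "unif_moments I (\<lambda>n i \<omega>. f n i \<omega> * g n i \<omega>)"
  unfolding unif_moments_def
proof (intro conjI allI ballI)
  fix n i assume "i \<in> I n"
  then show "dep n UNIV (\<lambda>\<omega>. f n i \<omega> * g n i \<omega>)" 
    by (intro dep_mult unif_momentsD[OF assms(1)] unif_momentsD[OF assms(2)])
next
  fix k
  obtain C where C: "\<And>n i. i \<in> I n \<Longrightarrow> (\<integral>\<omega>. cmod (f n i \<omega>) ^ (2 * k) \<partial>M n) \<le> C"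
    using unif_moments_bound[OF assms(1)] by metis
  obtain D where D: "\<And>n i. i \<in> I n \<Longrightarrow> (\<integral>\<omega>. cmod (g n i \<omega>) ^ (2 * k) \<partial>M n) \<le> D"
    using unif_moments_bound[OF assms(2)] by metis
  have "(\<integral>\<omega>. cmod (f n i \<omega> * g n i \<omega>) ^ k \<partial>M n) \<le> C + D" if i: "i \<in> I n" for n i
  proof -
    note d = unif_momentsD[OF assms(1) i] unif_momentsD[OF assms(2) i]
    have "(\<integral>\<omega>. cmod (f n i \<omega> * g n i \<omega>) ^ k \<partial>M n) \<le>
       (\<integral>\<omega>. cmod (f n i \<omega>) ^ (2 * k) + cmod (g n i \<omega>) ^ (2 * k) \<partial>M n)"
      using dep_moment[OF dep_mult[OF d]] dep_moment[OF d(1)] dep_moment[OF d(2)] power_mult_le_add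
      by (intro integral_mono) (auto simp: norm_mult)
    also have "\<dots> \<le> C + D" using C[OF i] D[OF i] dep_moment[OF d(1)] dep_moment[OF d(2)] by simp
    finally show ?thesis .
  qed
  then show "\<exists>C. \<forall>n. \<forall>i\<in>I n. (\<integral>\<omega>. cmod (f n i \<omega> * g n i \<omega>) ^ k \<partial>M n) \<le> C" by blast
qed

lemma unif_moments_add:
  assumes "unif_moments I f" "unif_moments I g"
  shows "unif_moments I (\<lambda>n i \<omega>. f n i \<omega> + g n i \<omega>)"
  unfolding unif_moments_def
proof (intro conjI allI ballI)
  fix n i assume "i \<in> I n"
  then show "dep n UNIV (\<lambda>\<omega>. f n i \<omega> + g n i \<omega>)" 
    by (intro dep_add unif_momentsD[OF assms(1)] unif_momentsD[OF assms(2)])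
next
  fix k
  obtain C where C: "\<And>n i. i \<in> I n \<Longrightarrow> (\<integral>\<omega>. cmod (f n i \<omega>) ^ k \<partial>M n) \<le> C"
    using unif_moments_bound[OF assms(1)] by metis
  obtain D where D: "\<And>n i. i \<in> I n \<Longrightarrow> (\<integral>\<omega>. cmod (g n i \<omega>) ^ k \<partial>M n) \<le> D"
    using unif_moments_bound[OF assms(2)] by metis
  have "(\<integral>\<omega>. cmod (f n i \<omega> + g n i \<omega>) ^ k \<partial>M n) \<le> 2 ^ k * (C + D)" if i: "i \<in> I n" for n i
  proof -
    note d = unif_momentsD[OF assms(1) i] unif_momentsD[OF assms(2) i]
    have "cmod (f n i \<omega> + g n i \<omega>) ^ k \<le> 2 ^ k * (cmod (f n i \<omega>) ^ k + cmod (g n i \<omega>) ^ k)" for \<omega>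
      by (rule order_trans[OF power_mono[OF norm_triangle_ineq] power_add_le]) auto
    then have "(\<integral>\<omega>. cmod (f n i \<omega> + g n i \<omega>) ^ k \<partial>M n) \<le>
       (\<integral>\<omega>. 2 ^ k * (cmod (f n i \<omega>) ^ k + cmod (g n i \<omega>) ^ k) \<partial>M n)"
      using dep_moment[OF dep_add[OF d]] dep_moment[OF d(1)] dep_moment[OF d(2)]
      by (intro integral_mono) auto
    also have "\<dots> \<le> 2 ^ k * (C + D)" using C[OF i] D[OF i] dep_moment[OF d(1)] dep_moment[OF d(2)] by simp
    finally show ?thesis .
  qed
  then show "\<exists>C. \<forall>n. \<forall>i\<in>I n. (\<integral>\<omega>. cmod (f n i \<omega> + g n i \<omega>) ^ k \<partial>M n) \<le> C" by blast
qed

lemma unif_moments_diff: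
  assumes "unif_moments I f" "unif_moments I g"
  shows "unif_moments I (\<lambda>n i \<omega>. f n i \<omega> - g n i \<omega>)"
proof -
  have "unif_moments I (\<lambda>n i \<omega>. f n i \<omega> + (- 1) * g n i \<omega>)"
    by (intro unif_moments_add unif_moments_mult assms unif_moments_const[where B = 1]) auto
  then show ?thesis by simp
qed

lemma unif_moments_entry: "unif_moments (\<lambda>n. {(x, y). x < n \<and> y < n}) (\<lambda>n (x, y). a n x y)"
  unfolding unif_moments_def
proof (intro conjI allI ballI)
  fix k
  obtain C where "\<And>n p q. p < n \<Longrightarrow> q < n \<Longrightarrow> (\<integral>\<omega>. cmod (a n p q \<omega>) ^ k \<partial>M n) \<le> C"
    using moment_bound[of k] by metis
  then show "\<exists>C. \<forall>n. \<forall>i\<in>{(x, y). x < n \<and> y < n}.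
      (\<integral>\<omega>. cmod ((case i of (x, y) \<Rightarrow> a n x y) \<omega>) ^ k \<partial>M n) \<le> C" by (intro exI[of _ C]) auto
qed (auto intro: dep_entry)

lemma unif_moments_path_weight:
  "unif_moments (\<lambda>n. walks n m) (\<lambda>n p \<omega>. path_weight (\<lambda>x y. a n x y \<omega>) c p)"
proof (induction m rule: induct_nat_012)
  case 0
  show ?case
    by (rule unif_moments_cong[OF unif_moments_const[where B = 1 and c = "\<lambda>_ _. 1"]]) auto
next
  case 1
  show ?case
  proof (rule unif_moments_cong[OF unif_moments_const[where B = 1 and c = "\<lambda>_ _. 1"]])
    fix n p assume "p \<in> walks n (Suc 0)"
    then obtain x where "p = [x]" by (cases p) (auto simp: tuples_def)
    then show "(\<lambda>\<omega>. 1) = (\<lambda>\<omega>. path_weight (\<lambda>x y. a n x y \<omega>) c p)" by simp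
  qed simp
next
  case (ge2 m)
  have e: "unif_moments (\<lambda>n. walks n (Suc (Suc m))) (\<lambda>n p. a n (p ! 0) (p ! 1))"
  proof -
    have "unif_moments (\<lambda>n. walks n (Suc (Suc m))) (\<lambda>n p. case (p ! 0, p ! 1) of (x, y) \<Rightarrow> a n x y)"
      by (rule unif_moments_reindex[OF unif_moments_entry]) (auto simp: tuples_def length_Suc_conv)
    then show ?thesis by simp
  qed
  have t: "unif_moments (\<lambda>n. walks n (Suc (Suc m))) (\<lambda>n p \<omega>. path_weight (\<lambda>x y. a n x y \<omega>) c (tl p))"
    by (rule unif_moments_reindex[OF ge2(2), where h = "\<lambda>n p. tl p"]) (auto simp: tuples_def length_Suc_conv)
  have tt: "unif_moments (\<lambda>n. walks n (Suc (Suc m))) (\<lambda>n p \<omega>. path_weight (\<lambda>x y. a n x y \<omega>) c (tl (tl p)))"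
    by (rule unif_moments_reindex[OF ge2(1), where h = "\<lambda>n p. tl (tl p)"]) (auto simp: tuples_def length_Suc_conv)
  \<comment> \<open>A correction exists only from three vertices on; the test \<open>m > 0\<close>
    excludes the meaningless \<open>p ! 2\<close> of a two-element list.\<close>
  have i: "unif_moments (\<lambda>n. walks n (Suc (Suc m))) (\<lambda>n p \<omega>. if p ! 0 = p ! 2 \<and> m > 0 then c else 0)"
    by (rule unif_moments_const[where B = "cmod c"]) auto
  show ?case
  proof (rule unif_moments_cong[OF unif_moments_diff[OF unif_moments_mult[OF e t] unif_moments_mult[OF i tt]]])
    fix n p assume "p \<in> walks n (Suc (Suc m))"
    then obtain x y r where "p = x # y # r" "length r = m" by (auto simp: tuples_def length_Suc_conv)
    then show "(\<lambda>\<omega>. a n (p ! 0) (p ! 1) \<omega> * path_weight (\<lambda>x y. a n x y \<omega>) c (tl p) -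
          (if p ! 0 = p ! 2 \<and> 0 < m then c else 0) * path_weight (\<lambda>x y. a n x y \<omega>) c (tl (tl p))) =
        (\<lambda>\<omega>. path_weight (\<lambda>x y. a n x y \<omega>) c p)"
      by (cases r) auto
  qed
qed

lemma unif_moments_cw:
  assumes "m \<ge> 2"
  shows "unif_moments (\<lambda>n. walks n m) cw"
proof -
  let ?c = "complex_of_real (s\<^sup>2)"
  have 1: "unif_moments (\<lambda>n. walks n m) (\<lambda>n p \<omega>. path_weight (\<lambda>x y. a n x y \<omega>) ?c (p @ [hd p]))"
  proof (rule unif_moments_reindex[OF unif_moments_path_weight[of "Suc m"]])
    fix n p assume "p \<in> walks n m"
    then show "p @ [hd p] \<in> walks n (Suc m)" using assms by (cases p) (auto simp: tuples_def)
  qed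
  have 2: "unif_moments (\<lambda>n. walks n m) (\<lambda>n p \<omega>. path_weight (\<lambda>x y. a n x y \<omega>) ?c (tl p))"
  proof (rule unif_moments_reindex[OF unif_moments_path_weight[of "m - 1"]])
    fix n p assume "p \<in> walks n m"
    then show "tl p \<in> walks n (m - 1)" using assms by (cases p) (auto simp: tuples_def)
  qed
  have 3: "unif_moments (\<lambda>n. walks n m) (\<lambda>n p \<omega>. if p ! 1 = last p then ?c else 0)"
    by (rule unif_moments_const[where B = "cmod ?c"]) auto
  show ?thesis
    by (rule unif_moments_cong[OF unif_moments_diff[OF 1 unif_moments_mult[OF 3 2]]])
       (auto simp: cw_def cycle_weight_def fun_eq_iff)
qed

lemma unif_moments_xi_walks:
  assumes "m \<ge> 2"
  shows "unif_moments (\<lambda>n. walks n m) xi"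
proof -
  obtain C where C: "\<And>n p. p \<in> walks n m \<Longrightarrow> (\<integral>\<omega>. cmod (cw n p \<omega>) ^ 1 \<partial>M n) \<le> C"
    using unif_moments_bound[OF unif_moments_cw[OF assms]] by metis
  have "unif_moments (\<lambda>n. walks n m) (\<lambda>n p \<omega>. \<integral>\<omega>. cw n p \<omega> \<partial>M n)"
  proof (rule unif_moments_const)
    fix n p assume "p \<in> walks n m"
    have "cmod (\<integral>\<omega>. cw n p \<omega> \<partial>M n) \<le> (\<integral>\<omega>. cmod (cw n p \<omega>) \<partial>M n)" by simp
    also have "\<dots> \<le> C" using C[OF \<open>p \<in> walks n m\<close>] by simp
    finally show "cmod (\<integral>\<omega>. cw n p \<omega> \<partial>M n) \<le> C" .
  qed
  from unif_moments_diff[OF unif_moments_cw[OF assms] this]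
  show ?thesis unfolding xi_def[abs_def] .
qed

lemma unif_moments_xi:
  assumes "finite J" "J \<subseteq> {2..}"
  shows "unif_moments (\<lambda>n. walk_family n J) xi"
  unfolding unif_moments_def
proof (intro conjI allI ballI)
  fix n p assume "p \<in> walk_family n J"
  then show "dep n UNIV (xi n p)"
    using unif_momentsD[OF unif_moments_xi_walks] assms(2) by (auto simp: walk_family_def)
next
  fix k
  have "\<exists>C. \<forall>n. \<forall>p\<in>walks n m. (\<integral>\<omega>. cmod (xi n p \<omega>) ^ k \<partial>M n) \<le> C" if "m \<in> J" for m
    using unif_moments_xi_walks[of m] that assms(2) by (auto simp: unif_moments_def)
  then obtain C where C: "\<And>m n p. m \<in> J \<Longrightarrow> p \<in> walks n m \<Longrightarrow> (\<integral>\<omega>. cmod (xi n p \<omega>) ^ k \<partial>M n) \<le> C m"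
    by metis
  have "(\<integral>\<omega>. cmod (xi n p \<omega>) ^ k \<partial>M n) \<le> Max (C ` J)" if "p \<in> walk_family n J" for n p
    using that C assms(1) unfolding walk_family_def by (auto intro: order_trans[OF _ Max_ge])
  then show "\<exists>C. \<forall>n. \<forall>p\<in>walk_family n J. (\<integral>\<omega>. cmod (xi n p \<omega>) ^ k \<partial>M n) \<le> C" by blast
qed

lemma unif_moments_prod_list:
  assumes "unif_moments I f"
  shows "unif_moments (\<lambda>n. tuples (I n) r) (\<lambda>n ps \<omega>. \<Prod>p\<leftarrow>ps. f n p \<omega>)"
proof (induction r)
  case 0
  show ?case by (rule unif_moments_cong[OF unif_moments_const[where B = 1 and c = "\<lambda>_ _. 1"]]) auto
next
  case (Suc r)
  have 1: "unif_moments (\<lambda>n. tuples (I n) (Suc r)) (\<lambda>n ps. f n (hd ps))"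
    by (rule unif_moments_reindex[OF assms]) (auto simp: tuples_def length_Suc_conv)
  have 2: "unif_moments (\<lambda>n. tuples (I n) (Suc r)) (\<lambda>n ps \<omega>. \<Prod>p\<leftarrow>tl ps. f n p \<omega>)"
    by (rule unif_moments_reindex[OF Suc, where h = "\<lambda>n. tl"]) (auto simp: tuples_def length_Suc_conv)
  show ?case
    by (rule unif_moments_cong[OF unif_moments_mult[OF 1 2]]) (auto simp: tuples_def length_Suc_conv)
qed

lemma mom_bound:
  assumes "finite J" "J \<subseteq> {2..}"
  obtains C where "C \<ge> 0" "\<And>n ps. ps \<in> tuples (walk_family n J) r \<Longrightarrow> cmod (mom n ps) \<le> C"
proof -
  obtain C where C: "C \<ge> 0" "\<And>n ps. ps \<in> tuples (walk_family n J) r \<Longrightarrow>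
      (\<integral>\<omega>. cmod (\<Prod>p\<leftarrow>ps. xi n p \<omega>) ^ 1 \<partial>M n) \<le> C"
    using unif_moments_bound[OF unif_moments_prod_list[OF unif_moments_xi[OF assms]]] by metis
  show ?thesis
  proof (rule that[OF C(1)])
    fix n ps assume "ps \<in> tuples (walk_family n J) r"
    have "cmod (mom n ps) \<le> (\<integral>\<omega>. cmod (\<Prod>p\<leftarrow>ps. xi n p \<omega>) \<partial>M n)" by (simp add: mom_def)
    also have "\<dots> \<le> C" using C(2)[OF \<open>ps \<in> _\<close>] by simp
    finally show "cmod (mom n ps) \<le> C" .
  qed
qed

lemma walk_family_is_walk: "J \<subseteq> {2..} \<Longrightarrow> p \<in> walk_family n J \<Longrightarrow> is_walk n p"
  by (auto simp: walk_family_def tuples_def is_walk_def)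

section \<open>Linear combinations of centred traces and their powers\<close>

definition wt :: "(nat \<Rightarrow> real) \<Rightarrow> nat \<Rightarrow> nat list \<Rightarrow> complex" where
  "wt t n p = complex_of_real (t (length p) * (1 / sqrt (real n)) ^ length p)"

text \<open>Written as a single sum over walks of all lengths in \<open>J\<close>, so that a power
  becomes a sum over families of mixed lengths; \<open>lin_stat_eq\<close> recovers the combination
  of traces with coefficients \<open>t\<close>.\<close>

definition lin_stat :: "nat set \<Rightarrow> (nat \<Rightarrow> real) \<Rightarrow> nat \<Rightarrow> 'a \<Rightarrow> complex" where
  "lin_stat J t n \<omega> = (\<Sum>p\<in>walk_family n J. wt t n p * xi n p \<omega>)"

lemma lin_stat_power:
  "lin_stat J t n \<omega> ^ r = (\<Sum>ps\<in>tuples (walk_family n J) r. (\<Prod>p\<leftarrow>ps. wt t n p) * (\<Prod>p\<leftarrow>ps. xi n p \<omega>))"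
proof (induction r)
  case (Suc r)
  have "lin_stat J t n \<omega> ^ Suc r = (\<Sum>p\<in>walk_family n J. \<Sum>ps\<in>tuples (walk_family n J) r.
      (wt t n p * xi n p \<omega>) * ((\<Prod>p\<leftarrow>ps. wt t n p) * (\<Prod>p\<leftarrow>ps. xi n p \<omega>)))"
    unfolding power_Suc Suc unfolding lin_stat_def by (rule sum_product)
  then show ?case unfolding sum_tuples_Suc by (simp add: mult_ac)
qed simp

lemma dep_sum:
  assumes "\<And>i. i \<in> I \<Longrightarrow> dep n S (f i)"
  shows "dep n S (\<lambda>\<omega>. \<Sum>i\<in>I. f i \<omega>)"
  using assms by (induction I rule: infinite_finite_induct) (auto intro: dep_const dep_add)

lemma dep_lin_stat:
  assumes "J \<subseteq> {2..}"
  shows "dep n UNIV (lin_stat J t n)"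
  unfolding lin_stat_def
  by (intro dep_sum dep_mult dep_const dep_mono[OF dep_xi]) (use walk_family_is_walk[OF assms] in auto)

lemma integral_lin_stat_power:
  assumes "finite J" "J \<subseteq> {2..}"
  shows "(\<integral>\<omega>. lin_stat J t n \<omega> ^ r \<partial>M n) =
    (\<Sum>ps\<in>tuples (walk_family n J) r. (\<Prod>p\<leftarrow>ps. wt t n p) * mom n ps)"
proof -
  have "integrable (M n) (\<lambda>\<omega>. (\<Prod>p\<leftarrow>ps. wt t n p) * (\<Prod>p\<leftarrow>ps. xi n p \<omega>))"
    if "ps \<in> tuples (walk_family n J) r" for ps
    by (rule dep_integrable[OF dep_mult[OF dep_const dep_mono[OF dep_prod_xi, of _ _ UNIV]]])
       (use that walk_family_is_walk[OF assms(2)] in \<open>auto simp: tuples_def\<close>)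
  then show ?thesis
    unfolding lin_stat_power by (subst Bochner_Integration.integral_sum) (auto simp: mom_def)
qed

lemma norm_prod_wt:
  assumes "\<And>m. m \<in> J \<Longrightarrow> \<bar>t m\<bar> \<le> T" "T \<ge> 0" "set ps \<subseteq> walk_family n J"
  shows "cmod (\<Prod>p\<leftarrow>ps. wt t n p) \<le> T ^ length ps * (1 / sqrt (real n)) ^ length (concat ps)"
  using assms(3)
proof (induction ps)
  case (Cons p ps)
  have "length p \<in> J" using Cons(2) by (auto simp: walk_family_def tuples_def)
  then have "cmod (wt t n p) \<le> T * (1 / sqrt (real n)) ^ length p"
    unfolding wt_def norm_of_real abs_mult using assms(1,2) by (intro mult_mono) auto
  then have "cmod (wt t n p) * cmod (\<Prod>p\<leftarrow>ps. wt t n p) \<le>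
     (T * (1 / sqrt (real n)) ^ length p) * (T ^ length ps * (1 / sqrt (real n)) ^ length (concat ps))"
    using Cons assms(2) by (intro mult_mono) auto
  then show ?case by (simp add: norm_mult power_add mult_ac)
qed simp

text \<open>The analogue of Stein's identity \<open>\<E>[X f(X)] = \<sigma>\<^sup>2 \<E>[f'(X)]\<close> with \<open>f(x) = x^(r + 1)\<close>.\<close>

lemma moment_recursion:
  assumes "finite J" "J \<subseteq> {2..}"
  shows "\<exists>C. \<forall>n>0. cmod ((\<integral>\<omega>. lin_stat J t n \<omega> ^ Suc (Suc r) \<partial>M n) -
     of_nat (Suc r) * (\<integral>\<omega>. lin_stat J t n \<omega> ^ 2 \<partial>M n) * (\<integral>\<omega>. lin_stat J t n \<omega> ^ r \<partial>M n)) \<le> C / sqrt (real n)"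
proof -
  obtain T where T: "T \<ge> 0" "\<And>m. m \<in> J \<Longrightarrow> \<bar>t m\<bar> \<le> T"
    using finite_imageI[OF assms(1), of "\<lambda>m. \<bar>t m\<bar>"] that[of "Max (insert 0 ((\<lambda>m. \<bar>t m\<bar>) ` J))"]
    by (simp add: assms(1))
  obtain C0 where C0: "C0 \<ge> 0"
    "\<And>n ps. ps \<in> tuples (walk_family n J) (Suc (Suc r)) \<Longrightarrow> cmod (mom n ps) \<le> C0"
    using mom_bound[OF assms] by metis
  obtain C1 where C1: "C1 \<ge> 0" "\<And>n ps. ps \<in> tuples (walk_family n J) 2 \<Longrightarrow> cmod (mom n ps) \<le> C1"
    using mom_bound[OF assms] by metis
  obtain C2 where C2: "C2 \<ge> 0" "\<And>n ps. ps \<in> tuples (walk_family n J) r \<Longrightarrow> cmod (mom n ps) \<le> C2"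
    using mom_bound[OF assms] by metis
  obtain C3 where C3: "C3 \<ge> 0" "\<And>n. n > 0 \<Longrightarrow>
      (\<Sum>ps | ps \<in> tuples (walk_family n J) (Suc (Suc r)) \<and> sparse_family ps.
         (1 / sqrt (real n)) ^ length (concat ps)) \<le> C3 / sqrt (real n)"
    using sparse_sum_bound[OF assms(1), of "Suc (Suc r)"] by auto
  \<comment> \<open>Bounds the defect \<open>D\<close> below: one mixed moment minus r + 1 products
    of two mixed moments.\<close>
  define K where "K = C0 + real (Suc r) * (C1 * C2)"
  have K: "K \<ge> 0" using C0 C1 C2 by (simp add: K_def)
  show ?thesis
  proof (intro exI allI impI)
    fix n :: nat assume n: "n > 0"
    let ?W = "walk_family n J" and ?sn = "sqrt (real n)"
    let ?w = "\<lambda>ps. \<Prod>p\<leftarrow>ps. wt t n p"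
    define G where "G p ps = (\<Sum>j<length ps. mom n [p, ps ! j] * mom n (drop_nth j ps))" for p ps
    \<comment> \<open>The defect of the exact recursion, which is zero unless the family is
      sparse.\<close>
    define D where "D ps = mom n ps - G (hd ps) (tl ps)" for ps
    have two: "(\<integral>\<omega>. lin_stat J t n \<omega> ^ 2 \<partial>M n) = (\<Sum>p\<in>?W. \<Sum>q\<in>?W. wt t n p * wt t n q * mom n [p, q])"
      unfolding integral_lin_stat_power[OF assms] numeral_2_eq_2 sum_tuples_Suc by (simp add: mult_ac)
    have G: "(\<Sum>p\<in>?W. \<Sum>ps\<in>tuples ?W (Suc r). wt t n p * ?w ps * G p ps) =
       of_nat (Suc r) * (\<integral>\<omega>. lin_stat J t n \<omega> ^ 2 \<partial>M n) * (\<integral>\<omega>. lin_stat J t n \<omega> ^ r \<partial>M n)"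
    proof -
      \<comment> \<open>Summing over the partner at place \<open>j\<close> separately decouples the
        pair from the remaining r walks, so the result does not depend on \<open>j\<close>.\<close>
      have one: "(\<Sum>ps\<in>tuples ?W (Suc r). wt t n p * ?w ps * (mom n [p, ps ! j] * mom n (drop_nth j ps))) =
          (\<Sum>q\<in>?W. wt t n p * wt t n q * mom n [p, q]) * (\<Sum>ps\<in>tuples ?W r. ?w ps * mom n ps)"
        if j: "j \<le> r" for p j
      proof -
        have "(\<Sum>ps\<in>tuples ?W (Suc r). wt t n p * ?w ps * (mom n [p, ps ! j] * mom n (drop_nth j ps))) =
          (\<Sum>ps\<in>tuples ?W r. \<Sum>q\<in>?W. (wt t n p * wt t n q * mom n [p, q]) * (?w ps * mom n ps))"
          unfolding sum_tuples_insert[OF j]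
        proof (intro sum.cong refl)
          fix ps q assume "ps \<in> tuples ?W r"
          then have len: "length ps = r" by (simp add: tuples_def)
          have "?w (take j ps @ q # drop j ps) = wt t n q * ?w (take j ps @ drop j ps)"
            by (simp only: map_append prod_list.append list.map prod_list.Cons mult_ac)
          then have "?w (take j ps @ q # drop j ps) = wt t n q * ?w ps"
            by (simp only: append_take_drop_id)
          moreover have "drop_nth j (take j ps @ q # drop j ps) = ps"
            using j len by (simp add: drop_nth_def min_def)
          moreover have "(take j ps @ q # drop j ps) ! j = q" using j len by (simp add: nth_append min_def)
          ultimately show "wt t n p * ?w (take j ps @ q # drop j ps) *
             (mom n [p, (take j ps @ q # drop j ps) ! j] * mom n (drop_nth j (take j ps @ q # drop j ps))) =
             (wt t n p * wt t n q * mom n [p, q]) * (?w ps * mom n ps)"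
            by (simp only: mult_ac)
        qed
        also have "\<dots> = (\<Sum>q\<in>?W. \<Sum>ps\<in>tuples ?W r. (wt t n p * wt t n q * mom n [p, q]) * (?w ps * mom n ps))"
          by (rule sum.swap)
        finally show ?thesis unfolding sum_product .
      qed
      have "(\<Sum>p\<in>?W. \<Sum>ps\<in>tuples ?W (Suc r). wt t n p * ?w ps * G p ps) =
        (\<Sum>p\<in>?W. \<Sum>ps\<in>tuples ?W (Suc r). \<Sum>j<Suc r. wt t n p * ?w ps * (mom n [p, ps ! j] * mom n (drop_nth j ps)))"
        unfolding G_def sum_distrib_left by (intro sum.cong refl) (auto simp: tuples_def)
      also have "\<dots> = (\<Sum>p\<in>?W. \<Sum>j<Suc r.
          (\<Sum>q\<in>?W. wt t n p * wt t n q * mom n [p, q]) * (\<Sum>ps\<in>tuples ?W r. ?w ps * mom n ps))"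
        by (intro sum.cong refl, subst sum.swap, intro sum.cong refl one) auto
      also have "\<dots> = of_nat (Suc r) * (\<Sum>p\<in>?W. \<Sum>q\<in>?W. wt t n p * wt t n q * mom n [p, q]) *
          (\<Sum>ps\<in>tuples ?W r. ?w ps * mom n ps)"
        by (simp add: sum_distrib_left sum_distrib_right mult_ac del: sum.lessThan_Suc)
      finally show ?thesis by (simp only: two integral_lin_stat_power[OF assms, of n t r])
    qed
    have "(\<integral>\<omega>. lin_stat J t n \<omega> ^ Suc (Suc r) \<partial>M n) -
       of_nat (Suc r) * (\<integral>\<omega>. lin_stat J t n \<omega> ^ 2 \<partial>M n) * (\<integral>\<omega>. lin_stat J t n \<omega> ^ r \<partial>M n)
      = (\<Sum>ps\<in>tuples ?W (Suc (Suc r)). ?w ps * D ps)"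
      unfolding G[symmetric] integral_lin_stat_power[OF assms, of n t "Suc (Suc r)"] D_def sum_tuples_Suc[of _ _ "Suc r"]
      by (simp add: sum_subtractf algebra_simps)
    also have "\<dots> = (\<Sum>ps | ps \<in> tuples ?W (Suc (Suc r)) \<and> sparse_family ps. ?w ps * D ps)"
    proof (rule sum.mono_neutral_right)
      show "\<forall>ps\<in>tuples ?W (Suc (Suc r)) - {ps. ps \<in> tuples ?W (Suc (Suc r)) \<and> sparse_family ps}. ?w ps * D ps = 0"
      proof
        fix ps assume ps: "ps \<in> tuples ?W (Suc (Suc r)) - {ps. ps \<in> tuples ?W (Suc (Suc r)) \<and> sparse_family ps}"
        then obtain p qs where pq: "ps = p # qs" by (auto simp: tuples_def length_Suc_conv)
        have "mom n (p # qs) = G p qs" unfolding G_def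
          by (rule mom_recursion) (use ps walk_family_is_walk[OF assms(2)] in \<open>auto simp: pq tuples_def sparse_family_def\<close>)
        then show "?w ps * D ps = 0" by (simp add: D_def pq)
      qed
    qed (use assms in auto)
    also have "cmod \<dots> \<le> (\<Sum>ps | ps \<in> tuples ?W (Suc (Suc r)) \<and> sparse_family ps.
        (T ^ Suc (Suc r) * K) * (1 / ?sn) ^ length (concat ps))"
    proof (rule sum_norm_le)
      fix ps assume "ps \<in> {ps. ps \<in> tuples ?W (Suc (Suc r)) \<and> sparse_family ps}"
      then have ps: "ps \<in> tuples ?W (Suc (Suc r))" by simp
      then obtain p qs where pq: "ps = p # qs" "length qs = Suc r" "p \<in> ?W" "set qs \<subseteq> ?W"
        by (auto simp: tuples_def length_Suc_conv)
      have "cmod (G p qs) \<le> (\<Sum>j<length qs. C1 * C2)"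
        unfolding G_def
      proof (rule sum_norm_le)
        fix j assume j: "j \<in> {..<length qs}"
        have "[p, qs ! j] \<in> tuples ?W 2" using pq j by (auto simp: tuples_def subset_iff)
        moreover have "drop_nth j qs \<in> tuples ?W r"
          using pq j set_drop_nth[of j qs] by (auto simp: tuples_def drop_nth_def)
        ultimately show "cmod (mom n [p, qs ! j] * mom n (drop_nth j qs)) \<le> C1 * C2"
          unfolding norm_mult using C1 C2 by (intro mult_mono) auto
      qed
      then have "cmod (D ps) \<le> K"
        using C0(2)[OF ps] norm_triangle_ineq4[of "mom n ps" "G p qs"] pq by (simp add: D_def K_def)
      moreover have "cmod (?w ps) \<le> T ^ Suc (Suc r) * (1 / ?sn) ^ length (concat ps)"
        using norm_prod_wt[OF T(2,1), where ps = ps and n = n] ps by (simp add: tuples_def)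
      ultimately have "cmod (?w ps) * cmod (D ps) \<le> (T ^ Suc (Suc r) * (1 / ?sn) ^ length (concat ps)) * K"
        using T by (intro mult_mono) auto
      then show "cmod (?w ps * D ps) \<le> (T ^ Suc (Suc r) * K) * (1 / ?sn) ^ length (concat ps)"
        by (simp add: norm_mult mult_ac)
    qed
    also have "\<dots> \<le> (T ^ Suc (Suc r) * K) * (C3 / ?sn)"
      unfolding sum_distrib_left[symmetric] using C3(2)[OF n] T K by (intro mult_left_mono) auto
    finally show "cmod ((\<integral>\<omega>. lin_stat J t n \<omega> ^ Suc (Suc r) \<partial>M n) -
       of_nat (Suc r) * (\<integral>\<omega>. lin_stat J t n \<omega> ^ 2 \<partial>M n) * (\<integral>\<omega>. lin_stat J t n \<omega> ^ r \<partial>M n)) \<le>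
       (T ^ Suc (Suc r) * K * C3) / ?sn" by simp
  qed
qed

end

section \<open>Eulerian numbers and cyclic ascents\<close>

text \<open>What \<open>path_weight\<close> becomes on a path without repeated vertices, where no
  pair can backtrack.\<close>

fun chain :: "(nat \<Rightarrow> nat \<Rightarrow> complex) \<Rightarrow> nat list \<Rightarrow> complex" where
  "chain w (x # y # r) = w x y * chain w (y # r)"
| "chain w _ = 1"

fun ascents :: "nat list \<Rightarrow> nat" where
  "ascents (x # y # r) = (if x < y then 1 else 0) + ascents (y # r)"
| "ascents _ = 0"

text \<open>This triangle recurrence is the link between the alternating sum and permutations:
  inserting the maximum obeys the same rule.\<close>

lemma eulerian_Suc:
  assumes "m \<ge> 1" "k \<ge> 1"
  shows "eulerian (Suc m) k = int k * eulerian m k + (int m + 2 - int k) * eulerian m (k - 1)"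
proof -
  let ?b = "\<lambda>j. (- 1) ^ j * (int k - int j) ^ m :: int"
  have "eulerian (Suc m) k = (\<Sum>j=0..k. ?b j * ((int k - int j) * int ((Suc (Suc m)) choose j)))"
    by (simp add: eulerian_def mult_ac)
  also have "\<dots> = (\<Sum>j=0..k. ?b j * (int k * int (Suc m choose j))) -
      (\<Sum>j=1..k. ?b j * ((int m + 2 - int k) * int (Suc m choose (j - 1))))"
  proof -
    \<comment> \<open>Pascal's rule for \<open>Suc (Suc m) choose j\<close>, with j C(m + 1, j) = (m
      + 2 - j) C(m + 1, j - 1), absorbs the additional factor k - j.\<close>
    have id: "(int k - int j) * int ((Suc (Suc m)) choose j) =
        int k * int (Suc m choose j) - (int m + 2 - int k) * int (Suc m choose (j - 1))"
      if j: "j \<ge> 1" for j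
    proof -
      obtain i where i: "j = Suc i" using j by (metis One_nat_def Suc_le_D)
      have "Suc i * (Suc m choose Suc i) + i * (Suc m choose i) = Suc m * (Suc m choose i)"
      proof -
        have "Suc i * (Suc m choose Suc i) = (Suc m - i) * (Suc m choose i)"
          by (simp only: binomial_absorption binomial_absorb_comp)
        then show ?thesis
          by (cases "i \<le> Suc m") (simp_all only: add_mult_distrib[symmetric] le_add_diff_inverse2, simp add: binomial_eq_0)
      qed
      then have "int (Suc i) * int (Suc m choose Suc i) + int i * int (Suc m choose i) = int (Suc m) * int (Suc m choose i)"
        by (metis of_nat_add of_nat_mult)
      then show ?thesis unfolding i by (simp add: algebra_simps)
    qed
    have "(\<Sum>j=0..k. ?b j * ((int k - int j) * int ((Suc (Suc m)) choose j))) =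
       ?b 0 * int k + (\<Sum>j=1..k. ?b j * ((int k - int j) * int ((Suc (Suc m)) choose j)))"
      by (simp add: sum.atLeast_Suc_atMost)
    also have "(\<Sum>j=1..k. ?b j * ((int k - int j) * int ((Suc (Suc m)) choose j))) =
       (\<Sum>j=1..k. ?b j * (int k * int (Suc m choose j))) -
       (\<Sum>j=1..k. ?b j * ((int m + 2 - int k) * int (Suc m choose (j - 1))))"
      unfolding sum_subtractf[symmetric]
    proof (intro sum.cong refl)
      fix j assume "j \<in> {1..k}"
      then show "?b j * ((int k - int j) * int ((Suc (Suc m)) choose j)) =
         ?b j * (int k * int (Suc m choose j)) - ?b j * ((int m + 2 - int k) * int (Suc m choose (j - 1)))"
        unfolding right_diff_distrib[symmetric] using id[of j] by simp
    qed
    finally show ?thesis by (simp add: sum.atLeast_Suc_atMost)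
  qed
  also have "(\<Sum>j=1..k. ?b j * ((int m + 2 - int k) * int (Suc m choose (j - 1)))) =
      (\<Sum>j=0..k - 1. ?b (Suc j) * ((int m + 2 - int k) * int (Suc m choose j)))"
    using assms by (intro sum.reindex_bij_witness[of _ Suc "\<lambda>j. j - 1"]) auto
  \<comment> \<open>Raising j by one flips the sign and replaces k - j by (k - 1) - j.\<close>
  also have "\<dots> = - ((int m + 2 - int k) * eulerian m (k - 1))"
    using assms unfolding eulerian_def sum_distrib_left sum_negf[symmetric]
    by (intro sum.cong refl) (auto simp: of_nat_diff algebra_simps)
  finally show ?thesis by (simp add: eulerian_def sum_distrib_left mult_ac)
qed

lemma eulerian_0: "m \<ge> 1 \<Longrightarrow> eulerian m 0 = 0"
  by (simp add: eulerian_def power_0_left)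

lemma eulerian_1: "eulerian (Suc 0) k = (if k = 1 then 1 else 0)"
proof -
  consider "k = 0" | "k = 1" | i where "k = Suc (Suc i)" by (metis One_nat_def not0_implies_Suc)
  then show ?thesis
  proof cases
    case 3
    have "eulerian (Suc 0) k = (\<Sum>j\<in>{0,1,2}. (- 1) ^ j * (int k - int j) ^ Suc 0 * int (2 choose j))"
      unfolding eulerian_def
    proof (rule sum.mono_neutral_cong_right)
      show "\<forall>j\<in>{0..k} - {0, 1, 2}. (- 1) ^ j * (int k - int j) ^ Suc 0 * int ((Suc 0 + 1) choose j) = 0"
      proof
        fix j assume "j \<in> {0..k} - {0, 1, 2}"
        then have "j > 2" by auto
        then show "(- 1) ^ j * (int k - int j) ^ Suc 0 * int ((Suc 0 + 1) choose j) = 0"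
          by (simp add: binomial_eq_0)
      qed
    qed (use 3 in \<open>auto simp: numeral_2_eq_2\<close>)
    moreover have "(2 choose 1) = (2::nat)" "(2 choose 2) = (1::nat)" by (simp_all add: numeral_2_eq_2)
    ultimately show ?thesis using 3 by simp
  qed (simp_all add: eulerian_def)
qed

lemma eulerian_gt: "m \<ge> 1 \<Longrightarrow> k > m \<Longrightarrow> eulerian m k = 0"
proof (induction m arbitrary: k rule: nat_induct_at_least)
  case base
  then show ?case by (simp add: eulerian_1)
next
  case (Suc m)
  have "eulerian m k = 0" using Suc by simp
  moreover have "k = m + 2 \<or> eulerian m (k - 1) = 0" using Suc by (cases "k = m + 2") auto
  ultimately show ?case using Suc eulerian_Suc[of m k] by auto
qed

lemma eulerian_symmetric: "m \<ge> 1 \<Longrightarrow> k \<le> Suc m \<Longrightarrow> eulerian m (Suc m - k) = eulerian m k"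
proof (induction m arbitrary: k rule: nat_induct_at_least)
  case base
  then show ?case by (auto simp: eulerian_1)
next
  case (Suc m)
  show ?case
  proof (cases "k = 0 \<or> k = Suc (Suc m)")
    case True
    then show ?thesis using eulerian_0[of "Suc m"] eulerian_gt[of "Suc m" "Suc (Suc m)"] by auto
  next
    case False
    then have k: "1 \<le> k" "k \<le> Suc m" using Suc(3) by auto
    have "Suc m - (k - 1) = Suc (Suc m) - k" using k by simp
    then have 1: "eulerian m (Suc (Suc m) - k) = eulerian m (k - 1)" using Suc(2)[of "k - 1"] k by simp
    have 2: "eulerian m (Suc (Suc m) - k - 1) = eulerian m k" using Suc(2)[of k] k by simp
    have "eulerian (Suc m) (Suc (Suc m) - k) =
        int (Suc (Suc m) - k) * eulerian m (k - 1) + (int m + 2 - int (Suc (Suc m) - k)) * eulerian m k"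
      using eulerian_Suc[of m "Suc (Suc m) - k"] 1 2 Suc(1) k by simp
    also have "\<dots> = eulerian (Suc m) k" using eulerian_Suc[of m k] Suc(1) k by (simp add: of_nat_diff)
    finally show ?thesis .
  qed
qed

text \<open>Inserting the largest value in front or inside an ascent keeps the number of ascents; at
  the end or between two entries that do not ascend it adds one.\<close>

lemma sum_ascents_insert:
  fixes g :: "nat \<Rightarrow> complex"
  assumes "q \<noteq> []" "\<And>v. v \<in> set q \<Longrightarrow> v < M"
  shows "(\<Sum>i\<le>length q. g (ascents (take i q @ M # drop i q))) =
    of_nat (Suc (ascents q)) * g (ascents q) + (of_nat (length q) - of_nat (ascents q)) * g (Suc (ascents q))"
  using assms
proof (induction q arbitrary: g rule: ascents.induct)
  case (1 x y r)
  define b :: nat where "b = (if x < y then 1 else 0)"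
  let ?q = "y # r"
  have less: "x < M" "y < M" using 1(3) by auto
  have "(\<Sum>i\<le>length (x # ?q). g (ascents (take i (x # ?q) @ M # drop i (x # ?q)))) =
      g (ascents (M # x # ?q)) + (\<Sum>i\<le>length ?q. g (ascents (x # take i ?q @ M # drop i ?q)))"
    by (simp only: length_Cons sum.atMost_Suc_shift) simp
  also have "ascents (M # x # ?q) = b + ascents ?q" using less by (simp add: b_def)
  also have "(\<Sum>i\<le>length ?q. g (ascents (x # take i ?q @ M # drop i ?q))) =
      g (Suc (ascents ?q)) + (\<Sum>i\<le>length r. g (b + ascents (take (Suc i) ?q @ M # drop (Suc i) ?q)))"
    using less by (simp only: length_Cons sum.atMost_Suc_shift) (simp add: b_def)
  also have "(\<Sum>i\<le>length r. g (b + ascents (take (Suc i) ?q @ M # drop (Suc i) ?q))) =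
      (\<Sum>i\<le>length ?q. g (b + ascents (take i ?q @ M # drop i ?q))) - g (b + ascents ?q)"
    using less by (simp only: length_Cons sum.atMost_Suc_shift) simp
  also have "(\<Sum>i\<le>length ?q. g (b + ascents (take i ?q @ M # drop i ?q))) =
     of_nat (Suc (ascents ?q)) * g (b + ascents ?q) +
     (of_nat (length ?q) - of_nat (ascents ?q)) * g (b + Suc (ascents ?q))"
    by (rule 1(1)) (use 1(3) in auto)
  finally show ?case by (cases "x < y") (simp_all add: b_def algebra_simps)
next
  case ("2_2" v)
  then show ?case by simp
qed simp

lemma sum_permutations_insert:
  assumes "finite K" "M \<notin> K"
  shows "(\<Sum>p\<in>permutations_of_set (insert M K). f p) =
     (\<Sum>q\<in>permutations_of_set K. \<Sum>i\<le>card K. f (take i q @ M # drop i q))"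
proof -
  have "(\<Sum>p\<in>permutations_of_set (insert M K). f p) =
     (\<Sum>(q, i)\<in>permutations_of_set K \<times> {..card K}. f (take i q @ M # drop i q))"
  proof (rule sum.reindex_bij_witness[where i = "\<lambda>(q, i). take i q @ M # drop i q"
        and j = "\<lambda>p. (takeWhile (\<lambda>v. v \<noteq> M) p @ tl (dropWhile (\<lambda>v. v \<noteq> M) p), length (takeWhile (\<lambda>v. v \<noteq> M) p))"])
    fix p assume "p \<in> permutations_of_set (insert M K)"
    then have p: "set p = insert M K" "distinct p" by (auto simp: permutations_of_set_def)
    then obtain us vs where uv: "p = us @ M # vs" "M \<notin> set us" by (metis insertI1 split_list_first)
    then have t: "takeWhile (\<lambda>v. v \<noteq> M) p = us" "dropWhile (\<lambda>v. v \<noteq> M) p = M # vs"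
      by (subst uv(1), subst takeWhile_append2; use uv(2) in auto)
         (subst uv(1), subst dropWhile_append2; use uv(2) in auto)
    have "set (us @ vs) = K" "distinct (us @ vs)" using p uv assms(2) by auto
    moreover from this have "length (us @ vs) = card K" by (metis distinct_card)
    ultimately show "(takeWhile (\<lambda>v. v \<noteq> M) p @ tl (dropWhile (\<lambda>v. v \<noteq> M) p), length (takeWhile (\<lambda>v. v \<noteq> M) p))
        \<in> permutations_of_set K \<times> {..card K}"
      by (auto simp: t permutations_of_set_def)
    show "(case (takeWhile (\<lambda>v. v \<noteq> M) p @ tl (dropWhile (\<lambda>v. v \<noteq> M) p), length (takeWhile (\<lambda>v. v \<noteq> M) p))
        of (q, i) \<Rightarrow> take i q @ M # drop i q) = p"
      unfolding t using uv(1) by simp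
    then show "(case (takeWhile (\<lambda>v. v \<noteq> M) p @ tl (dropWhile (\<lambda>v. v \<noteq> M) p), length (takeWhile (\<lambda>v. v \<noteq> M) p))
        of (q, i) \<Rightarrow> f (take i q @ M # drop i q)) = f p" by simp
  next
    fix z assume "z \<in> permutations_of_set K \<times> {..card K}"
    then obtain q i where z: "z = (q, i)" "set q = K" "distinct q" "i \<le> card K"
      by (auto simp: permutations_of_set_def)
    have len: "length q = card K" using z by (metis distinct_card)
    have s: "set (take i q @ drop i q) = K" "distinct (take i q @ drop i q)" using z by simp_all
    have "M \<notin> set (take i q)" using assms(2) z(2) set_take_subset[of i q] by auto
    then show "(takeWhile (\<lambda>v. v \<noteq> M) (case z of (q, i) \<Rightarrow> take i q @ M # drop i q) @
            tl (dropWhile (\<lambda>v. v \<noteq> M) (case z of (q, i) \<Rightarrow> take i q @ M # drop i q)),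
           length (takeWhile (\<lambda>v. v \<noteq> M) (case z of (q, i) \<Rightarrow> take i q @ M # drop i q))) = z"
      using len z by (auto simp: takeWhile_append dropWhile_append)
    show "(case z of (q, i) \<Rightarrow> take i q @ M # drop i q) \<in> permutations_of_set (insert M K)"
    proof -
      have "set (take i q) \<union> set (drop i q) = K" "set (take i q) \<inter> set (drop i q) = {}"
        using z(2,3) by (metis append_take_drop_id set_append, metis append_take_drop_id distinct_append)
      then show ?thesis using assms(2) z by (auto simp: permutations_of_set_def)
    qed
  qed
  then show ?thesis by (simp add: sum.cartesian_product)
qed

text \<open>The test function \<open>g\<close> is arbitrary so that inserting the maximum leads to
  the same statement for another function \<open>g'\<close>. In this normalisation the index k
  belongs to permutations with k - 1 ascents.\<close>

lemma sum_ascents_eulerian: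
  fixes g :: "nat \<Rightarrow> complex"
  assumes "finite K" "card K = k" "k \<ge> 1"
  shows "(\<Sum>q\<in>permutations_of_set K. g (Suc (ascents q))) = (\<Sum>j=1..k. of_int (eulerian k j) * g j)"
  using assms(3,1,2)
proof (induction k arbitrary: K g rule: nat_induct_at_least)
  case base
  then obtain x where "K = {x}" by (metis One_nat_def card_1_singletonE)
  then show ?case using eulerian_1[of 1] by simp
next
  case (Suc k)
  define M where "M = Max K"
  define K' where "K' = K - {M}"
  have "K \<noteq> {}" using Suc by auto
  then have "M \<in> K" unfolding M_def using Suc(3) by (intro Max_in)
  then have M: "M \<in> K" "finite K'" "card K' = k" "K = insert M K'" "M \<notin> K'"
    using Suc(3,4) by (auto simp: K'_def)
  have less: "v < M" if "v \<in> K'" for v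
    using that Suc(3) by (auto simp: K'_def M_def le_neq_implies_less)
  define g' where "g' j = of_nat j * g j + (of_nat (Suc k) - of_nat j) * g (Suc j)" for j
  have "(\<Sum>p\<in>permutations_of_set K. g (Suc (ascents p))) =
     (\<Sum>q\<in>permutations_of_set K'. \<Sum>i\<le>k. g (Suc (ascents (take i q @ M # drop i q))))"
    unfolding M(4) sum_permutations_insert[OF M(2,5)] M(3) ..
  also have "\<dots> = (\<Sum>q\<in>permutations_of_set K'. g' (Suc (ascents q)))"
  proof (rule sum.cong[OF refl])
    fix q assume "q \<in> permutations_of_set K'"
    then have q: "set q = K'" "distinct q" by (auto simp: permutations_of_set_def)
    then have len: "length q = k" using M(3) by (metis distinct_card)
    then have "q \<noteq> []" using Suc(1) by auto
    from sum_ascents_insert[OF this, of M "\<lambda>j. g (Suc j)"]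
    show "(\<Sum>i\<le>k. g (Suc (ascents (take i q @ M # drop i q)))) = g' (Suc (ascents q))"
      using less q len by (simp add: g'_def algebra_simps)
  qed
  also have "\<dots> = (\<Sum>j=1..k. of_int (eulerian k j) * g' j)" by (rule Suc(2)) (use M in auto)
  also have "\<dots> = (\<Sum>j=1..k. of_int (eulerian k j) * of_nat j * g j) +
      (\<Sum>j=1..k. of_int (eulerian k j) * (of_nat (Suc k) - of_nat j) * g (Suc j))"
    by (simp add: g'_def algebra_simps flip: sum.distrib)
  also have "(\<Sum>j=1..k. of_int (eulerian k j) * of_nat j * g j) = (\<Sum>j=1..Suc k. of_int (eulerian k j) * of_nat j * g j)"
    using eulerian_gt[of k "Suc k"] Suc(1) by simp
  also have "(\<Sum>j=1..k. of_int (eulerian k j) * (of_nat (Suc k) - of_nat j) * g (Suc j)) =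
      (\<Sum>j=0..k. of_int (eulerian k j) * (of_nat (Suc k) - of_nat j) * g (Suc j))"
    using eulerian_0[of k] Suc(1) by (simp add: sum.atLeast_Suc_atMost[of 0])
  also have "\<dots> = (\<Sum>j=1..Suc k. of_int (eulerian k (j - 1)) * (of_nat (Suc k) - of_nat (j - 1)) * g j)"
    by (rule sum.reindex_bij_witness[of _ "\<lambda>j. j - 1" Suc]) auto
  also have "(\<Sum>j=1..Suc k. of_int (eulerian k j) * of_nat j * g j) +
     (\<Sum>j=1..Suc k. of_int (eulerian k (j - 1)) * (of_nat (Suc k) - of_nat (j - 1)) * g j) =
     (\<Sum>j=1..Suc k. of_int (eulerian (Suc k) j) * g j)"
    unfolding sum.distrib[symmetric]
  proof (intro sum.cong refl)
    fix j assume j: "j \<in> {1..Suc k}"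
    have e: "(of_int (eulerian (Suc k) j) :: complex) =
        of_nat j * of_int (eulerian k j) + (of_nat k + 2 - of_nat j) * of_int (eulerian k (j - 1))"
      using eulerian_Suc[of k j] j Suc(1) by simp
    then show "of_int (eulerian k j) * of_nat j * g j +
       of_int (eulerian k (j - 1)) * (of_nat (Suc k) - of_nat (j - 1)) * g j = of_int (eulerian (Suc k) j) * g j"
      unfolding e using j by (simp add: of_nat_diff algebra_simps)
  qed
  finally show ?case .
qed

section \<open>Cyclic ascents\<close>

lemma chain_append: "chain w (xs @ y # ys) = chain w (xs @ [y]) * chain w (y # ys)"
  by (induction w xs rule: chain.induct) auto

lemma ascents_less: "q \<noteq> [] \<Longrightarrow> ascents q < length q"
  by (induction q rule: ascents.induct) auto

lemma chain_two_values:
  "q \<noteq> [] \<Longrightarrow> chain (\<lambda>u v. if u < v then x else y) q = x ^ ascents q * y ^ (length q - 1 - ascents q)"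
proof (induction q rule: ascents.induct)
  case (1 u v r)
  have "ascents (v # r) < length (v # r)" by (rule ascents_less) simp
  then have "Suc (length r) - ascents (v # r) = Suc (length r - ascents (v # r))" by simp
  then show ?case using 1 by (auto simp: mult_ac)
qed auto

text \<open>The maximum may stand at m places of the cycle. The step into it is an ascent and the
  step out of it a descent, so there is one more cyclic ascent than in the linear arrangement of the
  other m - 1 vertices; this shift matches the index of the Eulerian numbers of order m - 1.\<close>

lemma sum_permutations_cycle:
  fixes x y :: complex
  assumes "finite K" "card K = m" "m \<ge> 2"
  defines "w \<equiv> \<lambda>u v. if u < v then x else y"
  shows "(\<Sum>p\<in>permutations_of_set K. chain w (p @ [hd p])) =
     of_nat m * (\<Sum>j=1..m - 1. of_int (eulerian (m - 1) j) * (x ^ j * y ^ (m - j)))"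
proof -
  define M where "M = Max K"
  define K' where "K' = K - {M}"
  have "K \<noteq> {}" using assms by auto
  then have "M \<in> K" unfolding M_def using assms(1) by (intro Max_in)
  then have M: "M \<in> K" "finite K'" "card K' = m - 1" "K = insert M K'" "M \<notin> K'"
    using assms(1,2) by (auto simp: K'_def)
  have less: "v < M" if "v \<in> K'" for v
    using that assms(1) by (auto simp: K'_def M_def le_neq_implies_less)
  define h where "h q = chain w (M # q @ [M])" for q
  have "(\<Sum>p\<in>permutations_of_set K. chain w (p @ [hd p])) =
     (\<Sum>q\<in>permutations_of_set K'. \<Sum>i\<le>m - 1. h (rotate i q))"
    unfolding M(4) sum_permutations_insert[OF M(2,5)] M(3)
  proof (intro sum.cong refl)
    fix q i assume "q \<in> permutations_of_set K'" "i \<in> {..m - 1}"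
    then have "length q = m - 1" using M(3) by (auto simp: permutations_of_set_def distinct_card)
    then have rot: "rotate i q = drop i q @ take i q" using rotate_drop_take[of i q] \<open>i \<in> _\<close> by (cases "i = m - 1") auto
    show "chain w ((take i q @ M # drop i q) @ [hd (take i q @ M # drop i q)]) = h (rotate i q)"
    proof (cases "take i q")
      case Nil
      show ?thesis unfolding h_def rot Nil by simp
    next
      case (Cons z zs)
      have "chain w ((z # zs) @ M # drop i q @ [z]) = chain w ((z # zs) @ [M]) * chain w ((M # drop i q) @ [z])"
        using chain_append[of w "z # zs" M "drop i q @ [z]"] by simp
      moreover have "chain w ((M # drop i q) @ z # zs @ [M]) =
          chain w ((M # drop i q) @ [z]) * chain w (z # zs @ [M])"
        by (rule chain_append)
      ultimately show ?thesis unfolding h_def rot Cons by (simp add: mult.commute)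
    qed
  qed
  also have "\<dots> = (\<Sum>i\<le>m - 1. \<Sum>q\<in>permutations_of_set K'. h (rotate i q))" by (rule sum.swap)
  \<comment> \<open>Rotations permute the arrangements of \<open>K'\<close>, so every position of
    the maximum contributes equally.\<close>
  also have "\<dots> = (\<Sum>i\<le>m - 1. \<Sum>q\<in>permutations_of_set K'. h q)"
  proof (rule sum.cong[OF refl])
    fix i
    have "inj (rotate i :: nat list \<Rightarrow> nat list)" unfolding rotate_def by (rule inj_fn[OF inj_rotate1])
    then have inj: "inj_on (rotate i) (permutations_of_set K')" by (rule inj_on_subset) simp
    have "rotate i ` permutations_of_set K' \<subseteq> permutations_of_set K'"
      by (auto simp: permutations_of_set_def)
    then have "rotate i ` permutations_of_set K' = permutations_of_set K'"
      by (intro card_subset_eq) (auto simp: card_image[OF inj])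
    then show "(\<Sum>q\<in>permutations_of_set K'. h (rotate i q)) = (\<Sum>q\<in>permutations_of_set K'. h q)"
      using sum.reindex[OF inj, of h] by (simp add: comp_def)
  qed
  also have "\<dots> = of_nat m * (\<Sum>q\<in>permutations_of_set K'. h q)"
    using assms(3) by (simp add: of_nat_diff)
  also have "(\<Sum>q\<in>permutations_of_set K'. h q) =
     (\<Sum>q\<in>permutations_of_set K'. x ^ Suc (ascents q) * y ^ (m - Suc (ascents q)))"
  proof (intro sum.cong refl)
    fix q assume "q \<in> permutations_of_set K'"
    then have q: "set q = K'" "length q = m - 1" using M(3) by (auto simp: permutations_of_set_def distinct_card)
    then obtain z zs where z: "q = z # zs" using assms(3) by (cases q) auto
    obtain us u where u: "q = us @ [u]" using z by (metis rev_exhaust list.discI)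
    have "u \<in> set q" "z \<in> set q" by (simp add: u, simp add: z)
    then have "u < M" "z < M" using less q by auto
    have "chain w (q @ [M]) = chain w q * w u M" using chain_append[of w us u "[M]"] u by simp
    moreover have "h q = w M z * chain w (q @ [M])" unfolding h_def z by simp
    ultimately have "h q = w M z * (chain w q * w u M)" by simp
    also have "\<dots> = x ^ Suc (ascents q) * y ^ Suc (length q - 1 - ascents q)"
      using chain_two_values[of q x y] z \<open>u < M\<close> \<open>z < M\<close> by (simp add: w_def)
    also have "Suc (length q - 1 - ascents q) = m - Suc (ascents q)"
      using ascents_less[of q] z q by simp
    finally show "h q = x ^ Suc (ascents q) * y ^ (m - Suc (ascents q))" .
  qed
  also have "\<dots> = (\<Sum>j=1..m - 1. of_int (eulerian (m - 1) j) * (x ^ j * y ^ (m - j)))"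
    using sum_ascents_eulerian[OF M(2,3), of "\<lambda>j. x ^ j * y ^ (m - j)"] assms(3) by simp
  finally show ?thesis .
qed

lemma sum_distinct_walks:
  "(\<Sum>p | p \<in> walks n m \<and> distinct p. f p) =
     (\<Sum>K | K \<subseteq> {..<n} \<and> card K = m. \<Sum>p\<in>permutations_of_set K. f p)"
proof -
  have eq: "{p. p \<in> walks n m \<and> distinct p} = (\<Union>K\<in>{K. K \<subseteq> {..<n} \<and> card K = m}. permutations_of_set K)"
    by (auto simp: tuples_def permutations_of_set_def distinct_card)
  show ?thesis unfolding eq
    by (rule sum.UNION_disjoint) (auto dest: permutations_of_setD)
qed

lemma sum_distinct_cycles:
  fixes x y :: complex
  assumes "m \<ge> 2"
  shows "(\<Sum>p | p \<in> walks n m \<and> distinct p. chain (\<lambda>u v. if u < v then x else y) (p @ [hd p])) =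
     of_nat (n choose m) * (of_nat m * (\<Sum>j=1..m - 1. of_int (eulerian (m - 1) j) * (x ^ j * y ^ (m - j))))"
proof -
  let ?f = "\<lambda>p. chain (\<lambda>u v. if u < v then x else y) (p @ [hd p])"
  have fin: "finite K" if "K \<in> {K. K \<subseteq> {..<n} \<and> card K = m}" for K
    using that finite_subset by blast
  have "(\<Sum>p | p \<in> walks n m \<and> distinct p. ?f p) =
     (\<Sum>K | K \<subseteq> {..<n} \<and> card K = m. \<Sum>p\<in>permutations_of_set K. ?f p)"
    by (rule sum_distinct_walks)
  also have "\<dots> = (\<Sum>K | K \<subseteq> {..<n} \<and> card K = m.
      of_nat m * (\<Sum>j=1..m - 1. of_int (eulerian (m - 1) j) * (x ^ j * y ^ (m - j))))"
    by (intro sum.cong refl sum_permutations_cycle fin assms) auto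
  also have "\<dots> = of_nat (n choose m) * (of_nat m * (\<Sum>j=1..m - 1. of_int (eulerian (m - 1) j) * (x ^ j * y ^ (m - j))))"
    using n_subsets[of "{..<n}" m] by simp
  finally show ?thesis .
qed

section \<open>Limiting covariances\<close>

lemma closing_edge_once:
  assumes "distinct (l @ [b])" "length l \<ge> 2"
  shows "edge b (hd l) \<notin> path_edges (l @ [b])"
proof -
  have "l \<noteq> []" using assms(2) by auto
  then obtain l' z where lz: "l = l' @ [z]" by (metis rev_exhaust)
  then have l: "l = l' @ [z]" "l' \<noteq> []" using assms(2) by auto
  have "path_edges (l' @ z # [b]) = path_edges (l' @ [z]) \<union> path_edges [z, b]" by (rule path_edges_append)
  moreover have "edge b (hd l) \<notin> path_edges (l' @ [z])"
    using path_edges_ends[of b "hd l" "l' @ [z]"] assms(1) l by auto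
  moreover have "hd l \<noteq> z" "b \<noteq> z" using assms(1) l by (cases l'; auto)+
  ultimately show ?thesis using l by (auto simp: edge_eq_iff)
qed

lemma cycle_neighbours:
  assumes "distinct (us @ x # y # b # vs)" "edge y v \<in> cycle_edges (us @ x # y # b # vs)"
  shows "v = x \<or> v = b"
proof -
  define z where "z = hd (us @ [x])"
  have "cycle_edges (us @ x # y # b # vs) = path_edges (us @ x # (y # b # vs @ [z]))"
    by (cases us) (simp_all add: cycle_edges_def z_def)
  also have "\<dots> = path_edges (us @ [x]) \<union> {edge x y, edge y b} \<union> path_edges (b # vs @ [z])"
    by (subst path_edges_append) auto
  finally have e: "edge y v \<in> path_edges (us @ [x]) \<or> edge y v = edge x y \<or> edge y v = edge y b \<or>
      edge y v \<in> path_edges (b # vs @ [z])" using assms(2) by auto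
  have "z \<in> set (us @ [x])" unfolding z_def by (cases us) auto
  then have "y \<notin> set (us @ [x])" "y \<notin> set (b # vs @ [z])" using assms(1) by auto
  then have "edge y v \<notin> path_edges (us @ [x])" "edge y v \<notin> path_edges (b # vs @ [z])"
    using path_edges_ends by blast+
  then show ?thesis using e by (auto simp: edge_eq_iff)
qed

text \<open>The cycle is rebuilt vertex by vertex: one of the two neighbours of \<open>y\<close> is
  the preceding \<open>x\<close>, so the next vertex is forced.\<close>

lemma cycle_determined:
  assumes "distinct (us @ x # y # r)" "distinct (us @ x # y # r')" "length r = length r'"
    and "cycle_edges (us @ x # y # r) \<subseteq> cycle_edges (us @ x # y # r')"
  shows "r = r'"
  using assms
proof (induction r arbitrary: us x y r')
  case (Cons b r)
  obtain b' r'' where r': "r' = b' # r''" using Cons(4) by (cases r') auto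
  define z where "z = hd (us @ [x])"
  have "cycle_edges (us @ x # y # b # r) = path_edges (us @ x # (y # b # r @ [z]))"
    by (cases us) (simp_all add: cycle_edges_def z_def)
  also have "\<dots> = path_edges (us @ [x]) \<union> path_edges (x # y # b # r @ [z])" by (rule path_edges_append)
  finally have "edge y b \<in> cycle_edges (us @ x # y # b' # r'')" using Cons(5) r' by auto
  from cycle_neighbours[OF Cons(3)[unfolded r'] this] have "b = b'" using Cons(2) by auto
  then show ?case using Cons(1)[of "us @ [x]" y b r''] Cons(2-5) r' by simp
qed simp

lemma path_edges_rev: "path_edges (rev xs) = path_edges xs"
proof (induction xs rule: path_edges.induct)
  case (3 x y r)
  have "path_edges (rev r @ y # [x]) = path_edges (rev r @ [y]) \<union> path_edges [y, x]" by (rule path_edges_append)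
  then show ?case using 3 by (simp add: edge_commute)
qed auto

lemma cycle_edges_rev: "cycle_edges (rev p) = cycle_edges p"
proof (cases p)
  case (Cons x xs)
  have "rotate (length (rev xs)) (rev p) = x # rev xs" unfolding Cons rev.simps rotate_append by simp
  then have "cycle_edges (rev p) = path_edges (rev (x # xs @ [x]))"
    using cycle_edges_rotate[of "length (rev xs)" "rev p"] by (simp add: cycle_edges_def)
  then show ?thesis unfolding path_edges_rev by (simp add: cycle_edges_def Cons)
qed simp

lemma rev_rotate: "\<exists>j. rev (rotate k p) = rotate j (rev p)"
  using rotate_rev[of k "rev p"] by (metis length_rev rev_rev_ident rotate_rev)

text \<open>The first edge of \<open>q\<close> occurs in \<open>p\<close> in one of two directions.
  Once it is aligned by rotating \<open>p\<close> or its reversal, the rest is forced.\<close>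

lemma cycle_determined_dihedral:
  assumes "distinct p" "distinct q" "length p = length q" "length p \<ge> 3" "cycle_edges p = cycle_edges q"
  shows "\<exists>k. q = rotate k p \<or> q = rotate k (rev p)"
proof -
  obtain x y r where q: "q = x # y # r" using assms(3,4)
    by (metis Suc_le_length_iff numeral_3_eq_3)
  have "edge x y \<in> cycle_edges p" unfolding assms(5) q by (simp add: cycle_edges_def)
  then obtain k r' where "rotate k p = x # y # r' \<or> rotate k p = y # x # r'"
    using cycle_edges_rotate_to assms(4) by (metis Suc_leD numeral_2_eq_2 numeral_3_eq_3)
  then show ?thesis
  proof
    assume rot: "rotate k p = x # y # r'"
    have "r = r'"
    proof (rule cycle_determined[of "[]" x y])
      show "distinct ([] @ x # y # r')" "distinct ([] @ x # y # r)" using assms rot q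
        by (metis append_Nil distinct_rotate)+
      show "length r = length r'" using arg_cong[OF rot, of length] assms(3) q by simp
      show "cycle_edges ([] @ x # y # r) \<subseteq> cycle_edges ([] @ x # y # r')"
        using cycle_edges_rotate[of k p] assms(5) rot q by simp
    qed
    then show ?thesis using rot q by metis
  next
    assume rot: "rotate k p = y # x # r'"
    obtain j where "rev (rotate k p) = rotate j (rev p)" using rev_rotate by metis
    then have "rotate (length r') (rotate j (rev p)) = x # y # rev r'"
      using rotate_append[of "rev r'" "[x, y]"] by (simp add: rot)
    then have rot': "rotate (length r' + j) (rev p) = x # y # rev r'" by (simp add: rotate_rotate)
    have "r = rev r'"
    proof (rule cycle_determined[of "[]" x y])
      show "distinct ([] @ x # y # rev r')" "distinct ([] @ x # y # r)" using assms rot' q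
        by (metis append_Nil distinct_rotate distinct_rev)+
      show "length r = length (rev r')" using arg_cong[OF rot, of length] assms(3) q by simp
      show "cycle_edges ([] @ x # y # r) \<subseteq> cycle_edges ([] @ x # y # rev r')"
        using cycle_edges_rotate[of "length r' + j" "rev p"] cycle_edges_rev[of p] assms(5) rot' q by simp
    qed
    then show ?thesis using rot' q by metis
  qed
qed

text \<open>Equality would give two positions, each advancing by one modulo m, whose sum is always m
  - 1. One step changes the sum by 2, 2 - m or 2 - 2 m, none of which is 0 for m at least 3.\<close>

lemma nth_rotate_rev_neq:
  assumes "distinct p" "length p \<ge> 3"
  shows "rotate k p \<noteq> rotate j (rev p)"
proof
  let ?m = "length p"
  assume eq: "rotate k p = rotate j (rev p)"
  have *: "(i + k) mod ?m + (i + j) mod ?m = ?m - 1" if "i < ?m" for i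
  proof -
    have m: "(i + k) mod ?m < ?m" "(i + j) mod ?m < ?m" using assms by (auto intro!: mod_less_divisor)
    have "p ! ((i + k) mod ?m) = rev p ! ((i + j) mod ?m)"
      using nth_rotate[of i p k] nth_rotate[of i "rev p" j] that eq by (simp add: add.commute)
    also have "\<dots> = p ! (?m - Suc ((i + j) mod ?m))" using m by (simp add: rev_nth)
    finally have "(i + k) mod ?m = ?m - Suc ((i + j) mod ?m)"
      using assms m nth_eq_iff_index_eq[OF assms(1)] by simp
    then show ?thesis using m by simp
  qed
  have "0 < ?m" "1 < ?m" using assms(2) by linarith+
  then have "(0 + k) mod ?m + (0 + j) mod ?m = ?m - 1" "(1 + k) mod ?m + (1 + j) mod ?m = ?m - 1"
    using *[of 0] *[of 1] by blast+
  then show False using assms(2) mod_Suc[of k ?m] mod_Suc[of j ?m] by (auto split: if_splits)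
qed

lemma inj_rotate:
  assumes "distinct p" "length p = m"
  shows "inj_on (\<lambda>k. rotate k p) {..<m}"
proof (cases "p = []")
  case False
  show ?thesis
  proof (rule inj_onI)
    fix i j assume ij: "i \<in> {..<m}" "j \<in> {..<m}" "rotate i p = rotate j p"
    have "p ! i = p ! j"
      using hd_rotate_conv_nth[OF False, of i] hd_rotate_conv_nth[OF False, of j] ij assms by simp
    then show "i = j" using ij assms nth_eq_iff_index_eq by auto
  qed
qed (use assms in simp)

lemma ex_rotate_iff: "(\<exists>k. q = rotate k p) \<longleftrightarrow> q \<in> (\<lambda>k. rotate k p) ` {..<length p}" if "p \<noteq> []"
proof
  assume "\<exists>k. q = rotate k p"
  then obtain k where "q = rotate k p" by blast
  then have "q = rotate (k mod length p) p" using rotate_conv_mod by metis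
  then show "q \<in> (\<lambda>k. rotate k p) ` {..<length p}" using that by auto
qed auto

lemma card_distinct_walks: "card {p. p \<in> walks n m \<and> distinct p} = (n choose m) * fact m"
proof -
  have "card {p. p \<in> walks n m \<and> distinct p} =
     (\<Sum>K | K \<subseteq> {..<n} \<and> card K = m. \<Sum>p\<in>permutations_of_set K. 1)"
    unfolding sum_distinct_walks[symmetric] by simp
  also have "\<dots> = (\<Sum>K | K \<subseteq> {..<n} \<and> card K = m. fact m)"
  proof (rule sum.cong[OF refl])
    fix K assume "K \<in> {K. K \<subseteq> {..<n} \<and> card K = m}"
    then have "finite K" "card K = m" using finite_subset by auto
    then show "(\<Sum>p\<in>permutations_of_set K. 1) = fact m" by simp
  qed
  finally show ?thesis using n_subsets[of "{..<n}" m] by simp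
qed

lemma path_weight_chain: "distinct xs \<Longrightarrow> path_weight w c xs = chain w xs"
proof (induction xs rule: path_edges.induct)
  case (3 x y r)
  then show ?case using path_weight_distinct[of x r w c y] by simp
qed auto

lemma cycle_weight_chain:
  assumes "distinct p" "length p \<ge> 3"
  shows "cycle_weight w c p = chain w (p @ [hd p])"
proof -
  have "p \<noteq> []" using assms(2) by auto
  then obtain l b where p: "p = l @ [b]" by (metis rev_exhaust)
  have l: "length l \<ge> 2" using assms(2) p by simp
  then have hd: "hd p = hd l" unfolding p by (cases l) auto
  have "cycle_weight w c p = path_weight w c p * w b (hd l)"
    unfolding p using closing_edge_once[of l b] l assms(1) p by (intro cycle_weight_edge_once) auto
  also have "\<dots> = chain w (l @ [b]) * chain w [b, hd l]" using path_weight_chain[OF assms(1)] p by simp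
  also have "\<dots> = chain w (p @ [hd p])" unfolding hd using chain_append[of w l b "[hd l]"] p by simp
  finally show ?thesis .
qed

lemma chain_const: "chain (\<lambda>_ _. c) (x # xs) = c ^ length xs"
  by (induction xs arbitrary: x) simp_all

lemma choose_over_power_tendsto_real: "(\<lambda>n. real (n choose m) / real n ^ m) \<longlonglongrightarrow> 1 / fact m"
proof (induction m)
  case (Suc m)
  have "(\<lambda>n. (real n - real m) / real n / (real m + 1)) \<longlonglongrightarrow> inverse (real m + 1)" by real_asymp
  from tendsto_mult[OF Suc this]
  have "(\<lambda>n. real (n choose m) / real n ^ m * ((real n - real m) / real n / (real m + 1))) \<longlonglongrightarrow> 1 / fact (Suc m)"
    by (simp add: inverse_eq_divide add.commute mult.commute)
  moreover have "\<forall>\<^sub>F n in sequentially. real (n choose m) / real n ^ m * ((real n - real m) / real n / (real m + 1)) =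
      real (n choose Suc m) / real n ^ Suc m"
  proof (rule eventually_sequentiallyI[of "Suc m"])
    fix n assume n: "Suc m \<le> n"
    have "Suc m * (n choose Suc m) = (n - m) * (n choose m)"
      by (simp only: binomial_absorption binomial_absorb_comp)
    then have "real (Suc m) * real (n choose Suc m) = (real n - real m) * real (n choose m)"
      using n by (metis of_nat_mult of_nat_diff Suc_leD)
    then have e: "(real n - real m) * real (n choose m) = (real m + 1) * real (n choose Suc m)"
      by (simp add: add.commute)
    have "real (n choose m) / real n ^ m * ((real n - real m) / real n / (real m + 1)) =
        (real n - real m) * real (n choose m) / ((real m + 1) * real n ^ Suc m)"
      by (simp add: mult_ac)
    also have "\<dots> = real (n choose Suc m) / real n ^ Suc m" unfolding e by simp
    finally show "real (n choose m) / real n ^ m * ((real n - real m) / real n / (real m + 1)) =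
      real (n choose Suc m) / real n ^ Suc m" .
  qed
  ultimately show ?case by (rule Lim_transform_eventually)
qed simp

lemma choose_over_power_tendsto:
  "(\<lambda>n. of_nat (n choose m) / of_nat n ^ m :: complex) \<longlonglongrightarrow> 1 / fact m"
  using tendsto_of_real[OF choose_over_power_tendsto_real[of m], where 'a = complex] by simp

section \<open>Moments of pairs of walks\<close>

context wigner
begin

text \<open>A shared edge forces equal vertex sets, since a partial overlap would annihilate the
  moment. With two visits available per vertex, each walk then meets every vertex exactly
  once.\<close>

lemma mom_pair_nonzero:
  assumes walk: "is_walk n p" "is_walk n q" and ns: "\<not> sparse_family [p, q]" and "mom n [p, q] \<noteq> 0"
  shows "distinct p" "distinct q" "set p = set q" "length p = length q"
proof -
  let ?C = "concat [p, q]"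
  have no1: "count_list ?C v \<noteq> 1" for v using mom_vertex_once[of "[p, q]" n v] walk assms(4) by auto
  have two: "count_list ?C v = 2" if "v \<in> set ?C" for v
    by (rule counts_eq_two[OF _ no1 that]) (use ns in \<open>simp add: sparse_family_def\<close>)
  then have le2: "count_list ?C v \<le> 2" for v
    using count_list_0_iff[of ?C v] by (cases "v \<in> set ?C") auto
  have "cycle_edges p \<inter> cycle_edges q \<noteq> {}"
    using mom_isolated[of n p "[q]"] walk assms(4) by auto
  then show eq: "set p = set q"
    using mom_partial_overlap[of p q "[]" n] walk assms(4) le2 by auto
  have one: "count_list p v = 1" "count_list q v = 1" if "v \<in> set p" for v
  proof -
    have "count_list p v \<noteq> 0" "count_list q v \<noteq> 0" using that eq by (auto simp: count_list_0_iff)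
    then show "count_list p v = 1" "count_list q v = 1" using le2[of v] by auto
  qed
  have "length p = (\<Sum>v\<in>set p. 1)" "length q = (\<Sum>v\<in>set q. 1)"
    using sum_count_list[of p] sum_count_list[of q] one eq by simp_all
  then show "distinct p" "distinct q" by (auto intro: card_distinct)
  then show "length p = length q" using eq by (metis distinct_card)
qed

text \<open>An edge of \<open>p\<close> missing in \<open>q\<close> would be used only once. The
  argument takes three vertices, because a cycle of two steps traverses its edge twice.\<close>

lemma mom_pair_edges:
  assumes walk: "is_walk n p" "is_walk n q" and "distinct p" "length p \<ge> 3" "mom n [p, q] \<noteq> 0"
  shows "cycle_edges p \<subseteq> cycle_edges q"
proof
  fix e assume e: "e \<in> cycle_edges p"
  obtain u w where uw: "e = edge u w"
  proof -
    have "\<exists>u w. e = edge u w" if "e \<in> path_edges xs" for xs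
      using that by (induction xs rule: path_edges.induct) auto
    then show ?thesis using e that by (auto simp: cycle_edges_def)
  qed
  have rot0: "\<exists>k l b. rotate k p = l @ [b] \<and> e = edge b (hd l) \<and> length l \<ge> 2"
    if "rotate k p = x # y # r" "e = edge x y" for x y r k
  proof -
    have "length r \<ge> 1" using arg_cong[OF that(1), of length] assms(4) by simp
    then have "rotate (Suc k) p = (y # r) @ [x] \<and> e = edge x (hd (y # r)) \<and> length (y # r) \<ge> 2"
      using that by simp
    then show ?thesis by blast
  qed
  obtain k r where "rotate k p = u # w # r \<or> rotate k p = w # u # r"
    using cycle_edges_rotate_to[of u w p] e uw assms(4) by (metis Suc_leD numeral_2_eq_2 numeral_3_eq_3)
  then obtain k l b where rot: "rotate k p = l @ [b]" "e = edge b (hd l)" "length l \<ge> 2"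
    using rot0 uw edge_commute by metis
  show "e \<in> cycle_edges q"
  proof (rule ccontr)
    assume "e \<notin> cycle_edges q"
    moreover have "edge b (hd l) \<notin> path_edges (l @ [b])"
      using rot assms(3) by (intro closing_edge_once) (metis distinct_rotate)+
    moreover have "l \<noteq> []" using rot(3) by auto
    ultimately have "mom n [p, q] = 0" using mom_edge_once[OF walk(1) rot(1), of "[q]"] walk rot(2) by auto
    then show False using assms(5) by simp
  qed
qed

text \<open>The surviving partners have the same edges as \<open>p\<close>; these are the m
  rotations of \<open>p\<close> and the m rotations of its reversal, all different.\<close>

lemma mom_sum_distinct:
  assumes "distinct p" "p \<in> walks n m" "m \<ge> 3"
  shows "(\<Sum>q | q \<in> walks n m \<and> \<not> sparse_family [p, q]. mom n [p, q]) =
     (\<Sum>k<m. mom n [p, rotate k p]) + (\<Sum>k<m. mom n [p, rotate k (rev p)])"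
proof -
  have len: "length p = m" "p \<noteq> []" using assms(2,3) by (auto simp: tuples_def)
  let ?R = "(\<lambda>k. rotate k p) ` {..<m}" and ?S = "(\<lambda>k. rotate k (rev p)) ` {..<m}"
  have "(\<Sum>q | q \<in> walks n m \<and> \<not> sparse_family [p, q]. mom n [p, q]) = (\<Sum>q\<in>?R \<union> ?S. mom n [p, q])"
  proof (rule sum.mono_neutral_right)
    show "?R \<union> ?S \<subseteq> {q \<in> walks n m. \<not> sparse_family [p, q]}"
      using assms(2) distinct_card[OF assms(1)] by (auto simp: tuples_def sparse_family_def)
    show "\<forall>q\<in>{q \<in> walks n m. \<not> sparse_family [p, q]} - (?R \<union> ?S). mom n [p, q] = 0"
    proof (intro ballI, rule ccontr)
      fix q assume q: "q \<in> {q \<in> walks n m. \<not> sparse_family [p, q]} - (?R \<union> ?S)" and nz: "mom n [p, q] \<noteq> 0"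
      have w: "is_walk n p" "is_walk n q" using assms q by (auto simp: is_walk_def tuples_def)
      note pq = mom_pair_nonzero[OF w _ nz]
      have "mom n [q, p] \<noteq> 0" using nz mom_mset[of "[p, q]" "[q, p]"] by simp
      then have "cycle_edges p = cycle_edges q"
        using mom_pair_edges[OF w, OF _ _ nz] mom_pair_edges[OF w(2,1)] pq q assms len by auto
      then obtain k where "q = rotate k p \<or> q = rotate k (rev p)"
        using cycle_determined_dihedral[of p q] pq q assms len by auto
      then show False using ex_rotate_iff[OF len(2), of q] ex_rotate_iff[of "rev p" q] q len by auto
    qed
  qed simp
  also have "\<dots> = (\<Sum>q\<in>?R. mom n [p, q]) + (\<Sum>q\<in>?S. mom n [p, q])"
    using nth_rotate_rev_neq[OF assms(1)] len assms(3) by (intro sum.union_disjoint) auto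
  also have "(\<Sum>q\<in>?R. mom n [p, q]) = (\<Sum>k<m. mom n [p, rotate k p])"
    by (subst sum.reindex[OF inj_rotate]) (use assms len in auto)
  also have "(\<Sum>q\<in>?S. mom n [p, q]) = (\<Sum>k<m. mom n [p, rotate k (rev p)])"
    by (subst sum.reindex[OF inj_rotate]) (use assms len in auto)
  finally show ?thesis .
qed


text \<open>The multiplicative \<open>f\<close> will be x, x^2 or x times its conjugate, so that
  mean, pseudo-variance and variance come from one computation.\<close>

lemma integral_chain:
  fixes f :: "complex \<Rightarrow> complex"
  assumes f: "f 1 = 1" "\<And>x y. f (x * y) = f x * f y" "\<And>S g. dep n S g \<Longrightarrow> dep n S (\<lambda>\<omega>. f (g \<omega>))"
    and w: "\<And>u v. u < n \<Longrightarrow> v < n \<Longrightarrow> u \<noteq> v \<Longrightarrow> (\<integral>\<omega>. f (a n u v \<omega>) \<partial>M n) = w u v"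
    and "distinct xs" "set xs \<subseteq> {..<n}"
  shows "(\<integral>\<omega>. f (chain (\<lambda>x y. a n x y \<omega>) xs) \<partial>M n) = chain w xs"
  using assms(5,6)
proof (induction xs rule: path_edges.induct)
  case (3 x y r)
  have "dep n (path_edges (y # r)) (\<lambda>\<omega>. chain (\<lambda>x y. a n x y \<omega>) (y # r))"
    using dep_path_weight[of "y # r" n 0] path_weight_chain[of "y # r"] 3(2,3) by simp
  from f(3)[OF this] f(3)[OF dep_entry[of x n y "{edge x y}"]]
  have "(\<integral>\<omega>. f (a n x y \<omega>) * f (chain (\<lambda>x y. a n x y \<omega>) (y # r)) \<partial>M n) =
      (\<integral>\<omega>. f (a n x y \<omega>) \<partial>M n) * (\<integral>\<omega>. f (chain (\<lambda>x y. a n x y \<omega>) (y # r)) \<partial>M n)"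
    using 3(2,3) path_edges_ends[of x y "y # r"] by (intro dep_indep) auto
  then show ?case using 3 w[of x y] by (simp add: f(2))
next
  case (2 x)
  interpret prob_space "M n" by (rule prob)
  show ?case by (simp add: f(1) prob_space)
next
  case 1
  interpret prob_space "M n" by (rule prob)
  show ?case by (simp add: f(1) prob_space)
qed

lemma integral_cw_distinct:
  fixes f :: "complex \<Rightarrow> complex"
  assumes f: "f 1 = 1" "\<And>x y. f (x * y) = f x * f y" "\<And>S g. dep n S g \<Longrightarrow> dep n S (\<lambda>\<omega>. f (g \<omega>))"
    and w: "\<And>u v. u < n \<Longrightarrow> v < n \<Longrightarrow> u \<noteq> v \<Longrightarrow> (\<integral>\<omega>. f (a n u v \<omega>) \<partial>M n) = w u v"
    and p: "distinct p" "set p \<subseteq> {..<n}" "length p \<ge> 3"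
  shows "(\<integral>\<omega>. f (cw n p \<omega>) \<partial>M n) = chain w (p @ [hd p])"
proof -
  have "p \<noteq> []" using p(3) by auto
  then obtain l b where lb: "p = l @ [b]" by (metis rev_exhaust)
  have l: "length l \<ge> 2" using p(3) lb by simp
  then have hd: "hd p = hd l" "hd l \<in> set l" unfolding lb by (cases l; auto)+
  have n: "b < n" "hd l < n" "b \<noteq> hd l" using p hd(2) lb by auto
  have c: "chain w (p @ [hd p]) = chain w p * w b (hd l)" for w
    using chain_append[of w l b "[hd l]"] lb hd by simp
  have "dep n (path_edges p) (\<lambda>\<omega>. chain (\<lambda>x y. a n x y \<omega>) p)"
    using dep_path_weight[of p n 0] path_weight_chain[of p] p by simp
  from f(3)[OF this] f(3)[OF dep_entry[of b n "hd l" "{edge b (hd l)}"]]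
  have "(\<integral>\<omega>. f (chain (\<lambda>x y. a n x y \<omega>) p) * f (a n b (hd l) \<omega>) \<partial>M n) =
      (\<integral>\<omega>. f (chain (\<lambda>x y. a n x y \<omega>) p) \<partial>M n) * (\<integral>\<omega>. f (a n b (hd l) \<omega>) \<partial>M n)"
    using n closing_edge_once[of l b] lb p(1) l by (intro dep_indep) auto
  then have "(\<integral>\<omega>. f (cw n p \<omega>) \<partial>M n) = chain w p * w b (hd l)"
    using integral_chain[OF f w p(1,2)] w[OF n]
    by (simp add: cw_def cycle_weight_chain[OF p(1,3)] c f(2))
  then show ?thesis by (simp add: c)
qed

lemma xi_distinct:
  assumes "distinct p" "set p \<subseteq> {..<n}" "length p \<ge> 3"
  shows "xi n p \<omega> = cw n p \<omega>"
proof -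
  obtain x y r where p: "p = x # y # r" using assms(3) by (metis Suc_le_length_iff numeral_3_eq_3)
  have "(\<integral>\<omega>. cw n p \<omega> \<partial>M n) = chain (\<lambda>_ _. 0) (p @ [hd p])"
    by (rule integral_cw_distinct[where f = "\<lambda>x. x"]) (use assms integral_entry_0 in auto)
  then show ?thesis by (simp add: xi_def p)
qed

lemma cw_rev:
  assumes "is_walk n p" "\<omega> \<in> space (M n)"
  shows "cw n (rev p) \<omega> = cnj (cw n p \<omega>)"
proof -
  have p: "length p \<ge> 2" "set p \<subseteq> {..<n}" using assms(1) by (auto simp: is_walk_def)
  then obtain x xs where xs: "p = x # xs" by (cases p) auto
  have "rotate (length (rev xs)) (rev p) = x # rev xs" unfolding xs rev.simps rotate_append by simp
  then have "cw n (rev p) \<omega> = cw n (x # rev xs) \<omega>"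
    using cw_rotate[of n "rev p" "length (rev xs)" \<omega>] assms(1) by (simp add: is_walk_def)
  also have "\<dots> = cnj (cw n p \<omega>)"
  proof -
    have "cycle_weight (\<lambda>x y. a n x y \<omega>) (complex_of_real (s\<^sup>2)) (hd p # rev (tl p)) =
       cnj (cycle_weight (\<lambda>x y. a n x y \<omega>) (complex_of_real (s\<^sup>2)) p)"
    proof (rule cycle_weight_rev)
      fix x y assume "x \<in> set p" "y \<in> set p"
      then show "a n y x \<omega> = cnj (a n x y \<omega>)" using p(2) by (intro herm assms(2)) auto
    qed (use p in auto)
    then show ?thesis by (simp add: cw_def xs)
  qed
  finally show ?thesis .
qed

text \<open>Pseudo-variance of the off-diagonal entries above the diagonal and below it.\<close>

abbreviation pvar :: complex where "pvar \<equiv> (\<integral>\<omega>. A \<omega> ^ 2 \<partial>P)"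
abbreviation pvar_cnj :: complex where "pvar_cnj \<equiv> (\<integral>\<omega>. cnj (A \<omega>) ^ 2 \<partial>P)"

lemma integral_entry_sq:
  assumes "u < n" "v < n" "u \<noteq> v"
  shows "(\<integral>\<omega>. (a n u v \<omega>)\<^sup>2 \<partial>M n) = (if u < v then pvar else pvar_cnj)"
proof (cases "u < v")
  case True
  then show ?thesis using integral_entry_eq[of u v n "\<lambda>x. x\<^sup>2"] assms by simp
next
  case False
  then have "v < u" using assms by simp
  have "(\<integral>\<omega>. (a n u v \<omega>)\<^sup>2 \<partial>M n) = (\<integral>\<omega>. (cnj (a n v u \<omega>))\<^sup>2 \<partial>M n)"
    by (intro Bochner_Integration.integral_cong refl arg_cong[of _ _ "\<lambda>x. x\<^sup>2"] herm assms)
  also have "\<dots> = pvar_cnj" using integral_entry_eq[OF \<open>v < u\<close> assms(1), of "\<lambda>x. (cnj x)\<^sup>2"] by simp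
  finally show ?thesis using False by simp
qed

text \<open>A rotation does not change the weight, so the moment is the mean of a square, to which
  ascending and descending steps contribute the two conjugate pseudo-variances.\<close>

lemma mom_rotate:
  assumes "distinct p" "p \<in> walks n m" "m \<ge> 3"
  shows "mom n [p, rotate k p] = chain (\<lambda>u v. if u < v then pvar else pvar_cnj) (p @ [hd p])"
proof -
  have p: "set p \<subseteq> {..<n}" "length p \<ge> 3" "is_walk n p" using assms by (auto simp: tuples_def is_walk_def)
  have "mom n [p, rotate k p] = (\<integral>\<omega>. (cw n p \<omega>)\<^sup>2 \<partial>M n)"
    by (simp add: mom_def xi_rotate[OF p(3)] xi_distinct[OF assms(1) p(1,2)] power2_eq_square)
  also have "\<dots> = chain (\<lambda>u v. if u < v then pvar else pvar_cnj) (p @ [hd p])"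
    by (rule integral_cw_distinct[where f = "\<lambda>x. x\<^sup>2"])
       (use assms p integral_entry_sq dep_power in \<open>auto simp: power_mult_distrib\<close>)
  finally show ?thesis .
qed

text \<open>Reversal conjugates the weight, so each step contributes E(|a|^2) whatever its
  direction.\<close>

lemma mom_rotate_rev:
  assumes "distinct p" "p \<in> walks n m" "m \<ge> 3"
  shows "mom n [p, rotate k (rev p)] = complex_of_real (s\<^sup>2) ^ m"
proof -
  have p: "set p \<subseteq> {..<n}" "length p \<ge> 3" "is_walk n p" "length p = m" using assms by (auto simp: tuples_def is_walk_def)
  have r: "is_walk n (rev p)" using p by (simp add: is_walk_def)
  have "mom n [p, rotate k (rev p)] = (\<integral>\<omega>. cw n p \<omega> * cnj (cw n p \<omega>) \<partial>M n)"
    unfolding mom_def using assms(1) p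
    by (intro Bochner_Integration.integral_cong refl) (simp add: xi_rotate[OF r] xi_distinct cw_rev)
  also have "\<dots> = chain (\<lambda>u v. complex_of_real (s\<^sup>2)) (p @ [hd p])"
  proof (rule integral_cw_distinct[where f = "\<lambda>x. x * cnj x"])
    fix u v assume uv: "u < n" "v < n" "u \<noteq> v"
    have "(\<integral>\<omega>. a n u v \<omega> * cnj (a n u v \<omega>) \<partial>M n) = (\<integral>\<omega>. a n u v \<omega> * a n v u \<omega> \<partial>M n)"
      using herm[OF uv(1,2)] by (intro Bochner_Integration.integral_cong) auto
    then show "(\<integral>\<omega>. a n u v \<omega> * cnj (a n u v \<omega>) \<partial>M n) = complex_of_real (s\<^sup>2)"
      using integral_entry_norm_sq[OF uv] by simp
  qed (use assms(1) p in \<open>auto intro: dep_mult dep_cnj\<close>)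
  also have "\<dots> = complex_of_real (s\<^sup>2) ^ m" using p by (cases p) (simp_all only: append_Cons chain_const, simp_all)
  finally show ?thesis .
qed

text \<open>The variance of |a|^2.\<close>

definition fourth :: complex where
  "fourth = complex_of_real ((\<integral>\<omega>. cmod (A \<omega>) ^ 4 \<partial>P) - (s\<^sup>2)\<^sup>2)"

text \<open>The weight |a|^2 - 2 s^2 has mean - s^2, so the centred weight is |a|^2 - s^2 for both
  orders of the two vertices.\<close>

lemma mom_two:
  assumes "x < n" "y < n" "x \<noteq> y" "q \<in> {[x, y], [y, x]}"
  shows "mom n [[x, y], q] = fourth"
proof -
  let ?c = "complex_of_real (s\<^sup>2)"
  have less: "mom n [[x, y], [x, y]] = fourth" if xy: "x < y" "y < n" for x y
  proof -
    interpret prob_space "M n" by (rule prob)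
    interpret P: prob_space P by (rule prob_P)
    have xn: "x < n" using xy by simp
    have "dep n UNIV (\<lambda>\<omega>. a n x y \<omega> * a n y x \<omega>)" using xy xn by (intro dep_mult dep_entry) auto
    from dep_integrable[OF this] have "xi n [x, y] \<omega> = a n x y \<omega> * a n y x \<omega> - ?c" for \<omega>
      using integral_entry_norm_sq[of x n y] xy xn
      by (simp add: xi_def cw_def cycle_weight_def prob_space)
    then have "mom n [[x, y], [x, y]] = (\<integral>\<omega>. (a n x y \<omega> * cnj (a n x y \<omega>) - ?c)\<^sup>2 \<partial>M n)"
      unfolding mom_def using herm[OF xn xy(2)]
      by (intro Bochner_Integration.integral_cong refl) (simp add: power2_eq_square)
    also have "\<dots> = (\<integral>\<omega>. (A \<omega> * cnj (A \<omega>) - ?c)\<^sup>2 \<partial>P)"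
      using integral_entry_eq[OF xy, of "\<lambda>z. (z * cnj z - ?c)\<^sup>2"] by simp
    also have "\<dots> = (\<integral>\<omega>. complex_of_real (cmod (A \<omega>) ^ 4 - 2 * s\<^sup>2 * cmod (A \<omega>) ^ 2 + (s\<^sup>2)\<^sup>2) \<partial>P)"
    proof (rule Bochner_Integration.integral_cong[OF refl])
      fix \<omega>
      have "(A \<omega> * cnj (A \<omega>) - ?c)\<^sup>2 = complex_of_real ((cmod (A \<omega>) ^ 2 - s\<^sup>2)\<^sup>2)"
        by (simp only: of_real_power of_real_diff complex_norm_square[symmetric])
      also have "(cmod (A \<omega>) ^ 2 - s\<^sup>2)\<^sup>2 = cmod (A \<omega>) ^ 4 - 2 * s\<^sup>2 * cmod (A \<omega>) ^ 2 + (s\<^sup>2)\<^sup>2"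
        by (simp add: power2_eq_square algebra_simps power4_eq_xxxx)
      finally show "(A \<omega> * cnj (A \<omega>) - ?c)\<^sup>2 =
        complex_of_real (cmod (A \<omega>) ^ 4 - 2 * s\<^sup>2 * cmod (A \<omega>) ^ 2 + (s\<^sup>2)\<^sup>2)" .
    qed
    also have "\<dots> = fourth"
    proof -
      have int: "integrable P (\<lambda>\<omega>. cmod (A \<omega>) ^ k)" for k
      proof -
        note [measurable] = meas_A
        have [measurable]: "a n x y \<in> borel_measurable (M n)" using xn xy by simp
        have "integrable (distr (M n) borel (a n x y)) (\<lambda>z. cmod z ^ k)"
          using dep_moment[OF dep_entry[of x n y UNIV], of k] xn xy by (subst integrable_distr_eq) auto
        then show ?thesis unfolding distr_A[OF xy] by (subst (asm) integrable_distr_eq) auto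
      qed
      have "(\<integral>\<omega>. cmod (A \<omega>) ^ 4 - 2 * s\<^sup>2 * cmod (A \<omega>) ^ 2 + (s\<^sup>2)\<^sup>2 \<partial>P) =
          (\<integral>\<omega>. cmod (A \<omega>) ^ 4 \<partial>P) - 2 * s\<^sup>2 * (\<integral>\<omega>. cmod (A \<omega>) ^ 2 \<partial>P) + (s\<^sup>2)\<^sup>2"
        using int[of 4] int[of 2] by (simp add: P.prob_space)
      also have "\<dots> = (\<integral>\<omega>. cmod (A \<omega>) ^ 4 \<partial>P) - (s\<^sup>2)\<^sup>2"
        unfolding second_moment by (simp add: power2_eq_square)
      finally show ?thesis by (simp only: fourth_def integral_complex_of_real)
    qed
    finally show ?thesis .
  qed
  have rot: "xi n [u, v] \<omega> = xi n [v, u] \<omega>" if "u < n" "v < n" for u v \<omega>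
    using xi_rotate[of n "[u, v]" 1 \<omega>] that by (simp add: is_walk_def)
  have q: "xi n q \<omega> = xi n [x, y] \<omega>" for \<omega> using rot[OF assms(1,2)] assms(4) by auto
  show ?thesis
  proof (cases "x < y")
    case True
    have "mom n [[x, y], q] = mom n [[x, y], [x, y]]" by (simp add: mom_def q)
    then show ?thesis using less[OF True assms(2)] by simp
  next
    case False
    have "mom n [[x, y], q] = mom n [[y, x], [y, x]]" by (simp add: mom_def q rot[OF assms(1,2)])
    then show ?thesis using less[of y x] False assms by simp
  qed
qed

section \<open>Covariances of the traces and their limits\<close>

definition cov :: "nat \<Rightarrow> nat \<Rightarrow> nat \<Rightarrow> complex" where
  "cov m m' n = complex_of_real ((1 / sqrt (real n)) ^ (m + m')) * (\<Sum>p\<in>walks n m. \<Sum>q\<in>walks n m'. mom n [p, q])"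

lemma cov_approx:
  assumes "m \<ge> 2" "m' \<ge> 2"
  shows "(\<lambda>n. cov m m' n - complex_of_real ((1 / sqrt (real n)) ^ (m + m')) *
     (\<Sum>p\<in>walks n m. \<Sum>q | q \<in> walks n m' \<and> \<not> sparse_family [p, q]. mom n [p, q])) \<longlonglongrightarrow> 0"
proof -
  let ?J = "{m, m'}"
  have J: "finite ?J" "?J \<subseteq> {2..}" using assms by auto
  obtain C0 where C0: "C0 \<ge> 0" "\<And>n ps. ps \<in> tuples (walk_family n ?J) 2 \<Longrightarrow> cmod (mom n ps) \<le> C0"
    using mom_bound[OF J] by metis
  obtain C where C: "C \<ge> 0" "\<And>n. n > 0 \<Longrightarrow> (\<Sum>ps | ps \<in> tuples (walk_family n ?J) 2 \<and> sparse_family ps.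
         (1 / sqrt (real n)) ^ length (concat ps)) \<le> C / sqrt (real n)"
    using sparse_sum_bound[OF J(1), of 2] by auto
  have bound: "cmod (cov m m' n - complex_of_real ((1 / sqrt (real n)) ^ (m + m')) *
     (\<Sum>p\<in>walks n m. \<Sum>q | q \<in> walks n m' \<and> \<not> sparse_family [p, q]. mom n [p, q])) \<le> C0 * C / sqrt (real n)"
    if n: "n > 0" for n
  proof -
    let ?t = "(1 / sqrt (real n)) ^ (m + m')"
    let ?S = "{(p, q). p \<in> walks n m \<and> q \<in> walks n m' \<and> sparse_family [p, q]}"
    have fin: "finite ?S" by (rule finite_subset[of _ "walks n m \<times> walks n m'"]) auto
    have "(\<Sum>q\<in>walks n m'. mom n [p, q]) - (\<Sum>q | q \<in> walks n m' \<and> \<not> sparse_family [p, q]. mom n [p, q]) =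
       (\<Sum>q | q \<in> walks n m' \<and> sparse_family [p, q]. mom n [p, q])" for p
      using sum.Int_Diff[of "walks n m'" "\<lambda>q. mom n [p, q]" "{q. sparse_family [p, q]}"]
      by (simp add: Int_def Diff_eq set_diff_eq)
    then have "cov m m' n - complex_of_real ?t * (\<Sum>p\<in>walks n m. \<Sum>q | q \<in> walks n m' \<and> \<not> sparse_family [p, q]. mom n [p, q])
       = complex_of_real ?t * (\<Sum>p\<in>walks n m. \<Sum>q | q \<in> walks n m' \<and> sparse_family [p, q]. mom n [p, q])"
      unfolding cov_def right_diff_distrib[symmetric] sum_subtractf[symmetric] by simp
    also have "(\<Sum>p\<in>walks n m. \<Sum>q | q \<in> walks n m' \<and> sparse_family [p, q]. mom n [p, q]) =
        (\<Sum>(p, q)\<in>?S. mom n [p, q])"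
      by (subst sum.Sigma) (auto intro!: sum.cong)
    also have "complex_of_real ?t * (\<Sum>(p, q)\<in>?S. mom n [p, q]) = (\<Sum>(p, q)\<in>?S. complex_of_real ?t * mom n [p, q])"
      by (simp add: sum_distrib_left case_prod_beta)
    also have "cmod \<dots> \<le> (\<Sum>(p, q)\<in>?S. ?t * C0)"
    proof (rule sum_norm_le)
      fix z assume "z \<in> ?S"
      then obtain p q where z: "z = (p, q)" "p \<in> walks n m" "q \<in> walks n m'" by auto
      then have "[p, q] \<in> tuples (walk_family n ?J) 2" by (auto simp: tuples_def walk_family_def)
      from C0(2)[OF this] show "cmod (case z of (p, q) \<Rightarrow> complex_of_real ?t * mom n [p, q]) \<le> (case z of (p, q) \<Rightarrow> ?t * C0)"
        unfolding z(1) by (simp add: norm_mult norm_power norm_divide mult_left_mono)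
    qed
    also have "\<dots> = C0 * (\<Sum>(p, q)\<in>?S. (1 / sqrt (real n)) ^ length (concat [p, q]))"
      unfolding sum_distrib_left by (intro sum.cong refl) (auto simp: tuples_def)
    also have "(\<Sum>(p, q)\<in>?S. (1 / sqrt (real n)) ^ length (concat [p, q])) =
       (\<Sum>ps\<in>(\<lambda>(p, q). [p, q]) ` ?S. (1 / sqrt (real n)) ^ length (concat ps))"
      by (subst sum.reindex) (auto simp: inj_on_def intro!: sum.cong)
    also have "\<dots> \<le> (\<Sum>ps | ps \<in> tuples (walk_family n ?J) 2 \<and> sparse_family ps. (1 / sqrt (real n)) ^ length (concat ps))"
    proof (rule sum_mono2)
      show "finite {ps. ps \<in> tuples (walk_family n ?J) 2 \<and> sparse_family ps}"
        by (rule finite_subset[of _ "tuples (walk_family n ?J) 2"]) auto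
    qed (auto simp: tuples_def walk_family_def)
    also have "\<dots> \<le> C / sqrt (real n)" by (rule C(2)[OF n])
    finally show ?thesis using C0(1) by (simp add: mult_left_mono)
  qed
  show ?thesis
  proof (rule Lim_null_comparison)
    show "\<forall>\<^sub>F n in sequentially. cmod (cov m m' n - complex_of_real ((1 / sqrt (real n)) ^ (m + m')) *
     (\<Sum>p\<in>walks n m. \<Sum>q | q \<in> walks n m' \<and> \<not> sparse_family [p, q]. mom n [p, q])) \<le> C0 * C / sqrt (real n)"
      by (rule eventually_sequentiallyI[of 1]) (use bound in auto)
    show "(\<lambda>n. C0 * C / sqrt (real n)) \<longlonglongrightarrow> 0" by real_asymp
  qed
qed

lemma cov_distinct_tendsto:
  assumes "m \<ge> 2" "m' \<ge> 2" "m \<noteq> m'"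
  shows "cov m m' \<longlonglongrightarrow> 0"
proof -
  have "(\<Sum>p\<in>walks n m. \<Sum>q | q \<in> walks n m' \<and> \<not> sparse_family [p, q]. mom n [p, q]) = 0" for n
  proof (intro sum.neutral ballI)
    fix p q assume *: "p \<in> walks n m" "q \<in> {q \<in> walks n m'. \<not> sparse_family [p, q]}"
    then have "is_walk n p" "is_walk n q" "length p \<noteq> length q" using assms by (auto simp: tuples_def is_walk_def)
    then show "mom n [p, q] = 0" using mom_pair_nonzero(4)[of n p q] * by auto
  qed
  then show ?thesis using cov_approx[OF assms(1,2)] by simp
qed

text \<open>The Eulerian sum has the full range produced by counting cyclic ascents; the symmetry of
  the Eulerian numbers folds it into the half range of the theorem only at the end.\<close>

definition cov_limit :: "nat \<Rightarrow> complex" where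
  "cov_limit m = (if m = 2 then 2 * fourth else
     of_nat m * complex_of_real (s\<^sup>2) ^ m + of_nat m *
       (\<Sum>k=1..m - 1. of_int (eulerian (m - 1) k) / fact (m - 1) * (pvar ^ k * pvar_cnj ^ (m - k))))"

lemma cov_same_tendsto:
  assumes "m \<ge> 2"
  shows "cov m m \<longlonglongrightarrow> cov_limit m"
proof -
  define S where "S n = (\<Sum>p\<in>walks n m. \<Sum>q | q \<in> walks n m \<and> \<not> sparse_family [p, q]. mom n [p, q])" for n
  have zero: "(\<Sum>q | q \<in> walks n m \<and> \<not> sparse_family [p, q]. mom n [p, q]) = 0"
    if "p \<in> walks n m" "\<not> distinct p" for n p
  proof (intro sum.neutral ballI)
    fix q assume *: "q \<in> {q \<in> walks n m. \<not> sparse_family [p, q]}"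
    then have "is_walk n p" "is_walk n q" using assms that by (auto simp: tuples_def is_walk_def)
    then show "mom n [p, q] = 0" using mom_pair_nonzero(1)[of n p q] * that by auto
  qed
  have S: "S n = (\<Sum>p | p \<in> walks n m \<and> distinct p. \<Sum>q | q \<in> walks n m \<and> \<not> sparse_family [p, q]. mom n [p, q])" for n
    unfolding S_def by (rule sum.mono_neutral_right) (auto intro!: zero)
  have "(\<lambda>n. S n / of_nat n ^ m) \<longlonglongrightarrow> cov_limit m"
  proof (cases "m = 2")
    case True
    \<comment> \<open>There are n (n - 1) walks on two distinct vertices, and each has two
      partners.\<close>
    have "S n = of_nat (n choose 2) * 4 * fourth" for n
    proof -
      have "(\<Sum>q | q \<in> walks n m \<and> \<not> sparse_family [p, q]. mom n [p, q]) = 2 * fourth"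
        if p: "p \<in> walks n m" "distinct p" for p
      proof -
        obtain x y where xy: "p = [x, y]" "x < n" "y < n" "x \<noteq> y"
          using p True by (auto simp: tuples_def length_Suc_conv numeral_2_eq_2)
        have "(\<Sum>q | q \<in> walks n m \<and> \<not> sparse_family [p, q]. mom n [p, q]) = (\<Sum>q\<in>{[x, y], [y, x]}. mom n [p, q])"
        proof (rule sum.mono_neutral_right)
          show "{[x, y], [y, x]} \<subseteq> {q \<in> walks n m. \<not> sparse_family [p, q]}"
            using xy True by (auto simp: tuples_def sparse_family_def insert_commute)
          show "\<forall>q\<in>{q \<in> walks n m. \<not> sparse_family [p, q]} - {[x, y], [y, x]}. mom n [p, q] = 0"
          proof (intro ballI, rule ccontr)
            fix q assume q: "q \<in> {q \<in> walks n m. \<not> sparse_family [p, q]} - {[x, y], [y, x]}" "mom n [p, q] \<noteq> 0"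
            then have "is_walk n p" "is_walk n q" using assms p by (auto simp: tuples_def is_walk_def)
            from mom_pair_nonzero[OF this _ q(2)] q(1) xy(1)
            have "distinct q" "set q = {x, y}" "length q = 2" by auto
            then obtain u v where "q = [u, v]" "u \<noteq> v" "{u, v} = {x, y}"
              by (auto simp: length_Suc_conv numeral_2_eq_2)
            then show False using q(1) by (auto simp: doubleton_eq_iff)
          qed
        qed simp
        also have "\<dots> = 2 * fourth" using xy mom_two[of x n y] by simp
        finally show ?thesis .
      qed
      then have "S n = of_nat (card {p. p \<in> walks n m \<and> distinct p}) * (2 * fourth)" unfolding S by simp
      then show ?thesis unfolding card_distinct_walks True by (simp add: fact_2)
    qed
    then have "(\<lambda>n. S n / of_nat n ^ m) = (\<lambda>n. of_nat (n choose 2) / of_nat n ^ 2 * (4 * fourth))"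
      using True by (simp add: fun_eq_iff)
    moreover have "(\<lambda>n. of_nat (n choose 2) / of_nat n ^ 2 * (4 * fourth)) \<longlonglongrightarrow> 1 / fact 2 * (4 * fourth)"
      by (intro tendsto_mult choose_over_power_tendsto tendsto_const)
    ultimately show ?thesis using True by (simp add: cov_limit_def fact_2)
  next
    case False
    then have m: "m \<ge> 3" using assms by simp
    define E where "E = (\<Sum>j=1..m - 1. of_int (eulerian (m - 1) j) * (pvar ^ j * pvar_cnj ^ (m - j)))"
    \<comment> \<open>In the first term, one factor m counts the rotations of the partner and the
      other the positions of the maximum of \<open>p\<close>.\<close>
    have "S n = of_nat (n choose m) * (of_nat m * (of_nat m * E)) +
        of_nat (n choose m) * (fact m * (of_nat m * complex_of_real (s\<^sup>2) ^ m))" for n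
    proof -
      have "S n = (\<Sum>p | p \<in> walks n m \<and> distinct p.
          of_nat m * chain (\<lambda>u v. if u < v then pvar else pvar_cnj) (p @ [hd p]) + of_nat m * complex_of_real (s\<^sup>2) ^ m)"
        unfolding S
        by (intro sum.cong refl) (simp add: mom_sum_distinct[OF _ _ m] mom_rotate[OF _ _ m] mom_rotate_rev[OF _ _ m])
      then show ?thesis
        unfolding sum.distrib sum_distrib_left[symmetric] sum_distinct_cycles[OF assms] E_def
        by (simp add: card_distinct_walks)
    qed
    then have "(\<lambda>n. S n / of_nat n ^ m) = (\<lambda>n. of_nat (n choose m) / of_nat n ^ m *
        (of_nat m * (of_nat m * E) + fact m * (of_nat m * complex_of_real (s\<^sup>2) ^ m)))"
      by (simp add: fun_eq_iff add_divide_distrib algebra_simps)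
    moreover have "(\<lambda>n. of_nat (n choose m) / of_nat n ^ m *
        (of_nat m * (of_nat m * E) + fact m * (of_nat m * complex_of_real (s\<^sup>2) ^ m))) \<longlonglongrightarrow>
        1 / fact m * (of_nat m * (of_nat m * E) + fact m * (of_nat m * complex_of_real (s\<^sup>2) ^ m))"
      by (intro tendsto_mult choose_over_power_tendsto tendsto_const)
    moreover have "1 / fact m * (of_nat m * (of_nat m * E) + fact m * (of_nat m * complex_of_real (s\<^sup>2) ^ m)) = cov_limit m"
    proof -
      have f: "(fact m :: complex) = of_nat m * fact (m - 1)" using m by (simp add: fact_reduce)
      have "(\<Sum>k=1..m - 1. of_int (eulerian (m - 1) k) / fact (m - 1) * (pvar ^ k * pvar_cnj ^ (m - k))) = E / fact (m - 1)"
        unfolding E_def sum_divide_distrib by (intro sum.cong refl) simp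
      then show ?thesis using m False by (simp add: cov_limit_def f field_simps)
    qed
    ultimately show ?thesis by simp
  qed
  moreover have "complex_of_real ((1 / sqrt (real n)) ^ (m + m)) * S n = S n / of_nat n ^ m" for n
  proof -
    have "(1 / sqrt (real n)) ^ (m + m) = 1 / real n ^ m"
      by (simp add: power_divide power_add flip: power_mult_distrib)
    then show ?thesis by simp
  qed
  ultimately have "(\<lambda>n. complex_of_real ((1 / sqrt (real n)) ^ (m + m)) * S n) \<longlonglongrightarrow> cov_limit m" by simp
  from tendsto_add[OF cov_approx[OF assms assms] this] show ?thesis by (simp add: S_def)
qed

end

section \<open>Convergence in distribution\<close>

lemma norm_diff_triangle4:
  fixes x y z w :: "'a :: real_normed_vector"
  shows "norm (x - w) \<le> norm (x - y) + norm (y - z) + norm (z - w)"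
  using norm_triangle_ineq[of "x - y + (y - z)" "z - w"] norm_triangle_ineq[of "x - y" "y - z"] by simp

text \<open>The characteristic function differs from its Taylor polynomial of degree 2 N by at most
  2 E(X^(2 N)) / (2 N)!, whose limit in n is 2 (v / 2)^N / N! and becomes small. The argument of the
  characteristic function is absorbed in \<open>X\<close>.\<close>

lemma gaussian_charfun_limit:
  fixes X :: "nat \<Rightarrow> 'a \<Rightarrow> real" and M :: "nat \<Rightarrow> 'a measure"
  assumes prob: "\<And>n. prob_space (M n)" and meas: "\<And>n. X n \<in> borel_measurable (M n)"
    and int: "\<And>n k. integrable (M n) (\<lambda>\<omega>. X n \<omega> ^ k)"
    and lim: "\<And>k. (\<lambda>n. \<integral>\<omega>. X n \<omega> ^ k \<partial>M n) \<longlonglongrightarrow> g k"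
    and g: "g 0 = 1" "g 1 = 0" "\<And>k. g (Suc (Suc k)) = real (Suc k) * v * g k" and "v \<ge> 0"
  shows "(\<lambda>n. \<integral>\<omega>. iexp (X n \<omega>) \<partial>M n) \<longlonglongrightarrow> complex_of_real (exp (- v / 2))"
proof -
  have odd: "g (Suc (2 * k)) = 0" for k
    by (induction k) (use g(2,3) in simp_all)
  have even: "g (2 * k) / fact (2 * k) = (v / 2) ^ k / fact k" for k
  proof (induction k)
    case (Suc k)
    have "g (2 * Suc k) / fact (2 * Suc k) = v / real (Suc (Suc (2 * k))) * (g (2 * k) / fact (2 * k))"
    proof -
      define a where "a = real (Suc (2 * k))"
      define b where "b = real (Suc (Suc (2 * k)))"
      have a: "a \<noteq> 0" by (simp add: a_def)
      have 1: "g (2 * Suc k) = a * v * g (2 * k)" using g(3)[of "2 * k"] by (simp add: a_def)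
      have 2: "fact (2 * Suc k) = b * (a * fact (2 * k))" by (simp add: a_def b_def)
      show ?thesis unfolding b_def[symmetric] 1 2 using a by simp
    qed
    also have "\<dots> = (v / 2) ^ Suc k / fact (Suc k)"
      unfolding Suc by (simp add: field_simps)
    finally show ?case .
  qed (use g(1) in simp)
  \<comment> \<open>Limit of the Taylor polynomials; as odd moments vanish, it is a partial sum of
    the series of exp (- v / 2).\<close>
  define T where "T N = (\<Sum>k\<le>2 * N. \<i> ^ k / fact k * complex_of_real (g k))" for N
  have T: "T N = complex_of_real (\<Sum>k\<le>N. (- v / 2) ^ k / fact k)" for N
  proof -
    have step: "\<i> ^ (2 * k) / fact (2 * k) * complex_of_real (g (2 * k)) = complex_of_real ((- v / 2) ^ k / fact k)" for k
    proof -
      have "\<i> ^ (2 * k) / fact (2 * k) * complex_of_real (g (2 * k)) =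
          \<i> ^ (2 * k) * complex_of_real (g (2 * k) / fact (2 * k))" by simp
      also have "\<dots> = complex_of_real ((- 1) ^ k * ((v / 2) ^ k / fact k))" unfolding even by (simp add: power_mult)
      also have "(- 1) ^ k * ((v / 2) ^ k / fact k) = (- v / 2) ^ k / fact k"
        by (simp add: power_mult_distrib[symmetric] flip: minus_divide_left)
      finally show ?thesis .
    qed
    show ?thesis unfolding T_def
    proof (induction N)
      case (Suc N)
      have "2 * Suc N = Suc (Suc (2 * N))" by simp
      then have "(\<Sum>k\<le>2 * Suc N. \<i> ^ k / fact k * complex_of_real (g k)) =
         (\<Sum>k\<le>2 * N. \<i> ^ k / fact k * complex_of_real (g k)) +
         \<i> ^ (2 * Suc N) / fact (2 * Suc N) * complex_of_real (g (2 * Suc N))"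
        using odd[of N] by (simp only: sum.atMost_Suc) simp
      then show ?case using Suc step[of "Suc N"] by simp
    qed (use g(1) in simp)
  qed
  have exp_sums: "(\<lambda>k. x ^ k / fact k) sums exp x" for x :: real
    using exp_converges[of x] by (simp add: divide_inverse mult.commute)
  have "(\<lambda>N. \<Sum>k\<le>N. (- v / 2) ^ k / fact k) \<longlonglongrightarrow> exp (- v / 2)"
    using exp_sums[of "- v / 2"] by (simp add: sums_def_le)
  then have T_lim: "T \<longlonglongrightarrow> complex_of_real (exp (- v / 2))"
    unfolding T by (rule tendsto_of_real)
  have "(\<lambda>k. (v / 2) ^ k / fact k) \<longlonglongrightarrow> 0"
    using exp_sums[of "v / 2"] by (intro summable_LIMSEQ_zero) (rule sums_summable)
  then have g_lim: "(\<lambda>k. g (2 * k) / fact (2 * k)) \<longlonglongrightarrow> 0" unfolding even .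
  show ?thesis
  proof (rule LIMSEQ_I)
    fix e :: real assume e: "e > 0"
    have "\<forall>\<^sub>F N in sequentially. norm (T N - complex_of_real (exp (- v / 2))) < e / 4"
      using tendstoD[OF T_lim, of "e / 4"] e by (simp add: dist_norm)
    moreover have "\<forall>\<^sub>F N in sequentially. \<bar>g (2 * N) / fact (2 * N)\<bar> < e / 8"
      using tendstoD[OF g_lim, of "e / 8"] e by (simp add: dist_norm)
    \<comment> \<open>\<open>N\<close> is fixed before n, so that only finitely many moments have to
      be close to their limits.\<close>
    ultimately obtain N where N: "norm (T N - complex_of_real (exp (- v / 2))) < e / 4"
      "\<bar>g (2 * N) / fact (2 * N)\<bar> < e / 8"
      using eventually_conj eventually_happens trivial_limit_sequentially by blast
    define S where "S n = (\<Sum>k\<le>2 * N. \<i> ^ k / fact k * complex_of_real (\<integral>\<omega>. X n \<omega> ^ k \<partial>M n))" for n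
    have "S \<longlonglongrightarrow> T N" unfolding S_def T_def
      by (intro tendsto_sum tendsto_mult tendsto_const tendsto_of_real lim)
    then have "\<forall>\<^sub>F n in sequentially. norm (S n - T N) < e / 4"
      using tendstoD[of S "T N" sequentially "e / 4"] e by (simp add: dist_norm)
    moreover have "(\<lambda>n. 2 * ((\<integral>\<omega>. X n \<omega> ^ (2 * N) \<partial>M n) / fact (2 * N))) \<longlonglongrightarrow> 2 * (g (2 * N) / fact (2 * N))"
      by (intro tendsto_mult tendsto_divide tendsto_const lim) simp
    then have "\<forall>\<^sub>F n in sequentially. 2 * ((\<integral>\<omega>. X n \<omega> ^ (2 * N) \<partial>M n) / fact (2 * N)) < e / 4"
      by (rule order_tendstoD(2)) (use N(2) in linarith)
    ultimately have "\<forall>\<^sub>F n in sequentially. norm ((\<integral>\<omega>. iexp (X n \<omega>) \<partial>M n) - complex_of_real (exp (- v / 2))) < e"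
    proof eventually_elim
      case (elim n)
      interpret prob_space "M n" by (rule prob)
      have "cmod (char (distr (M n) borel (X n)) 1 - (\<Sum>k\<le>2 * N. ((\<i> * complex_of_real 1) ^ k / fact k) * expectation (\<lambda>x. X n x ^ k)))
         \<le> (2 * \<bar>1\<bar> ^ (2 * N) / fact (2 * N)) * expectation (\<lambda>x. \<bar>X n x\<bar> ^ (2 * N))"
        by (intro char_approx1'[where \<mu> = "distr (M n) borel (X n)"] int meas refl)
      moreover have "char (distr (M n) borel (X n)) 1 = (\<integral>\<omega>. iexp (X n \<omega>) \<partial>M n)"
        unfolding char_def using meas[of n] by (subst integral_distr) auto
      moreover have "\<bar>x\<bar> ^ (2 * N) = x ^ (2 * N)" for x :: real by (simp add: power_mult)
      ultimately have 1: "cmod ((\<integral>\<omega>. iexp (X n \<omega>) \<partial>M n) - S n) \<le> 2 * ((\<integral>\<omega>. X n \<omega> ^ (2 * N) \<partial>M n) / fact (2 * N))"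
        by (simp add: S_def)
      have "norm ((\<integral>\<omega>. iexp (X n \<omega>) \<partial>M n) - complex_of_real (exp (- v / 2))) \<le>
         cmod ((\<integral>\<omega>. iexp (X n \<omega>) \<partial>M n) - S n) + norm (S n - T N) + norm (T N - complex_of_real (exp (- v / 2)))"
        by (rule norm_diff_triangle4)
      then show ?case using 1 elim N(1) e by linarith
    qed
    then show "\<exists>no. \<forall>n\<ge>no. norm ((\<integral>\<omega>. iexp (X n \<omega>) \<partial>M n) - complex_of_real (exp (- v / 2))) < e"
      unfolding eventually_sequentially .
  qed
qed

section \<open>Trigonometric polynomials in finitely many coordinates\<close>

inductive trig_poly :: "nat set \<Rightarrow> ((nat \<Rightarrow> real) \<Rightarrow> real) \<Rightarrow> bool" for J where
  cos: "trig_poly J (\<lambda>x. c * cos ((\<Sum>j\<in>J. t j * x j) + d))"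
| add: "trig_poly J f \<Longrightarrow> trig_poly J g \<Longrightarrow> trig_poly J (\<lambda>x. f x + g x)"

lemma trig_poly_const: "trig_poly J (\<lambda>x. c)"
  using trig_poly.cos[of J c "\<lambda>_. 0" 0] by simp

text \<open>By the product-to-sum formula. The phase \<open>d\<close> makes sines available too, so
  one kind of generator is enough for an algebra.\<close>

lemma trig_poly_mult:
  assumes "trig_poly J f" "trig_poly J g"
  shows "trig_poly J (\<lambda>x. f x * g x)"
  using assms
proof (induction arbitrary: g rule: trig_poly.induct)
  case (cos c t d)
  from cos show ?case
  proof (induction rule: trig_poly.induct)
    case (cos c' t' d')
    let ?f = "\<lambda>x. c * c' / 2 * cos ((\<Sum>j\<in>J. (t j - t' j) * x j) + (d - d')) +
       c * c' / 2 * cos ((\<Sum>j\<in>J. (t j + t' j) * x j) + (d + d'))"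
    have "?f = (\<lambda>x. c * cos ((\<Sum>j\<in>J. t j * x j) + d) * (c' * cos ((\<Sum>j\<in>J. t' j * x j) + d')))"
    proof
      fix x
      define u where "u = (\<Sum>j\<in>J. t j * x j) + d"
      define u' where "u' = (\<Sum>j\<in>J. t' j * x j) + d'"
      have e: "(\<Sum>j\<in>J. (t j - t' j) * x j) + (d - d') = u - u'" "(\<Sum>j\<in>J. (t j + t' j) * x j) + (d + d') = u + u'"
        by (simp_all add: u_def u'_def left_diff_distrib distrib_right sum_subtractf sum.distrib)
      show "?f x = c * cos ((\<Sum>j\<in>J. t j * x j) + d) * (c' * cos ((\<Sum>j\<in>J. t' j * x j) + d'))"
        unfolding e u_def[symmetric] u'_def[symmetric] cos_diff cos_add by (simp add: field_simps)
    qed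
    moreover have "trig_poly J ?f" by (intro trig_poly.intros)
    ultimately show ?case by simp
  next
    case (add f g)
    then show ?case by (simp add: distrib_left trig_poly.add)
  qed
next
  case (add f1 f2)
  then show ?case by (simp add: distrib_right trig_poly.add)
qed

lemma trig_poly_continuous: "trig_poly J f \<Longrightarrow> continuous_on UNIV f"
  by (induction rule: trig_poly.induct)
     (auto intro!: continuous_intros continuous_on_product_coordinates)

lemma trig_poly_bounded: "trig_poly J f \<Longrightarrow> \<exists>B. \<forall>x. \<bar>f x\<bar> \<le> B"
proof (induction rule: trig_poly.induct)
  case (cos c t d)
  have "\<bar>c * cos ((\<Sum>j\<in>J. t j * x j) + d)\<bar> \<le> \<bar>c\<bar> * 1" for x
    unfolding abs_mult by (intro mult_left_mono abs_cos_le_one) auto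
  then show ?case by blast
next
  case (add f g)
  then obtain B C where "\<forall>x. \<bar>f x\<bar> \<le> B" "\<forall>x. \<bar>g x\<bar> \<le> C" by blast
  then have "\<bar>f x + g x\<bar> \<le> B + C" for x by (meson abs_triangle_ineq add_mono order_trans)
  then show ?case by blast
qed

lemma trig_poly_compose_poly:
  assumes "real_polynomial_function q" "trig_poly J f"
  shows "trig_poly J (\<lambda>x. q (f x))"
  using assms(1)
proof (induction rule: real_polynomial_function.induct)
  case (linear h)
  interpret bounded_linear h by (rule linear)
  have "h y = h 1 * y" for y using scale[of y 1] by simp
  then have "(\<lambda>x. h (f x)) = (\<lambda>x. h 1 * f x)" by metis
  then show ?case using trig_poly_mult[OF trig_poly_const assms(2)] by simp
qed (auto intro: trig_poly_const trig_poly.add trig_poly_mult)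

text \<open>The frequency \<tau> is so small that both arguments lie in [-\<pi>/2, \<pi>/2], where
  sin is injective; the phase -\<pi>/2 turns the cosine into a sine.\<close>

lemma trig_poly_separates:
  assumes "finite J" "j \<in> J" "x j \<noteq> y j"
  shows "\<exists>f. trig_poly J f \<and> f x \<noteq> f y"
proof -
  define r where "r = \<bar>x j\<bar> + \<bar>y j\<bar> + 1"
  define \<tau> where "\<tau> = pi / (2 * r)"
  let ?f = "\<lambda>z. 1 * cos ((\<Sum>i\<in>J. (if i = j then \<tau> else 0) * z i) + (- pi / 2))"
  have f: "?f z = sin (\<tau> * z j)" for z
    using assms(1,2) by (simp add: if_distrib[of "\<lambda>c. c * _"] sum.delta' cos_diff cong: if_cong)
  have r: "r > 0" "\<bar>x j\<bar> \<le> r" "\<bar>y j\<bar> \<le> r" by (auto simp: r_def)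
  have b: "- (pi / 2) \<le> \<tau> * z" "\<tau> * z \<le> pi / 2" if "\<bar>z\<bar> \<le> r" for z
  proof -
    have "\<bar>\<tau> * z\<bar> \<le> \<tau> * r" unfolding abs_mult using that r(1) by (intro mult_mono) (auto simp: \<tau>_def)
    also have "\<tau> * r = pi / 2" using r(1) by (simp add: \<tau>_def)
    finally show "- (pi / 2) \<le> \<tau> * z" "\<tau> * z \<le> pi / 2" by linarith+
  qed
  have "\<tau> \<noteq> 0" using r(1) by (simp add: \<tau>_def)
  then have "sin (\<tau> * x j) \<noteq> sin (\<tau> * y j)"
    using sin_inj_pi[OF b(1,2)[OF r(2)] b(1,2)[OF r(3)]] assms(3) by auto
  moreover have "trig_poly J ?f" by (rule trig_poly.cos)
  ultimately show ?thesis using f by metis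
qed

text \<open>Coordinates outside \<open>J\<close> are frozen at 0, which makes the box a product of
  compact sets in the full function space.\<close>

lemma compact_box:
  "compact {x :: nat \<Rightarrow> real. (\<forall>j\<in>J. \<bar>x j\<bar> \<le> K) \<and> (\<forall>j. j \<notin> J \<longrightarrow> x j = 0)}"
proof -
  let ?B = "\<lambda>j. if j \<in> J then {- K..K} else {0 :: real}"
  have "compactin (product_topology (\<lambda>_::nat. euclideanreal) UNIV) (PiE UNIV ?B)"
    by (subst compactin_PiE) (auto simp: compactin_euclidean_iff)
  moreover have "PiE UNIV ?B = {x. (\<forall>j\<in>J. \<bar>x j\<bar> \<le> K) \<and> (\<forall>j. j \<notin> J \<longrightarrow> x j = 0)}"
    by (auto simp: PiE_iff abs_le_iff minus_le_iff split: if_splits)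
  ultimately show ?thesis by (simp add: euclidean_product_topology compactin_euclidean_iff)
qed

text \<open>The Stone-Weierstrass approximant on the box is not controlled outside; composing it with a polynomial
  that approximates the clamp to \<open>[-B, B]\<close> on its range makes it bounded everywhere.\<close>

lemma trig_poly_approx:
  assumes "finite J" "continuous_on UNIV F" "\<And>x. \<bar>F x\<bar> \<le> B" "e > 0"
  obtains h where "trig_poly J h" "\<And>x. \<bar>h x\<bar> \<le> B + e"
    "\<And>x. (\<forall>j\<in>J. \<bar>x j\<bar> \<le> K) \<Longrightarrow> (\<forall>j. j \<notin> J \<longrightarrow> x j = 0) \<Longrightarrow> \<bar>F x - h x\<bar> \<le> 2 * e"
proof -
  let ?S = "{x :: nat \<Rightarrow> real. (\<forall>j\<in>J. \<bar>x j\<bar> \<le> K) \<and> (\<forall>j. j \<notin> J \<longrightarrow> x j = 0)}"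
  have "\<exists>g. trig_poly J g \<and> (\<forall>x\<in>?S. \<bar>F x - g x\<bar> < e)"
  proof (rule Stone_Weierstrass_HOL)
    fix x y assume xy: "x \<in> ?S \<and> y \<in> ?S \<and> x \<noteq> y"
    then obtain j where "x j \<noteq> y j" by (metis ext)
    moreover from this have "j \<in> J" using xy by (metis (mono_tags, lifting) mem_Collect_eq)
    ultimately show "\<exists>f. trig_poly J f \<and> f x \<noteq> f y" using trig_poly_separates[OF assms(1)] by blast
  qed (use assms compact_box in \<open>auto intro: trig_poly_const trig_poly.add trig_poly_mult
        continuous_on_subset[OF trig_poly_continuous] continuous_on_subset[OF assms(2)]\<close>)
  then obtain g where g: "trig_poly J g" "\<And>x. x \<in> ?S \<Longrightarrow> \<bar>F x - g x\<bar> < e" by blast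
  obtain G where G: "\<And>x. \<bar>g x\<bar> \<le> G" using trig_poly_bounded[OF g(1)] by blast
  define clamp where "clamp y = max (- B) (min B y)" for y :: real
  have "continuous_on {- G..G} clamp" unfolding clamp_def by (intro continuous_intros)
  then obtain q where q: "real_polynomial_function q" "\<And>y. y \<in> {- G..G} \<Longrightarrow> \<bar>clamp y - q y\<bar> < e"
    using Stone_Weierstrass_real_polynomial_function[of "{- G..G}" clamp e] assms(4) by auto
  have B: "B \<ge> 0" using assms(3)[of undefined] by linarith
  have gq: "\<bar>clamp (g x) - q (g x)\<bar> < e" for x using q(2)[of "g x"] G[of x] by (auto simp: abs_le_iff)
  show ?thesis
  proof (rule that[of "\<lambda>x. q (g x)"])
    show "trig_poly J (\<lambda>x. q (g x))" by (rule trig_poly_compose_poly[OF q(1) g(1)])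
    show "\<bar>q (g x)\<bar> \<le> B + e" for x using gq[of x] B by (auto simp: clamp_def)
    show "\<bar>F x - q (g x)\<bar> \<le> 2 * e" if "\<forall>j\<in>J. \<bar>x j\<bar> \<le> K" "\<forall>j. j \<notin> J \<longrightarrow> x j = 0" for x
    proof -
      have "\<bar>F x - g x\<bar> < e" using g(2) that by simp
      \<comment> \<open>Clamping cannot move \<open>g x\<close> away from \<open>F x\<close>, which
        lies in [-B, B].\<close>
      then have "\<bar>F x - clamp (g x)\<bar> \<le> e" using assms(3)[of x] B by (auto simp: clamp_def)
      then show ?thesis using gq[of x] by linarith
    qed
  qed
qed

section \<open>From characteristic functions to bounded continuous functions\<close>

lemma integrable_iexp_rv:
  assumes "prob_space M" "f \<in> borel_measurable M"
  shows "integrable M (\<lambda>\<omega>. iexp (f \<omega>))"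
proof -
  interpret prob_space M by (rule assms(1))
  show ?thesis by (rule integrable_const_bound[of _ 1]) (use assms(2) in auto)
qed

text \<open>Convergence of characteristic functions gives convergence for trigonometric polynomials;
  these approximate \<open>F\<close> on a large box, and the second moments control what lies
  outside it.\<close>

lemma charfun_imp_weak_conv:
  fixes M :: "nat \<Rightarrow> 'a measure" and U :: "nat \<Rightarrow> nat \<Rightarrow> 'a \<Rightarrow> real" and V :: "nat \<Rightarrow> 'b \<Rightarrow> real"
    and F :: "(nat \<Rightarrow> real) \<Rightarrow> real"
  assumes prob: "\<And>n. prob_space (M n)" "prob_space N" and J: "finite J"
    and meas: "\<And>n j. j \<in> J \<Longrightarrow> U n j \<in> borel_measurable (M n)" "\<And>j. j \<in> J \<Longrightarrow> V j \<in> borel_measurable N"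
    and sq: "\<And>n j. j \<in> J \<Longrightarrow> integrable (M n) (\<lambda>\<omega>. (U n j \<omega>)\<^sup>2)" "\<And>j. j \<in> J \<Longrightarrow> integrable N (\<lambda>\<omega>. (V j \<omega>)\<^sup>2)"
    and sq_lim: "\<And>j. j \<in> J \<Longrightarrow> (\<lambda>n. \<integral>\<omega>. (U n j \<omega>)\<^sup>2 \<partial>M n) \<longlonglongrightarrow> v j"
    and char: "\<And>t. (\<lambda>n. \<integral>\<omega>. iexp (\<Sum>j\<in>J. t j * U n j \<omega>) \<partial>M n) \<longlonglongrightarrow> (\<integral>\<omega>. iexp (\<Sum>j\<in>J. t j * V j \<omega>) \<partial>N)"
    and F: "continuous_on UNIV F" "\<And>x. \<bar>F x\<bar> \<le> B"
  shows "(\<lambda>n. \<integral>\<omega>. F (\<lambda>j. if j \<in> J then U n j \<omega> else 0) \<partial>M n) \<longlonglongrightarrow> (\<integral>\<omega>. F (\<lambda>j. if j \<in> J then V j \<omega> else 0) \<partial>N)"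
proof -
  \<comment> \<open>Padding with 0 places all vectors in the one function space on which the
    approximation is formulated.\<close>
  define Ur where "Ur n \<omega> = (\<lambda>j. if j \<in> J then U n j \<omega> else 0)" for n \<omega>
  define Vr where "Vr \<omega> = (\<lambda>j. if j \<in> J then V j \<omega> else 0)" for \<omega>
  have B: "B \<ge> 0" using F(2)[of undefined] by linarith
  have cU: "(\<lambda>\<omega>. Ur n \<omega> i) \<in> borel_measurable (M n)" for n i
    using meas(1)[of i n] by (cases "i \<in> J") (simp_all add: Ur_def)
  have cV: "(\<lambda>\<omega>. Vr \<omega> i) \<in> borel_measurable N" for i
    using meas(2)[of i] by (cases "i \<in> J") (simp_all add: Vr_def)
  have mUr: "(\<lambda>\<omega>. f (Ur n \<omega>)) \<in> borel_measurable (M n)" if "continuous_on UNIV f" for f :: "_ \<Rightarrow> real" and n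
    by (rule measurable_compose[OF measurable_coordinatewise_then_product borel_measurable_continuous_onI[OF that]])
       (simp add: cU)
  have mVr: "(\<lambda>\<omega>. f (Vr \<omega>)) \<in> borel_measurable N" if "continuous_on UNIV f" for f :: "_ \<Rightarrow> real"
    by (rule measurable_compose[OF measurable_coordinatewise_then_product borel_measurable_continuous_onI[OF that]])
       (simp add: cV)
  have intU: "integrable (M n) (\<lambda>\<omega>. f (Ur n \<omega>))" if "continuous_on UNIV f" "\<And>x. \<bar>f x\<bar> \<le> C" for f :: "_ \<Rightarrow> real" and C n
  proof -
    interpret prob_space "M n" by (rule prob(1))
    show ?thesis by (rule integrable_const_bound[of _ C]) (use mUr that in auto)
  qed
  have intV: "integrable N (\<lambda>\<omega>. f (Vr \<omega>))" if "continuous_on UNIV f" "\<And>x. \<bar>f x\<bar> \<le> C" for f :: "_ \<Rightarrow> real" and C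
  proof -
    interpret prob_space N by (rule prob(2))
    show ?thesis by (rule integrable_const_bound[of _ C]) (use mVr that in auto)
  qed
  have trig: "(\<lambda>n. \<integral>\<omega>. h (Ur n \<omega>) \<partial>M n) \<longlonglongrightarrow> (\<integral>\<omega>. h (Vr \<omega>) \<partial>N)" if "trig_poly J h" for h
    using that
  proof (induction rule: trig_poly.induct)
    case (cos c t d)
    have re: "c * cos (y + d) = Re (complex_of_real c * iexp d * iexp y)" for y
      by (simp add: cos_add algebra_simps Re_exp Im_exp)
    have eU: "(\<integral>\<omega>. c * cos ((\<Sum>j\<in>J. t j * Ur n \<omega> j) + d) \<partial>M n) =
        Re (complex_of_real c * iexp d * (\<integral>\<omega>. iexp (\<Sum>j\<in>J. t j * U n j \<omega>) \<partial>M n))" for n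
    proof -
      interpret prob_space "M n" by (rule prob(1))
      have "(\<lambda>\<omega>. \<Sum>j\<in>J. t j * U n j \<omega>) \<in> borel_measurable (M n)" using meas(1) by auto
      then have i: "integrable (M n) (\<lambda>\<omega>. iexp (\<Sum>j\<in>J. t j * U n j \<omega>))"
        by (rule integrable_iexp_rv[OF prob(1)])
      have "(\<Sum>j\<in>J. t j * Ur n \<omega> j) = (\<Sum>j\<in>J. t j * U n j \<omega>)" for \<omega> by (simp add: Ur_def)
      then show ?thesis unfolding re using i by (simp del: Re_complex_of_real)
    qed
    have eV: "(\<integral>\<omega>. c * cos ((\<Sum>j\<in>J. t j * Vr \<omega> j) + d) \<partial>N) =
        Re (complex_of_real c * iexp d * (\<integral>\<omega>. iexp (\<Sum>j\<in>J. t j * V j \<omega>) \<partial>N))"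
    proof -
      interpret prob_space N by (rule prob(2))
      have "(\<lambda>\<omega>. \<Sum>j\<in>J. t j * V j \<omega>) \<in> borel_measurable N" using meas(2) by auto
      then have i: "integrable N (\<lambda>\<omega>. iexp (\<Sum>j\<in>J. t j * V j \<omega>))"
        by (rule integrable_iexp_rv[OF prob(2)])
      have "(\<Sum>j\<in>J. t j * Vr \<omega> j) = (\<Sum>j\<in>J. t j * V j \<omega>)" for \<omega> by (simp add: Vr_def)
      then show ?thesis unfolding re using i by (simp del: Re_complex_of_real)
    qed
    show ?case unfolding eU eV by (intro tendsto_Re tendsto_mult tendsto_const char)
  next
    case (add f g)
    obtain C where C: "\<And>x. \<bar>f x\<bar> \<le> C" using trig_poly_bounded[OF add(1)] by blast
    obtain D where D: "\<And>x. \<bar>g x\<bar> \<le> D" using trig_poly_bounded[OF add(2)] by blast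
    note c = trig_poly_continuous[OF add(1)] trig_poly_continuous[OF add(2)]
    have "(\<integral>\<omega>. f (Ur n \<omega>) + g (Ur n \<omega>) \<partial>M n) = (\<integral>\<omega>. f (Ur n \<omega>) \<partial>M n) + (\<integral>\<omega>. g (Ur n \<omega>) \<partial>M n)" for n
      by (rule Bochner_Integration.integral_add[OF intU[OF c(1) C] intU[OF c(2) D]])
    moreover have "(\<integral>\<omega>. f (Vr \<omega>) + g (Vr \<omega>) \<partial>N) = (\<integral>\<omega>. f (Vr \<omega>) \<partial>N) + (\<integral>\<omega>. g (Vr \<omega>) \<partial>N)"
      by (rule Bochner_Integration.integral_add[OF intV[OF c(1) C] intV[OF c(2) D]])
    ultimately show ?case using tendsto_add[OF add(3,4)] by simp
  qed
  \<comment> \<open>Bounds, for large n, the sum of the second moments of both vectors; the added 1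
    is the slack in their convergence.\<close>
  define W where "W = (\<Sum>j\<in>J. v j + 1) + (\<Sum>j\<in>J. \<integral>\<omega>. (V j \<omega>)\<^sup>2 \<partial>N)"
  show ?thesis unfolding Ur_def[symmetric] Vr_def[symmetric]
  proof (rule LIMSEQ_I)
    fix e :: real assume e: "e > 0"
    define \<epsilon> where "\<epsilon> = min 1 (e / 16)"
    have \<epsilon>: "\<epsilon> > 0" "\<epsilon> \<le> 1" "\<epsilon> \<le> e / 16" using e by (auto simp: \<epsilon>_def)
    \<comment> \<open>Chosen so that the tail bound (2 B + 1) W / K^2 is at most e / 8; the summand
      1 keeps K positive even if W is 0.\<close>
    define K where "K = sqrt (1 + 8 * (2 * B + 1) * \<bar>W\<bar> / e)"
    have "1 + 8 * (2 * B + 1) * \<bar>W\<bar> / e \<ge> 1" using B e by simp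
    then have K: "K > 0" "K\<^sup>2 = 1 + 8 * (2 * B + 1) * \<bar>W\<bar> / e"
      unfolding K_def by (simp, subst real_sqrt_pow2) auto
    have KW: "(2 * B + 1) * W / K\<^sup>2 \<le> e / 8"
    proof -
      have "(2 * B + 1) * W \<le> (2 * B + 1) * \<bar>W\<bar>" using B by (intro mult_left_mono) auto
      also have "\<dots> \<le> e / 8 * K\<^sup>2" using e unfolding K(2) by (simp add: field_simps)
      finally show ?thesis using K(1) by (simp add: divide_le_eq)
    qed
    obtain h where h: "trig_poly J h" "\<And>x. \<bar>h x\<bar> \<le> B + \<epsilon>"
      "\<And>x. (\<forall>j\<in>J. \<bar>x j\<bar> \<le> K) \<Longrightarrow> (\<forall>j. j \<notin> J \<longrightarrow> x j = 0) \<Longrightarrow> \<bar>F x - h x\<bar> \<le> 2 * \<epsilon>"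
      using trig_poly_approx[OF J F \<epsilon>(1)] by metis
    note hc = trig_poly_continuous[OF h(1)]
    \<comment> \<open>Outside the box some squared coordinate exceeds K^2, so the last term is at
      least 2 B + 1 and covers the trivial bound 2 B + \<epsilon>.\<close>
    have pw: "\<bar>F x - h x\<bar> \<le> 2 * \<epsilon> + (2 * B + 1) / K\<^sup>2 * (\<Sum>j\<in>J. (x j)\<^sup>2)" if "\<forall>j. j \<notin> J \<longrightarrow> x j = 0" for x
    proof (cases "\<forall>j\<in>J. \<bar>x j\<bar> \<le> K")
      case True
      have "0 \<le> (2 * B + 1) / K\<^sup>2 * (\<Sum>j\<in>J. (x j)\<^sup>2)" using B by (intro mult_nonneg_nonneg sum_nonneg) auto
      then show ?thesis using h(3)[OF True that] by linarith
    next
      case False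
      then obtain j where j: "j \<in> J" "\<bar>x j\<bar> > K" by auto
      have "K\<^sup>2 \<le> (x j)\<^sup>2" using j(2) K(1) by (metis abs_le_square_iff abs_of_pos less_imp_le)
      also have "\<dots> \<le> (\<Sum>j\<in>J. (x j)\<^sup>2)" using J j(1) by (intro member_le_sum) auto
      finally have "(2 * B + 1) * 1 \<le> (2 * B + 1) * ((\<Sum>j\<in>J. (x j)\<^sup>2) / K\<^sup>2)"
        using B K(1) by (intro mult_left_mono) (auto simp: le_divide_eq)
      then have "2 * B + 1 \<le> (2 * B + 1) / K\<^sup>2 * (\<Sum>j\<in>J. (x j)\<^sup>2)" by simp
      moreover have "\<bar>F x - h x\<bar> \<le> 2 * B + \<epsilon>" using F(2)[of x] h(2)[of x] by linarith
      ultimately show ?thesis using \<epsilon> by linarith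
    qed
    have estU: "\<bar>(\<integral>\<omega>. F (Ur n \<omega>) \<partial>M n) - (\<integral>\<omega>. h (Ur n \<omega>) \<partial>M n)\<bar> \<le>
        2 * \<epsilon> + (2 * B + 1) / K\<^sup>2 * (\<Sum>j\<in>J. \<integral>\<omega>. (U n j \<omega>)\<^sup>2 \<partial>M n)" for n
    proof -
      interpret prob_space "M n" by (rule prob(1))
      note i = intU[OF F] intU[OF hc h(2)]
      have "\<bar>(\<integral>\<omega>. F (Ur n \<omega>) \<partial>M n) - (\<integral>\<omega>. h (Ur n \<omega>) \<partial>M n)\<bar> = \<bar>\<integral>\<omega>. F (Ur n \<omega>) - h (Ur n \<omega>) \<partial>M n\<bar>"
        using i by simp
      also have "\<dots> \<le> (\<integral>\<omega>. \<bar>F (Ur n \<omega>) - h (Ur n \<omega>)\<bar> \<partial>M n)" by (rule integral_abs_bound)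
      also have "\<dots> \<le> (\<integral>\<omega>. 2 * \<epsilon> + (2 * B + 1) / K\<^sup>2 * (\<Sum>j\<in>J. (U n j \<omega>)\<^sup>2) \<partial>M n)"
      proof (rule integral_mono)
        fix \<omega>
        show "\<bar>F (Ur n \<omega>) - h (Ur n \<omega>)\<bar> \<le> 2 * \<epsilon> + (2 * B + 1) / K\<^sup>2 * (\<Sum>j\<in>J. (U n j \<omega>)\<^sup>2)"
          using pw[of "Ur n \<omega>"] by (simp add: Ur_def)
      qed (use i sq(1) in auto)
      also have "\<dots> = 2 * \<epsilon> + (2 * B + 1) / K\<^sup>2 * (\<Sum>j\<in>J. \<integral>\<omega>. (U n j \<omega>)\<^sup>2 \<partial>M n)"
        using sq(1) by (simp add: prob_space)
      finally show ?thesis .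
    qed
    have estV: "\<bar>(\<integral>\<omega>. F (Vr \<omega>) \<partial>N) - (\<integral>\<omega>. h (Vr \<omega>) \<partial>N)\<bar> \<le>
        2 * \<epsilon> + (2 * B + 1) / K\<^sup>2 * (\<Sum>j\<in>J. \<integral>\<omega>. (V j \<omega>)\<^sup>2 \<partial>N)"
    proof -
      interpret prob_space N by (rule prob(2))
      note i = intV[OF F] intV[OF hc h(2)]
      have "\<bar>(\<integral>\<omega>. F (Vr \<omega>) \<partial>N) - (\<integral>\<omega>. h (Vr \<omega>) \<partial>N)\<bar> = \<bar>\<integral>\<omega>. F (Vr \<omega>) - h (Vr \<omega>) \<partial>N\<bar>"
        using i by simp
      also have "\<dots> \<le> (\<integral>\<omega>. \<bar>F (Vr \<omega>) - h (Vr \<omega>)\<bar> \<partial>N)" by (rule integral_abs_bound)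
      also have "\<dots> \<le> (\<integral>\<omega>. 2 * \<epsilon> + (2 * B + 1) / K\<^sup>2 * (\<Sum>j\<in>J. (V j \<omega>)\<^sup>2) \<partial>N)"
      proof (rule integral_mono)
        fix \<omega>
        show "\<bar>F (Vr \<omega>) - h (Vr \<omega>)\<bar> \<le> 2 * \<epsilon> + (2 * B + 1) / K\<^sup>2 * (\<Sum>j\<in>J. (V j \<omega>)\<^sup>2)"
          using pw[of "Vr \<omega>"] by (simp add: Vr_def)
      qed (use i sq(2) in auto)
      also have "\<dots> = 2 * \<epsilon> + (2 * B + 1) / K\<^sup>2 * (\<Sum>j\<in>J. \<integral>\<omega>. (V j \<omega>)\<^sup>2 \<partial>N)"
        using sq(2) by (simp add: prob_space)
      finally show ?thesis .
    qed
    have "\<forall>\<^sub>F n in sequentially. \<forall>j\<in>J. (\<integral>\<omega>. (U n j \<omega>)\<^sup>2 \<partial>M n) < v j + 1"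
      using J sq_lim by (intro eventually_ball_finite ballI order_tendstoD) auto
    moreover have "\<forall>\<^sub>F n in sequentially. dist (\<integral>\<omega>. h (Ur n \<omega>) \<partial>M n) (\<integral>\<omega>. h (Vr \<omega>) \<partial>N) < e / 4"
      by (rule tendstoD[OF trig[OF h(1)]]) (use e in simp)
    ultimately have "\<forall>\<^sub>F n in sequentially. norm ((\<integral>\<omega>. F (Ur n \<omega>) \<partial>M n) - (\<integral>\<omega>. F (Vr \<omega>) \<partial>N)) < e"
    proof eventually_elim
      case (elim n)
      have "(\<Sum>j\<in>J. \<integral>\<omega>. (U n j \<omega>)\<^sup>2 \<partial>M n) \<le> (\<Sum>j\<in>J. v j + 1)"
        using elim(1) by (intro sum_mono) (auto intro: less_imp_le)
      then have "(\<Sum>j\<in>J. \<integral>\<omega>. (U n j \<omega>)\<^sup>2 \<partial>M n) + (\<Sum>j\<in>J. \<integral>\<omega>. (V j \<omega>)\<^sup>2 \<partial>N) \<le> W" by (simp add: W_def)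
      then have "(2 * B + 1) / K\<^sup>2 * ((\<Sum>j\<in>J. \<integral>\<omega>. (U n j \<omega>)\<^sup>2 \<partial>M n) + (\<Sum>j\<in>J. \<integral>\<omega>. (V j \<omega>)\<^sup>2 \<partial>N)) \<le>
          (2 * B + 1) / K\<^sup>2 * W" using B by (intro mult_left_mono) auto
      also have "\<dots> \<le> e / 8" using KW by simp
      finally have "(2 * B + 1) / K\<^sup>2 * (\<Sum>j\<in>J. \<integral>\<omega>. (U n j \<omega>)\<^sup>2 \<partial>M n) +
          (2 * B + 1) / K\<^sup>2 * (\<Sum>j\<in>J. \<integral>\<omega>. (V j \<omega>)\<^sup>2 \<partial>N) \<le> e / 8" by (simp only: distrib_left)
      \<comment> \<open>The two approximations cost 4 \<epsilon>, at most e / 4; the tails cost e /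
        8 and the trigonometric polynomial e / 4.\<close>
      then show ?case using estU[of n] estV elim(2) \<epsilon>(3) e unfolding dist_real_def real_norm_def by linarith
    qed
    then show "\<exists>no. \<forall>n\<ge>no. norm ((\<integral>\<omega>. F (Ur n \<omega>) \<partial>M n) - (\<integral>\<omega>. F (Vr \<omega>) \<partial>N)) < e"
      unfolding eventually_sequentially .
  qed
qed

section \<open>The limit theorem\<close>

fun gaussian_moment :: "real \<Rightarrow> nat \<Rightarrow> real" where
  "gaussian_moment v 0 = 1"
| "gaussian_moment v (Suc 0) = 0"
| "gaussian_moment v (Suc (Suc k)) = real (Suc k) * v * gaussian_moment v k"

section \<open>Centred traces and the limit of their characteristic functions\<close>

context wigner
begin

definition stat :: "nat \<Rightarrow> nat \<Rightarrow> 'a \<Rightarrow> complex" where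
  "stat n m \<omega> = complex_of_real ((1 / sqrt (real n)) ^ m) * (\<Sum>p\<in>walks n m. xi n p \<omega>)"

lemma sum_walk_family:
  assumes "finite J"
  shows "(\<Sum>p\<in>walk_family n J. f p) = (\<Sum>m\<in>J. \<Sum>p\<in>walks n m. f p)"
  unfolding walk_family_def
proof (rule sum.UNION_disjoint[OF assms])
  show "\<forall>m\<in>J. finite (walks n m)" by simp
qed (auto simp: tuples_def)

lemma lin_stat_eq:
  assumes "finite J"
  shows "lin_stat J t n \<omega> = (\<Sum>m\<in>J. complex_of_real (t m) * stat n m \<omega>)"
  unfolding lin_stat_def sum_walk_family[OF assms] stat_def sum_distrib_left
  by (intro sum.cong refl) (auto simp: wt_def tuples_def)

lemma trace_centered_eq_stat:
  assumes "n > 0" "m \<ge> 2" "\<omega> \<in> space (M n)"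
  shows "trace_mat (poly_mat (cheb_scaled m s) (wigner_mat n (\<lambda>p q. a n p q \<omega>)))
        - (\<integral>\<omega>'. trace_mat (poly_mat (cheb_scaled m s) (wigner_mat n (\<lambda>p q. a n p q \<omega>'))) \<partial>M n) = stat n m \<omega>"
proof -
  have s: "s \<noteq> 0" using s_pos by auto
  let ?c = "complex_of_real ((1 / sqrt (real n)) ^ m)"
  have tr: "trace_mat (poly_mat (cheb_scaled m s) (wigner_mat n (\<lambda>p q. a n p q \<omega>))) = ?c * (\<Sum>p\<in>walks n m. cw n p \<omega>)" for \<omega>
    unfolding trace_cheb_scaled[OF assms(2,1) s] cw_def by (simp add: power_divide)
  have "integrable (M n) (cw n p)" if "p \<in> walks n m" for p
    using that assms(2) by (intro dep_integrable[OF dep_cw]) (auto simp: is_walk_def tuples_def)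
  then have "(\<integral>\<omega>'. ?c * (\<Sum>p\<in>walks n m. cw n p \<omega>') \<partial>M n) = ?c * (\<Sum>p\<in>walks n m. \<integral>\<omega>'. cw n p \<omega>' \<partial>M n)"
    by (simp add: Bochner_Integration.integral_sum)
  then show ?thesis unfolding tr stat_def xi_def sum_subtractf right_diff_distrib by simp
qed

text \<open>Reversal permutes the closed walks and conjugates their weights.\<close>

lemma stat_real:
  assumes "m \<ge> 2" "\<omega> \<in> space (M n)"
  shows "stat n m \<omega> = complex_of_real (Re (stat n m \<omega>))"
proof -
  have "cnj (\<Sum>p\<in>walks n m. xi n p \<omega>) = (\<Sum>p\<in>walks n m. xi n (rev p) \<omega>)"
  proof -
    have "cnj (xi n p \<omega>) = xi n (rev p) \<omega>" if "p \<in> walks n m" for p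
    proof -
      have w: "is_walk n p" using that assms(1) by (auto simp: is_walk_def tuples_def)
      have "(\<integral>\<omega>. cw n (rev p) \<omega> \<partial>M n) = (\<integral>\<omega>. cnj (cw n p \<omega>) \<partial>M n)"
        using cw_rev[OF w] by (intro Bochner_Integration.integral_cong) auto
      then show ?thesis by (simp add: xi_def cw_rev[OF w assms(2)])
    qed
    then show ?thesis by simp
  qed
  also have "\<dots> = (\<Sum>p\<in>walks n m. xi n p \<omega>)"
    by (rule sum.reindex_bij_witness[of _ rev rev]) (auto simp: tuples_def)
  finally have "cnj (stat n m \<omega>) = stat n m \<omega>" by (simp add: stat_def)
  then show ?thesis by (metis Reals_cnj_iff of_real_Re)
qed

lemma lin_stat_real:
  assumes "finite J" "J \<subseteq> {2..}" "\<omega> \<in> space (M n)"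
  shows "lin_stat J t n \<omega> = complex_of_real (\<Sum>m\<in>J. t m * Re (stat n m \<omega>))"
proof -
  have eq: "complex_of_real (t m) * stat n m \<omega> = complex_of_real (t m * Re (stat n m \<omega>))" if "m \<in> J" for m
    using stat_real[of m \<omega> n] that assms(2,3) by (auto simp: subset_iff)
  show ?thesis unfolding lin_stat_eq[OF assms(1)] of_real_sum by (intro sum.cong refl eq)
qed

lemma integral_lin_stat_sq:
  assumes "finite J" "J \<subseteq> {2..}"
  shows "(\<integral>\<omega>. (lin_stat J t n \<omega>)\<^sup>2 \<partial>M n) = (\<Sum>m\<in>J. \<Sum>m'\<in>J. complex_of_real (t m * t m') * cov m m' n)"
proof -
  have "(\<integral>\<omega>. (lin_stat J t n \<omega>)\<^sup>2 \<partial>M n) =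
     (\<Sum>m\<in>J. \<Sum>p\<in>walks n m. \<Sum>m'\<in>J. \<Sum>q\<in>walks n m'. wt t n p * wt t n q * mom n [p, q])"
    unfolding integral_lin_stat_power[OF assms] numeral_2_eq_2 sum_tuples_Suc sum_walk_family[OF assms(1)]
    by (simp add: mult_ac)
  also have "\<dots> = (\<Sum>m\<in>J. \<Sum>m'\<in>J. \<Sum>p\<in>walks n m. \<Sum>q\<in>walks n m'. wt t n p * wt t n q * mom n [p, q])"
    by (intro sum.cong refl sum.swap)
  also have "\<dots> = (\<Sum>m\<in>J. \<Sum>m'\<in>J. complex_of_real (t m * t m') * cov m m' n)"
    unfolding cov_def sum_distrib_left
    by (intro sum.cong refl) (auto simp: wt_def tuples_def power_add)
  finally show ?thesis .
qed

lemma integral_lin_stat_sq_tendsto: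
  assumes "finite J" "J \<subseteq> {2..}"
  shows "(\<lambda>n. \<integral>\<omega>. (lin_stat J t n \<omega>)\<^sup>2 \<partial>M n) \<longlonglongrightarrow> (\<Sum>m\<in>J. complex_of_real ((t m)\<^sup>2) * cov_limit m)"
proof -
  have "(\<lambda>n. \<Sum>m\<in>J. \<Sum>m'\<in>J. complex_of_real (t m * t m') * cov m m' n) \<longlonglongrightarrow>
     (\<Sum>m\<in>J. \<Sum>m'\<in>J. complex_of_real (t m * t m') * (if m = m' then cov_limit m else 0))"
  proof (intro tendsto_sum tendsto_mult tendsto_const)
    fix m m' assume "m \<in> J" "m' \<in> J"
    then have "m \<ge> 2" "m' \<ge> 2" using assms(2) by auto
    then show "(\<lambda>n. cov m m' n) \<longlonglongrightarrow> (if m = m' then cov_limit m else 0)"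
      using cov_same_tendsto[of m] cov_distinct_tendsto[of m m'] by auto
  qed
  also have "(\<Sum>m\<in>J. \<Sum>m'\<in>J. complex_of_real (t m * t m') * (if m = m' then cov_limit m else 0)) =
     (\<Sum>m\<in>J. complex_of_real ((t m)\<^sup>2) * cov_limit m)"
  proof (rule sum.cong[OF refl])
    fix m assume "m \<in> J"
    have "(\<Sum>m'\<in>J. complex_of_real (t m * t m') * (if m = m' then cov_limit m else 0)) =
       (\<Sum>m'\<in>J. if m = m' then complex_of_real (t m * t m) * cov_limit m else 0)"
      by (intro sum.cong) auto
    then show "(\<Sum>m'\<in>J. complex_of_real (t m * t m') * (if m = m' then cov_limit m else 0)) =
       complex_of_real ((t m)\<^sup>2) * cov_limit m"
      using \<open>m \<in> J\<close> assms(1) by (simp add: power2_eq_square)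
  qed
  finally show ?thesis by (simp only: integral_lin_stat_sq[OF assms])
qed

lemma dep_stat: "m \<ge> 2 \<Longrightarrow> dep n UNIV (stat n m)"
  unfolding stat_def
  by (intro dep_mult dep_const dep_sum dep_mono[OF dep_xi]) (auto simp: is_walk_def tuples_def)

lemma integrable_Re_stat_power:
  assumes "finite J" "J \<subseteq> {2..}"
  shows "integrable (M n) (\<lambda>\<omega>. (\<Sum>m\<in>J. t m * Re (stat n m \<omega>)) ^ k)"
    and "complex_of_real (\<integral>\<omega>. (\<Sum>m\<in>J. t m * Re (stat n m \<omega>)) ^ k \<partial>M n) = (\<integral>\<omega>. lin_stat J t n \<omega> ^ k \<partial>M n)"
proof -
  have eq: "complex_of_real ((\<Sum>m\<in>J. t m * Re (stat n m \<omega>)) ^ k) = lin_stat J t n \<omega> ^ k" if "\<omega> \<in> space (M n)" for \<omega>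
    using lin_stat_real[OF assms that] by simp
  have "integrable (M n) (\<lambda>\<omega>. lin_stat J t n \<omega> ^ k)"
    by (rule dep_integrable[OF dep_power[OF dep_lin_stat[OF assms(2)]]])
  then have "integrable (M n) (\<lambda>\<omega>. complex_of_real ((\<Sum>m\<in>J. t m * Re (stat n m \<omega>)) ^ k))"
    by (subst Bochner_Integration.integrable_cong[OF refl eq])
  then show "integrable (M n) (\<lambda>\<omega>. (\<Sum>m\<in>J. t m * Re (stat n m \<omega>)) ^ k)"
    unfolding complex_of_real_integrable_eq .
  show "complex_of_real (\<integral>\<omega>. (\<Sum>m\<in>J. t m * Re (stat n m \<omega>)) ^ k \<partial>M n) = (\<integral>\<omega>. lin_stat J t n \<omega> ^ k \<partial>M n)"
    unfolding integral_complex_of_real[symmetric] using eq by (intro Bochner_Integration.integral_cong) auto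
qed

text \<open>The formula with pseudo-variances does not reveal it, but the value is a limit of second
  moments of real variables.\<close>

lemma cov_limit_nonneg:
  assumes "m \<ge> 2"
  shows "cov_limit m = complex_of_real (Re (cov_limit m))" "Re (cov_limit m) \<ge> 0"
proof -
  have J: "finite {m}" "{m} \<subseteq> {2..}" using assms by auto
  have lim: "(\<lambda>n. \<integral>\<omega>. (lin_stat {m} (\<lambda>_. 1) n \<omega>)\<^sup>2 \<partial>M n) \<longlonglongrightarrow> cov_limit m"
    using integral_lin_stat_sq_tendsto[OF J, of "\<lambda>_. 1"] by simp
  have "(\<integral>\<omega>. (lin_stat {m} (\<lambda>_. 1) n \<omega>)\<^sup>2 \<partial>M n) \<in> \<real>\<^sub>\<ge>\<^sub>0" for n
    unfolding integrable_Re_stat_power(2)[OF J, of n, symmetric] by simp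
  then have "cov_limit m \<in> \<real>\<^sub>\<ge>\<^sub>0"
    by (intro Lim_in_closed_set[OF closed_nonneg_Reals_complex _ _ lim]) auto
  then show "cov_limit m = complex_of_real (Re (cov_limit m))" "Re (cov_limit m) \<ge> 0"
    by (auto simp: complex_nonneg_Reals_iff complex_eq_iff)
qed

lemma charfun_stat_tendsto:
  assumes J: "finite J" "J \<subseteq> {2..}"
  shows "(\<lambda>n. \<integral>\<omega>. iexp (\<Sum>m\<in>J. t m * Re (stat n m \<omega>)) \<partial>M n) \<longlonglongrightarrow>
     complex_of_real (exp (- (\<Sum>m\<in>J. (t m)\<^sup>2 * Re (cov_limit m)) / 2))"
proof -
  define v where "v = (\<Sum>m\<in>J. (t m)\<^sup>2 * Re (cov_limit m))"
  have v: "v \<ge> 0" unfolding v_def using cov_limit_nonneg(2) J(2) by (intro sum_nonneg mult_nonneg_nonneg) auto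
  let ?X = "\<lambda>n \<omega>. \<Sum>m\<in>J. t m * Re (stat n m \<omega>)"
  have var: "(\<lambda>n. \<integral>\<omega>. lin_stat J t n \<omega> ^ 2 \<partial>M n) \<longlonglongrightarrow> complex_of_real v"
  proof -
    have e: "complex_of_real ((t m)\<^sup>2) * cov_limit m = complex_of_real ((t m)\<^sup>2 * Re (cov_limit m))" if "m \<in> J" for m
      using cov_limit_nonneg(1)[of m] that J(2) by (auto simp: subset_iff)
    have "(\<Sum>m\<in>J. complex_of_real ((t m)\<^sup>2) * cov_limit m) = complex_of_real v"
      unfolding v_def of_real_sum by (intro sum.cong refl e)
    then show ?thesis using integral_lin_stat_sq_tendsto[OF J, of t] by simp
  qed
  have mom_lim: "(\<lambda>n. \<integral>\<omega>. lin_stat J t n \<omega> ^ k \<partial>M n) \<longlonglongrightarrow> complex_of_real (gaussian_moment v k)" for k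
  proof (induction k rule: induct_nat_012)
    case 0
    have "(\<integral>\<omega>. lin_stat J t n \<omega> ^ 0 \<partial>M n) = 1" for n
    proof -
      interpret prob_space "M n" by (rule prob)
      show ?thesis by (simp add: prob_space)
    qed
    then show ?case by simp
  next
    case 1
    have "(\<integral>\<omega>. lin_stat J t n \<omega> ^ Suc 0 \<partial>M n) = 0" for n
      unfolding integral_lin_stat_power[OF J] sum_tuples_Suc
      using integral_xi walk_family_is_walk[OF J(2)] by (simp add: mom_def)
    then show ?case by simp
  next
    case (ge2 k)
    obtain C where C: "\<And>n. n > 0 \<Longrightarrow> cmod ((\<integral>\<omega>. lin_stat J t n \<omega> ^ Suc (Suc k) \<partial>M n) -
       of_nat (Suc k) * (\<integral>\<omega>. lin_stat J t n \<omega> ^ 2 \<partial>M n) * (\<integral>\<omega>. lin_stat J t n \<omega> ^ k \<partial>M n)) \<le> C / sqrt (real n)"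
      using moment_recursion[OF J] by metis
    have "(\<lambda>n. (\<integral>\<omega>. lin_stat J t n \<omega> ^ Suc (Suc k) \<partial>M n) -
       of_nat (Suc k) * (\<integral>\<omega>. lin_stat J t n \<omega> ^ 2 \<partial>M n) * (\<integral>\<omega>. lin_stat J t n \<omega> ^ k \<partial>M n)) \<longlonglongrightarrow> 0"
    proof (rule Lim_null_comparison)
      show "(\<lambda>n. C / sqrt (real n)) \<longlonglongrightarrow> 0" by real_asymp
    qed (rule eventually_sequentiallyI[of 1], use C in auto)
    moreover have "(\<lambda>n. of_nat (Suc k) * (\<integral>\<omega>. lin_stat J t n \<omega> ^ 2 \<partial>M n) * (\<integral>\<omega>. lin_stat J t n \<omega> ^ k \<partial>M n))
        \<longlonglongrightarrow> of_nat (Suc k) * complex_of_real v * complex_of_real (gaussian_moment v k)"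
      by (intro tendsto_mult tendsto_const var ge2(1))
    ultimately have "(\<lambda>n. \<integral>\<omega>. lin_stat J t n \<omega> ^ Suc (Suc k) \<partial>M n) \<longlonglongrightarrow>
        0 + of_nat (Suc k) * complex_of_real v * complex_of_real (gaussian_moment v k)"
      using tendsto_add by fastforce
    then show ?case by simp
  qed
  have "(\<lambda>n. \<integral>\<omega>. iexp (?X n \<omega>) \<partial>M n) \<longlonglongrightarrow> complex_of_real (exp (- v / 2))"
  proof (rule gaussian_charfun_limit[where g = "gaussian_moment v"])
    show "?X n \<in> borel_measurable (M n)" for n
    proof (intro borel_measurable_sum borel_measurable_times borel_measurable_const)
      fix m assume "m \<in> J"
      then have "stat n m \<in> borel_measurable (M n)" using dep_measurable[OF dep_stat] J(2) by auto
      then show "(\<lambda>\<omega>. Re (stat n m \<omega>)) \<in> borel_measurable (M n)" by simp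
    qed
    show "(\<lambda>n. \<integral>\<omega>. ?X n \<omega> ^ k \<partial>M n) \<longlonglongrightarrow> gaussian_moment v k" for k
      using mom_lim[of k] unfolding integrable_Re_stat_power(2)[OF J, symmetric] tendsto_of_real_iff .
  qed (use prob v integrable_Re_stat_power(1)[OF J] in auto)
  then show ?thesis by (simp add: v_def)
qed

end

text \<open>Each k is grouped with m - k; for even m the middle index is its own partner and must
  not be doubled.\<close>

lemma sum_half_range:
  fixes f :: "nat \<Rightarrow> complex"
  shows "(\<Sum>k=1..m - 1. f k) = (\<Sum>k=1..m div 2. f k + of_bool (2 * k \<noteq> m) * f (m - k))"
proof (cases "m \<ge> 2")
  case True
  have "{1..m - 1} = {1..m div 2} \<union> {m div 2 + 1..m - 1}" using True by auto
  then have "(\<Sum>k=1..m - 1. f k) = (\<Sum>k=1..m div 2. f k) + (\<Sum>k=m div 2 + 1..m - 1. f k)"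
    by (simp add: sum.union_disjoint)
  also have "(\<Sum>k=m div 2 + 1..m - 1. f k) = (\<Sum>k | k \<in> {1..m div 2} \<and> 2 * k \<noteq> m. f (m - k))"
    by (rule sum.reindex_bij_witness[of _ "\<lambda>k. m - k" "\<lambda>k. m - k"]) auto
  also have "\<dots> = (\<Sum>k=1..m div 2. of_bool (2 * k \<noteq> m) * f (m - k))"
    by (rule sum.mono_neutral_cong_left) auto
  finally show ?thesis by (simp add: sum.distrib)
next
  case False
  then have "m div 2 = 0" "m - 1 = 0" by auto
  then show ?thesis by simp
qed

text \<open>One infinite product carries all the limit variables. Scaling a standard normal
  coordinate by sqrt (v m) also covers variance 0, where the variable vanishes.\<close>

lemma std_normal_product:
  fixes v :: "nat \<Rightarrow> real"
  assumes v: "\<And>m. v m \<ge> 0"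
    and N_def: "N = PiM (UNIV :: nat set) (\<lambda>_. std_normal_distribution)"
    and Y_def: "Y = (\<lambda>m \<omega>. sqrt (v m) * (\<omega> m :: real))"
  shows "prob_space N"
    and "prob_space.indep_vars N (\<lambda>_. borel) Y S"
    and "centered_gaussian N (Y m)"
    and "(\<integral>\<omega>. Y m \<omega> ^ 2 \<partial>N) = v m" and "integrable N (\<lambda>\<omega>. Y m \<omega> ^ 2)"
    and "finite J \<Longrightarrow> (\<integral>\<omega>. iexp (\<Sum>m\<in>J. t m * Y m \<omega>) \<partial>N) = complex_of_real (exp (- (\<Sum>m\<in>J. (t m)\<^sup>2 * v m) / 2))"
proof -
  let ?D = "std_normal_distribution"
  have D: "prob_space ?D" using real_dist_normal_dist by (simp add: real_distribution_def)
  show N: "prob_space N" unfolding N_def by (intro prob_space_PiM D)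
  interpret prob_space N by (rule N)
  have setsN: "sets N = sets (PiM UNIV (\<lambda>_. borel))" unfolding N_def by (intro sets_PiM_cong) auto
  have coord [measurable]: "(\<lambda>\<omega>. \<omega> i) \<in> borel_measurable N" for i
  proof -
    have "(\<lambda>\<omega>. \<omega> i) \<in> borel_measurable (PiM UNIV (\<lambda>_. borel))"
      by (rule measurable_component_singleton) simp
    then show ?thesis unfolding measurable_cong_sets[OF setsN refl] .
  qed
  have distr: "distr N borel (\<lambda>\<omega>. \<omega> i) = ?D" for i
  proof -
    have "distr N borel (\<lambda>\<omega>. \<omega> i) = distr N ?D (\<lambda>\<omega>. \<omega> i)" by (rule distr_cong) auto
    also have "\<dots> = ?D" unfolding N_def using distr_PiM_component[of UNIV "\<lambda>_. ?D" i] D by simp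
    finally show ?thesis .
  qed
  have int: "(\<integral>\<omega>. f (\<omega> i) \<partial>N) = (\<integral>x. f x \<partial>?D)" if "f \<in> borel_measurable borel" for f :: "real \<Rightarrow> 'c::{banach, second_countable_topology}" and i
    unfolding distr[of i, symmetric] by (rule integral_distr[OF coord that, symmetric])
  have "indep_vars (\<lambda>_. borel) (\<lambda>i \<omega>. \<omega> i) UNIV"
  proof (subst indep_vars_iff_distr_eq_PiM')
    have "distr N (PiM UNIV (\<lambda>_. borel)) (\<lambda>x. \<lambda>i\<in>UNIV. x i) = distr N (PiM UNIV (\<lambda>_. borel)) (\<lambda>x. x)"
      by (simp add: restrict_def)
    also have "\<dots> = N" using setsN by (intro distr_id2) simp
    also have "\<dots> = (\<Pi>\<^sub>M i\<in>UNIV. distr N borel (\<lambda>\<omega>. \<omega> i))" unfolding distr by (simp only: N_def)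
    finally show "distr N (PiM UNIV (\<lambda>_. borel)) (\<lambda>x. \<lambda>i\<in>UNIV. x i) = (\<Pi>\<^sub>M i\<in>UNIV. distr N borel (\<lambda>\<omega>. \<omega> i))" .
  qed (use coord in auto)
  then have ind: "indep_vars (\<lambda>_. borel) (\<lambda>i \<omega>. \<omega> i) S" for S by (rule indep_vars_subset) simp
  show "indep_vars (\<lambda>_. borel) Y S"
    unfolding Y_def by (rule indep_vars_compose2[OF ind[of S], where Y = "\<lambda>m x. sqrt (v m) * x"]) simp
  have Y [measurable]: "Y m \<in> borel_measurable N" for m unfolding Y_def by measurable
  show "centered_gaussian N (Y m)" unfolding centered_gaussian_def
  proof (intro conjI Y)
    show "(AE \<omega> in N. Y m \<omega> = 0) \<or> (\<exists>\<sigma>>0. distributed N lborel (Y m) (\<lambda>x. ennreal (normal_density 0 \<sigma> x)))"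
    proof (cases "v m = 0")
      case True
      then show ?thesis by (simp add: Y_def)
    next
      case False
      then have pos: "sqrt (v m) > 0" using v[of m] by simp
      have "distributed N lborel (\<lambda>\<omega>. \<omega> m) (\<lambda>x. ennreal (std_normal_density x))"
      proof -
        have "distr N lborel (\<lambda>\<omega>. \<omega> m) = distr N borel (\<lambda>\<omega>. \<omega> m)" by (rule distr_cong) auto
        then show ?thesis unfolding distributed_def using distr[of m] coord[of m] by simp
      qed
      moreover have "(\<lambda>\<omega>. (Y m \<omega> - 0) / sqrt (v m)) = (\<lambda>\<omega>. \<omega> m)" using pos by (simp add: Y_def)
      ultimately have "distributed N lborel (Y m) (\<lambda>x. ennreal (normal_density 0 (sqrt (v m)) x))"
        using normal_standard_normal_convert[OF pos, of "Y m" 0] by simp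
      then show ?thesis using pos by blast
    qed
  qed
  show "(\<integral>\<omega>. Y m \<omega> ^ 2 \<partial>N) = v m"
  proof -
    have "(\<integral>\<omega>. Y m \<omega> ^ 2 \<partial>N) = v m * (\<integral>\<omega>. (\<omega> m)\<^sup>2 \<partial>N)" using v[of m] by (simp add: Y_def power_mult_distrib)
    also have "(\<integral>\<omega>. (\<omega> m)\<^sup>2 \<partial>N) = (\<integral>x. x\<^sup>2 \<partial>?D)" by (rule int) simp
    also have "\<dots> = 1" using std_normal_distribution_even_moments(1)[of 1] by simp
    finally show ?thesis by simp
  qed
  show "integrable N (\<lambda>\<omega>. Y m \<omega> ^ 2)"
  proof -
    have "integrable (distr N borel (\<lambda>\<omega>. \<omega> m)) (\<lambda>x. x\<^sup>2)"
      unfolding distr by (rule integrable_std_normal_distribution_moment)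
    then have "integrable N (\<lambda>\<omega>. (\<omega> m)\<^sup>2)" by (subst (asm) integrable_distr_eq) auto
    then show ?thesis by (simp add: Y_def power_mult_distrib)
  qed
  show "(\<integral>\<omega>. iexp (\<Sum>m\<in>J. t m * Y m \<omega>) \<partial>N) = complex_of_real (exp (- (\<Sum>m\<in>J. (t m)\<^sup>2 * v m) / 2))" if J: "finite J"
  proof -
    let ?f = "\<lambda>m x. iexp (t m * sqrt (v m) * x)"
    have "(\<integral>\<omega>. iexp (\<Sum>m\<in>J. t m * Y m \<omega>) \<partial>N) = (\<integral>\<omega>. (\<Prod>m\<in>J. ?f m (\<omega> m)) \<partial>N)"
      by (simp add: Y_def exp_sum[OF J, symmetric] sum_distrib_left mult_ac)
    also have "\<dots> = (\<Prod>m\<in>J. \<integral>\<omega>. ?f m (\<omega> m) \<partial>N)"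
    proof (rule indep_vars_lebesgue_integral[OF J])
      show "indep_vars (\<lambda>_. borel) (\<lambda>m \<omega>. ?f m (\<omega> m)) J"
        by (rule indep_vars_compose2[OF ind[of J], where Y = ?f]) measurable
      show "integrable N (\<lambda>\<omega>. ?f m (\<omega> m))" for m
        by (rule integrable_iexp_rv[OF N]) measurable
    qed
    also have "\<dots> = (\<Prod>m\<in>J. complex_of_real (exp (- ((t m)\<^sup>2 * v m) / 2)))"
    proof (rule prod.cong[OF refl])
      fix m
      have "(\<integral>\<omega>. ?f m (\<omega> m) \<partial>N) = (\<integral>x. ?f m x \<partial>?D)" by (rule int) measurable
      also have "\<dots> = char ?D (t m * sqrt (v m))" by (simp add: char_def)
      also have "\<dots> = complex_of_real (exp (- ((t m)\<^sup>2 * v m) / 2))"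
        unfolding char_std_normal_distribution using v[of m] by (simp add: power_mult_distrib)
      finally show "(\<integral>\<omega>. ?f m (\<omega> m) \<partial>N) = complex_of_real (exp (- ((t m)\<^sup>2 * v m) / 2))" .
    qed
    also have "\<dots> = complex_of_real (exp (- (\<Sum>m\<in>J. (t m)\<^sup>2 * v m) / 2))"
      unfolding of_real_prod[symmetric] exp_sum[OF J, symmetric]
      by (simp add: sum_negf sum_divide_distrib)
    finally show ?thesis .
  qed
qed

theorem mainTheorem2:
  fixes M :: "nat \<Rightarrow> 'a measure"
    and a :: "nat \<Rightarrow> nat \<Rightarrow> nat \<Rightarrow> 'a \<Rightarrow> complex"
    and P :: "'b measure"
    and A :: "'b \<Rightarrow> complex"
    and s :: real
  assumes "\<And>n. prob_space (M n)"
    and "\<And>n p q \<omega>. p < n \<Longrightarrow> q < n \<Longrightarrow> \<omega> \<in> space (M n) \<Longrightarrow> a n q p \<omega> = cnj (a n p q \<omega>)"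
    and "\<And>n. prob_space.indep_vars (M n) (\<lambda>_. borel) (\<lambda>(p, q). a n p q)
               {(p, q). p \<le> q \<and> q < n}"
    and "\<And>n p q. p \<le> q \<Longrightarrow> q < n \<Longrightarrow> (\<integral>\<omega>. a n p q \<omega> \<partial>M n) = 0"
    and "\<And>k. (SUP (n, p, q) \<in> {(n, p, q). p < n \<and> q < n}.
               \<integral>\<^sup>+\<omega>. ennreal (cmod (a n p q \<omega>) ^ k) \<partial>M n) < \<infinity>"
    and "prob_space P"
    and "A \<in> borel_measurable P"
    and "\<And>n p q. p < q \<Longrightarrow> q < n \<Longrightarrow> distr (M n) borel (a n p q) = distr P borel A"
    and "(\<integral>\<omega>. cmod (A \<omega>) ^ 2 \<partial>P) = s ^ 2"
    and "s ^ 2 > 0"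
  shows "\<exists>(N :: (nat \<Rightarrow> real) measure) (Y :: nat \<Rightarrow> (nat \<Rightarrow> real) \<Rightarrow> real).
    prob_space N \<and>
    prob_space.indep_vars N (\<lambda>_. borel) Y {2..} \<and>
    (\<forall>m\<ge>2. centered_gaussian N (Y m)) \<and>
    (\<integral>\<omega>. Y 2 \<omega> ^ 2 \<partial>N)
      = 2 * ((\<integral>\<omega>. cmod (A \<omega>) ^ 4 \<partial>P) - (\<integral>\<omega>. cmod (A \<omega>) ^ 2 \<partial>P) ^ 2) \<and>
    (\<forall>m\<ge>3. complex_of_real (\<integral>\<omega>. Y m \<omega> ^ 2 \<partial>N)
      = of_nat m * complex_of_real (\<integral>\<omega>. cmod (A \<omega>) ^ 2 \<partial>P) ^ m
        + of_nat m * (\<Sum>k = 1..m div 2. of_int (eulerian (m - 1) k) / fact (m - 1) *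
            ((\<integral>\<omega>. A \<omega> ^ 2 \<partial>P) ^ k * (\<integral>\<omega>. cnj (A \<omega>) ^ 2 \<partial>P) ^ (m - k)
             + of_bool (2 * k \<noteq> m) *
               ((\<integral>\<omega>. A \<omega> ^ 2 \<partial>P) ^ (m - k) * (\<integral>\<omega>. cnj (A \<omega>) ^ 2 \<partial>P) ^ k)))) \<and>
    joint_conv_distr M
      (\<lambda>n m \<omega>. trace_mat (poly_mat (cheb_scaled m s) (wigner_mat n (\<lambda>p q. a n p q \<omega>)))
        - (\<integral>\<omega>'. trace_mat (poly_mat (cheb_scaled m s) (wigner_mat n (\<lambda>p q. a n p q \<omega>'))) \<partial>M n))
      N (\<lambda>m \<omega>. complex_of_real (Y m \<omega>)) {2..}"
proof -
  interpret wigner M a P A s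
    by (rule wigner.intro; fact assms)
  \<comment> \<open>Indices below 2 lie outside the family; the value 0 there keeps \<open>v\<close>
    nonnegative for the product construction.\<close>
  define v where "v m = (if m \<ge> 2 then Re (cov_limit m) else 0)" for m
  have v: "v m \<ge> 0" "m \<ge> 2 \<Longrightarrow> cov_limit m = complex_of_real (v m)" for m
    using cov_limit_nonneg[of m] by (auto simp: v_def)
  define N where "N = PiM (UNIV :: nat set) (\<lambda>_. std_normal_distribution)"
  define Y where "Y = (\<lambda>m \<omega>. sqrt (v m) * (\<omega> m :: real))"
  note NY = std_normal_product[OF v(1) N_def Y_def]
  have sq: "(\<integral>\<omega>. Y m \<omega> ^ 2 \<partial>N) = v m" for m by (rule NY(4))
  have var2: "(\<integral>\<omega>. Y 2 \<omega> ^ 2 \<partial>N)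
      = 2 * ((\<integral>\<omega>. cmod (A \<omega>) ^ 4 \<partial>P) - (\<integral>\<omega>. cmod (A \<omega>) ^ 2 \<partial>P) ^ 2)"
  proof -
    have "complex_of_real (v 2) = complex_of_real (2 * ((\<integral>\<omega>. cmod (A \<omega>) ^ 4 \<partial>P) - (s\<^sup>2)\<^sup>2))"
      using v(2)[of 2] by (simp add: cov_limit_def fourth_def)
    then have "v 2 = 2 * ((\<integral>\<omega>. cmod (A \<omega>) ^ 4 \<partial>P) - (s\<^sup>2)\<^sup>2)" by (simp only: of_real_eq_iff)
    then show ?thesis by (simp only: sq second_moment)
  qed
  have var: "complex_of_real (\<integral>\<omega>. Y m \<omega> ^ 2 \<partial>N)
      = of_nat m * complex_of_real (\<integral>\<omega>. cmod (A \<omega>) ^ 2 \<partial>P) ^ m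
        + of_nat m * (\<Sum>k = 1..m div 2. of_int (eulerian (m - 1) k) / fact (m - 1) *
            (pvar ^ k * pvar_cnj ^ (m - k)
             + of_bool (2 * k \<noteq> m) * (pvar ^ (m - k) * pvar_cnj ^ k)))"
    if m: "m \<ge> 3" for m
  proof -
    \<comment> \<open>The upper half of the range is reflected by k \<mapsto> m - k, under which the
      Eulerian numbers of order m - 1 are invariant.\<close>
    have "(\<Sum>k=1..m - 1. of_int (eulerian (m - 1) k) / fact (m - 1) * (pvar ^ k * pvar_cnj ^ (m - k))) =
       (\<Sum>k = 1..m div 2. of_int (eulerian (m - 1) k) / fact (m - 1) *
            (pvar ^ k * pvar_cnj ^ (m - k) + of_bool (2 * k \<noteq> m) * (pvar ^ (m - k) * pvar_cnj ^ k)))"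
      unfolding sum_half_range
    proof (rule sum.cong[OF refl])
      fix k assume "k \<in> {1..m div 2}"
      then have k: "k \<le> m" by auto
      have "eulerian (m - 1) (m - k) = eulerian (m - 1) k"
        using eulerian_symmetric[of "m - 1" k] m k by simp
      moreover have "m - (m - k) = k" using k by simp
      ultimately show "of_int (eulerian (m - 1) k) / fact (m - 1) * (pvar ^ k * pvar_cnj ^ (m - k)) +
          of_bool (2 * k \<noteq> m) * (of_int (eulerian (m - 1) (m - k)) / fact (m - 1) *
            (pvar ^ (m - k) * pvar_cnj ^ (m - (m - k)))) =
          of_int (eulerian (m - 1) k) / fact (m - 1) *
            (pvar ^ k * pvar_cnj ^ (m - k) + of_bool (2 * k \<noteq> m) * (pvar ^ (m - k) * pvar_cnj ^ k))"
        by (simp add: distrib_left)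
    qed
    then show ?thesis using v(2)[of m] m unfolding sq second_moment by (simp add: cov_limit_def)
  qed
  have conv: "joint_conv_distr M
      (\<lambda>n m \<omega>. trace_mat (poly_mat (cheb_scaled m s) (wigner_mat n (\<lambda>p q. a n p q \<omega>)))
        - (\<integral>\<omega>'. trace_mat (poly_mat (cheb_scaled m s) (wigner_mat n (\<lambda>p q. a n p q \<omega>'))) \<partial>M n))
      N (\<lambda>m \<omega>. complex_of_real (Y m \<omega>)) {2..}"
    unfolding joint_conv_distr_def
  proof (intro allI impI, elim conjE)
    fix J and f :: "(nat \<Rightarrow> complex) \<Rightarrow> real"
    assume J: "finite J" "J \<subseteq> {2..}"
      and f: "continuous_map (product_topology (\<lambda>_. euclidean) J) euclideanreal f"
      and bdd: "bounded (f ` (\<Pi>\<^sub>E j\<in>J. UNIV))"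
    \<comment> \<open>All variables are real, so the test function on complex vectors is pulled back
      along the embedding of real ones.\<close>
    define F where "F x = f (\<lambda>j\<in>J. complex_of_real (x j))" for x :: "nat \<Rightarrow> real"
    obtain B where B: "\<And>x. x \<in> (\<Pi>\<^sub>E j\<in>J. UNIV) \<Longrightarrow> \<bar>f x\<bar> \<le> B"
      using bdd unfolding bounded_iff by auto
    have FB: "\<bar>F x\<bar> \<le> B" for x unfolding F_def by (rule B) auto
    have "continuous_map euclidean (product_topology (\<lambda>_. euclidean) J)
        (\<lambda>x :: nat \<Rightarrow> real. \<lambda>j\<in>J. complex_of_real (x j))"
      unfolding continuous_map_componentwise
      by (auto intro!: continuous_intros continuous_on_product_coordinates)
    from continuous_map_compose[OF this f] have cont: "continuous_on UNIV F"
      by (simp add: F_def[abs_def] comp_def)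
    have one: "finite {j}" "{j} \<subseteq> {2..}" if "j \<in> J" for j using that J(2) by auto
    have lim: "(\<lambda>n. \<integral>\<omega>. F (\<lambda>j. if j \<in> J then Re (stat n j \<omega>) else 0) \<partial>M n) \<longlonglongrightarrow>
        (\<integral>\<omega>. F (\<lambda>j. if j \<in> J then Y j \<omega> else 0) \<partial>N)"
    proof (rule charfun_imp_weak_conv[OF prob NY(1) J(1), where v = v and B = B])
      show "(\<lambda>\<omega>. Re (stat n j \<omega>)) \<in> borel_measurable (M n)" if "j \<in> J" for n j
        using dep_measurable[OF dep_stat[of j n]] that J(2) by (auto intro: borel_measurable_Re)
      show "Y j \<in> borel_measurable N" for j using NY(3)[of j] by (simp add: centered_gaussian_def)
      show "integrable (M n) (\<lambda>\<omega>. (Re (stat n j \<omega>))\<^sup>2)" if "j \<in> J" for n j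
        using integrable_Re_stat_power(1)[OF one[OF that], of n "\<lambda>_. 1" 2] by simp
      show "(\<lambda>n. \<integral>\<omega>. (Re (stat n j \<omega>))\<^sup>2 \<partial>M n) \<longlonglongrightarrow> v j" if "j \<in> J" for j
      proof -
        have "(\<lambda>n. \<integral>\<omega>. (lin_stat {j} (\<lambda>_. 1) n \<omega>)\<^sup>2 \<partial>M n) \<longlonglongrightarrow> complex_of_real (v j)"
          using integral_lin_stat_sq_tendsto[OF one[OF that], of "\<lambda>_. 1"] v(2)[of j] that J(2) by auto
        then show ?thesis
          unfolding integrable_Re_stat_power(2)[OF one[OF that], symmetric] tendsto_of_real_iff by simp
      qed
      show "integrable N (\<lambda>\<omega>. (Y j \<omega>)\<^sup>2)" for j by (rule NY(5))
      show "(\<lambda>n. \<integral>\<omega>. iexp (\<Sum>j\<in>J. t j * Re (stat n j \<omega>)) \<partial>M n) \<longlonglongrightarrow> (\<integral>\<omega>. iexp (\<Sum>j\<in>J. t j * Y j \<omega>) \<partial>N)" for t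
      proof -
        have "(\<Sum>m\<in>J. (t m)\<^sup>2 * Re (cov_limit m)) = (\<Sum>m\<in>J. (t m)\<^sup>2 * v m)"
          using J(2) by (intro sum.cong refl) (auto simp: v_def)
        then show ?thesis using charfun_stat_tendsto[OF J, of t] unfolding NY(6)[OF J(1)] by simp
      qed
    qed (use cont FB in auto)
    have eqV: "F (\<lambda>j. if j \<in> J then Y j \<omega> else 0) = f (\<lambda>j\<in>J. complex_of_real (Y j \<omega>))" for \<omega>
      unfolding F_def by (rule arg_cong[of _ _ f]) auto
    \<comment> \<open>The walk expansion of the trace divides by sqrt n, so it is available from n =
      1 on, which is enough for the limit.\<close>
    have eqU: "(\<integral>\<omega>. F (\<lambda>j. if j \<in> J then Re (stat n j \<omega>) else 0) \<partial>M n) =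
       (\<integral>\<omega>. f (\<lambda>j\<in>J. trace_mat (poly_mat (cheb_scaled j s) (wigner_mat n (\<lambda>p q. a n p q \<omega>)))
        - (\<integral>\<omega>'. trace_mat (poly_mat (cheb_scaled j s) (wigner_mat n (\<lambda>p q. a n p q \<omega>'))) \<partial>M n)) \<partial>M n)"
      if n: "n \<ge> 1" for n
    proof (rule Bochner_Integration.integral_cong[OF refl])
      fix \<omega> assume \<omega>: "\<omega> \<in> space (M n)"
      have "trace_mat (poly_mat (cheb_scaled j s) (wigner_mat n (\<lambda>p q. a n p q \<omega>)))
        - (\<integral>\<omega>'. trace_mat (poly_mat (cheb_scaled j s) (wigner_mat n (\<lambda>p q. a n p q \<omega>'))) \<partial>M n) =
          complex_of_real (Re (stat n j \<omega>))" if "j \<in> J" for j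
        using trace_centered_eq_stat[OF _ _ \<omega>, of j] stat_real[OF _ \<omega>, of j] that J(2) n by auto
      then show "F (\<lambda>j. if j \<in> J then Re (stat n j \<omega>) else 0) =
        f (\<lambda>j\<in>J. trace_mat (poly_mat (cheb_scaled j s) (wigner_mat n (\<lambda>p q. a n p q \<omega>)))
        - (\<integral>\<omega>'. trace_mat (poly_mat (cheb_scaled j s) (wigner_mat n (\<lambda>p q. a n p q \<omega>'))) \<partial>M n))"
        unfolding F_def by (intro arg_cong[of _ _ f]) (auto simp: fun_eq_iff)
    qed
    show "(\<lambda>n. \<integral>\<omega>. f (\<lambda>j\<in>J. trace_mat (poly_mat (cheb_scaled j s) (wigner_mat n (\<lambda>p q. a n p q \<omega>)))
        - (\<integral>\<omega>'. trace_mat (poly_mat (cheb_scaled j s) (wigner_mat n (\<lambda>p q. a n p q \<omega>'))) \<partial>M n)) \<partial>M n)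
      \<longlonglongrightarrow> (\<integral>\<omega>. f (\<lambda>j\<in>J. complex_of_real (Y j \<omega>)) \<partial>N)"
      by (rule Lim_transform_eventually[OF lim[unfolded eqV] eventually_sequentiallyI[OF eqU]])
  qed
  show ?thesis
    using NY(1,2,3) var2 var conv by (intro exI[of _ N] exI[of _ Y]) blast
qed

end
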